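(* Let $p_1$, $p_2$, $\tilde p_1$ and $\tilde p_2$ be four finite real numbers, with $p_1<p_2$, such that $[p_1,p_2]\subset(\tilde p_1,\tilde p_2)$. Let $f$ be a symbol as in the context, and let $u_0\in\mathcal S(\mathbb R)$ satisfy $\mathrm{supp}\,\mathcal F u_0\subseteq[p_1,p_2]$ and $\|u_0\|_{L^2(\mathbb R)}=1$. For $(t_0,x_0)\in\mathbb R^2$, consider the following two estimates (E1) and (E2), where $\delta$ is arbitrarily chosen in $\big(\frac12,\frac34\big)$. (E1) For all $(t,x)\in\mathfrak C_f\big([\tilde p_1,\tilde p_2],(t_0,x_0)\big)$, with $p_0(t,x):=(f')^{-1}\big(\frac{x-x_0}{t-t_0}\big)$, $$\left|u_f(t,x)-\frac1{\sqrt{2\pi}}\,e^{-\mathrm{sgn}(t-t_0)i\frac\pi4}\,e^{-itf(p_0(t,x))+ixp_0(t,x)}\,\frac{\mathcal F u_0(p_0(t,x))}{\sqrt{f''(p_0(t,x))}}\,|t-t_0|^{-\frac12}\right|$$ $$\leqslant\Big(C_5(f,\delta,\tilde p_1,\tilde p_2)\,\|(\cdot-x_0)u_f(t_0,\cdot)\|_{L^2(\mathbb R)}+C_6(f,\delta,\tilde p_1,\tilde p_2)\,\|u_0\|_{L^1(\mathbb R)}\Big)|t-t_0|^{-\delta}.$$ (E2) For all $(t,x)\in\mathfrak C_f\big([\tilde p_1,\tilde p_2],(t_0,x_0)\big)^c$, $$|u_f(t,x)|\leqslant\Big(C_7(f,p_1,p_2,\tilde p_1,\tilde p_2)\,\|(\cdot-x_0)u_f(t_0,\cdot)\|_{L^2(\mathbb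 R)}+C_8(f,p_1,p_2,\tilde p_1,\tilde p_2)\,\|u_0\|_{L^1(\mathbb R)}\Big)|t-t_0|^{-1}.$$ Then the $(t_0,x_0)$-dependent right-hand sides of the estimates (E1) and (E2) have a global minimum at the point $(t^*,x^* )\in\mathbb R^2$ with $$t^*=\operatorname*{arg\,min}_{\tau\in\mathbb R}\mathcal V\big(u_f(\tau,\cdot)\big),\qquad x^*=\mathcal M_1\big(u_f(t^*,\cdot)\big).$$ In this case, for all $(t,x)\in\mathfrak C_f\big([\tilde p_1,\tilde p_2],(t^*,x^* )\big)$, we have $$\left|u_f(t,x)-\frac1{\sqrt{2\pi}}\,e^{-\mathrm{sgn}(t-t^* )i\frac\pi4}\,e^{-itf(p_0(t,x))+ixp_0(t,x)}\,\frac{\mathcal F u_0(p_0(t,x))}{\sqrt{f''(p_0(t,x))}}\,|t-t^*|^{-\frac12}\right|$$ $$\leqslant\Big(C_5(f,\delta,\tilde p_1,\tilde p_2)\min_{\tau\in\mathbb R}\Big(\sqrt{\mathcal V(u_f(\tau,\cdot))}\Big)+C_6(f,\delta,\tilde p_1,\tilde p_2)\,\|u_0\|_{L^1(\mathbb R)}\Big)|t-t^*|^{-\delta},$$ where $\delta$ is arbitrarily chosen in $\big(\frac12,\frac34\big)$ and now $p_0(t,x):=(f')^{-1}\big(\frac{x-x^*}{t-t^*}\big)$, and for all $(t,x)\in\mathfrak C_f\big([\tilde p_1,\tilde p_2],(t^*,x^* )\big)^c$ we have $$|u_f(t,x)|\leqslant\Big(C_7(f,p_1,p_2,\tilde p_1,\tilde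 p_2)\min_{\tau\in\mathbb R}\Big(\sqrt{\mathcal V(u_f(\tau,\cdot))}\Big)+C_8(f,p_1,p_2,\tilde p_1,\tilde p_2)\,\|u_0\|_{L^1(\mathbb R)}\Big)|t-t^*|^{-1}.$$
   Context: Fourier transform: $\mathcal F u(p)=\int_{\mathbb R}u(x)e^{-ixp}\,dx$. $\mathcal S(\mathbb R)$ is the Schwartz space. The symbol $f:\mathbb R\to\mathbb R$ is $\mathcal C^\infty$, all its derivatives grow at most polynomially at infinity, and $f$ is strictly convex in the sense $f''>0$ on $\mathbb R$. The wave packet is $u_f(t,x)=\frac1{2\pi}\int_{\mathbb R}\mathcal F u_0(p)\,e^{-itf(p)+ixp}\,dp$, the solution of $[i\partial_t-f(D)]u_f(t)=0$, $u_f(0)=u_0$, where $f(D)u=\mathcal F^{-1}(f\,\mathcal F u)$. Space-time cone: for $(t_0,x_0)\in\mathbb R^2$, $$\mathfrak C_f\big([\tilde p_1,\tilde p_2],(t_0,x_0)\big)=\Big\{(t,x)\in(\mathbb R\setminus\{t_0\})\times\mathbb R\;\Big|\;f'(\tilde p_1)\leqslant\tfrac{x-x_0}{t-t_0}\leqslant f'(\tilde p_2)\Big\},$$ and $\mathfrak C_f\big([\tilde p_1,\tilde p_2],(t_0,x_0)\big)^c$ is its complement in $(\mathbb R\setminus\{t_0\})\times\mathbb R$. For $u$ with $\|u\|_{L^2(\mathbb R)}=1$: $\mathcal M_1(u)=\int_{\mathbb R}x|u(x)|^2dx$, $\mathcal M_2(u)=\int_{\mathbb R}x^2|u(x)|^2dx$,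 $\mathcal V(u)=\mathcal M_2(u)-\mathcal M_1(u)^2$. Constants (with $\|\cdot\|_\infty$ the norm of $L^\infty(\tilde p_1,\tilde p_2)$ and $m=\min_{[\tilde p_1,\tilde p_2]}f''$): $L(\delta)=\frac{\sqrt\pi}2\Big(\frac1{2\sqrt\pi}+\sqrt{\frac1{4\pi}+\frac12}\Big)^{2\delta-1}$; $C_5(f,\delta,\tilde p_1,\tilde p_2)=\frac{2^{\delta+\frac12}L(\delta)}{\sqrt\pi\sqrt{3-4\delta}}(\tilde p_2-\tilde p_1)^{\frac{3-4\delta}2}\,\|f''\|_\infty^{\frac32-\delta}m^{-\frac32}$; $C_6(f,\delta,\tilde p_1,\tilde p_2)=\frac{2^{\delta-2}L(\delta)}{\pi(1-\delta)}(\tilde p_2-\tilde p_1)^{2-2\delta}\Big(\|f''\|_\infty^{\frac52-\delta}\|f^{(3)}\|_\infty m^{-\frac72}+\frac13\|f''\|_\infty^{\frac72-\delta}\|f^{(3)}\|_\infty m^{-\frac92}\Big)$; $C_7(f,p_1,p_2,\tilde p_1,\tilde p_2)=\frac1{\sqrt{2\pi}}(p_2-p_1)^{\frac12}\min\{f'(p_1)-f'(\tilde p_1),f'(\tilde p_2)-f'(p_2)\}^{-1}$; $C_8(f,p_1,p_2,\tilde p_1,\tilde p_2)=\frac1{2\pi}\min\{f'(p_1)-f'(\tilde p_1),f'(\tilde p_2)-f'(p_2)\}^{-1}$.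
   Formalization: The global minimum of the right-hand sides of (E1) and (E2) is stated in (t_0,x_0) with the elapsed time t−t_0 in the decay factor held fixed (nonzero); at fixed t, the factor |t−t_0| also varies with t_0 and the literal claim fails. *)

theory Defs
  imports
    "HOL-Analysis.Analysis"
    "HOL-Library.Landau_Symbols"
    "HOL-Probability.Essential_Supremum"
begin

text \<open>Iterated derivatives of a function of one real variable; they are meaningful only for
  functions all of whose iterated derivatives are differentiable, which \<open>schwartz\<close> requires.\<close>

definition nth_vderiv :: "nat \<Rightarrow> (real \<Rightarrow> 'a::real_normed_vector) \<Rightarrow> real \<Rightarrow> 'a" where
  "nth_vderiv n u = ((\<lambda>g x. vector_derivative g (at x)) ^^ n) u"

definition schwartz :: "(real \<Rightarrow> complex) \<Rightarrow> bool" where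
  "schwartz u \<longleftrightarrow>
     (\<forall>n x. nth_vderiv n u differentiable (at x)) \<and>
     (\<forall>n k. bounded (range (\<lambda>x. \<bar>x\<bar> ^ k *\<^sub>R nth_vderiv n u x)))"

definition is_symbol :: "(real \<Rightarrow> real) \<Rightarrow> bool" where
  "is_symbol f \<longleftrightarrow>
     (\<forall>n x. (deriv ^^ n) f field_differentiable (at x)) \<and>
     (\<forall>n. \<exists>k. (deriv ^^ n) f \<in> O[at_infinity](\<lambda>x. x ^ k)) \<and>
     (\<forall>x. (deriv ^^ 2) f x > 0)"

definition fourier :: "(real \<Rightarrow> complex) \<Rightarrow> real \<Rightarrow> complex" where
  "fourier u p = (\<integral>x. u x * exp (- \<i> * x * p) \<partial>lborel)"

definition wave_packet :: "(real \<Rightarrow> real) \<Rightarrow> (real \<Rightarrow> complex) \<Rightarrow> real \<Rightarrow> real \<Rightarrow> complex" where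
  "wave_packet f u0 t x =
     1 / (2 * pi) * (\<integral>p. fourier u0 p * exp (- \<i> * t * f p + \<i> * x * p) \<partial>lborel)"

text \<open>The Bochner integral of a non-integrable function is \<open>0\<close>, so the next four definitions
  have their usual meaning only where the integrands are integrable; this holds for Schwartz
  functions and their products with polynomials.\<close>

definition L1_norm :: "(real \<Rightarrow> complex) \<Rightarrow> real" where
  "L1_norm u = (\<integral>x. cmod (u x) \<partial>lborel)"

definition L2_norm :: "(real \<Rightarrow> complex) \<Rightarrow> real" where
  "L2_norm u = sqrt (\<integral>x. (cmod (u x))\<^sup>2 \<partial>lborel)"

definition moment1 :: "(real \<Rightarrow> complex) \<Rightarrow> real" where
  "moment1 u = (\<integral>x. x * (cmod (u x))\<^sup>2 \<partial>lborel)"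

definition moment2 :: "(real \<Rightarrow> complex) \<Rightarrow> real" where
  "moment2 u = (\<integral>x. x\<^sup>2 * (cmod (u x))\<^sup>2 \<partial>lborel)"

definition pos_variance :: "(real \<Rightarrow> complex) \<Rightarrow> real" where
  "pos_variance u = moment2 u - (moment1 u)\<^sup>2"

definition st_cone :: "(real \<Rightarrow> real) \<Rightarrow> real \<Rightarrow> real \<Rightarrow> real \<times> real \<Rightarrow> (real \<times> real) set" where
  "st_cone f q1 q2 = (\<lambda>(t0, x0). {(t, x). t \<noteq> t0 \<and>
     deriv f q1 \<le> (x - x0) / (t - t0) \<and> (x - x0) / (t - t0) \<le> deriv f q2})"

definition st_cone_compl :: "(real \<Rightarrow> real) \<Rightarrow> real \<Rightarrow> real \<Rightarrow> real \<times> real \<Rightarrow> (real \<times> real) set" where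
  "st_cone_compl f q1 q2 = (\<lambda>(t0, x0). (- {t0}) \<times> UNIV - st_cone f q1 q2 (t0, x0))"

text \<open>Stationary momentum \<open>p\<^sub>0(t,x)\<close>. In the cone the quotient lies in the range of \<open>f'\<close>, which
  is injective for a symbol, so \<open>inv\<close> is the genuine inverse there.\<close>

definition stat_momentum :: "(real \<Rightarrow> real) \<Rightarrow> real \<times> real \<Rightarrow> real \<Rightarrow> real \<Rightarrow> real" where
  "stat_momentum f = (\<lambda>(t0, x0) t x. inv (deriv f) ((x - x0) / (t - t0)))"

definition leading_term ::
  "(real \<Rightarrow> real) \<Rightarrow> (real \<Rightarrow> complex) \<Rightarrow> real \<times> real \<Rightarrow> real \<Rightarrow> real \<Rightarrow> complex" where
  "leading_term f u0 = (\<lambda>(t0, x0) t x. let p0 = stat_momentum f (t0, x0) t x in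
     1 / sqrt (2 * pi) * exp (- complex_of_real (sgn (t - t0)) * \<i> * (pi / 4))
       * exp (- \<i> * t * f p0 + \<i> * x * p0)
       * (fourier u0 p0 / sqrt ((deriv ^^ 2) f p0)) * complex_of_real (\<bar>t - t0\<bar> powr (- 1/2)))"

definition Linf_norm :: "real \<Rightarrow> real \<Rightarrow> (real \<Rightarrow> real) \<Rightarrow> real" where
  "Linf_norm a b g = real_of_ereal (esssup (lebesgue_on {a<..<b}) (\<lambda>x. ereal \<bar>g x\<bar>))"

definition L_const :: "real \<Rightarrow> real" where
  "L_const \<delta> = sqrt pi / 2 * (1 / (2 * sqrt pi) + sqrt (1 / (4 * pi) + 1 / 2)) powr (2 * \<delta> - 1)"

text \<open>In \<open>C5\<close> and \<open>C6\<close> the infimum \<open>m\<close> is an attained minimum, by continuity of \<open>f''\<close>.\<close>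

definition C5 :: "(real \<Rightarrow> real) \<Rightarrow> real \<Rightarrow> real \<Rightarrow> real \<Rightarrow> real" where
  "C5 f \<delta> q1 q2 =
     (let N2 = Linf_norm q1 q2 ((deriv ^^ 2) f);
          m = (INF p\<in>{q1..q2}. (deriv ^^ 2) f p)
      in 2 powr (\<delta> + 1/2) * L_const \<delta> / (sqrt pi * sqrt (3 - 4 * \<delta>))
         * (q2 - q1) powr ((3 - 4 * \<delta>) / 2) * N2 powr (3/2 - \<delta>) * m powr (- 3/2))"

definition C6 :: "(real \<Rightarrow> real) \<Rightarrow> real \<Rightarrow> real \<Rightarrow> real \<Rightarrow> real" where
  "C6 f \<delta> q1 q2 =
     (let N2 = Linf_norm q1 q2 ((deriv ^^ 2) f);
          N3 = Linf_norm q1 q2 ((deriv ^^ 3) f);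
          m = (INF p\<in>{q1..q2}. (deriv ^^ 2) f p)
      in 2 powr (\<delta> - 2) * L_const \<delta> / (pi * (1 - \<delta>)) * (q2 - q1) powr (2 - 2 * \<delta>)
         * (N2 powr (5/2 - \<delta>) * N3 * m powr (- 7/2)
            + 1/3 * (N2 powr (7/2 - \<delta>) * N3 * m powr (- 9/2))))"

definition C7 :: "(real \<Rightarrow> real) \<Rightarrow> real \<Rightarrow> real \<Rightarrow> real \<Rightarrow> real \<Rightarrow> real" where
  "C7 f p1 p2 q1 q2 = 1 / sqrt (2 * pi) * (p2 - p1) powr (1/2)
     * inverse (min (deriv f p1 - deriv f q1) (deriv f q2 - deriv f p2))"

definition C8 :: "(real \<Rightarrow> real) \<Rightarrow> real \<Rightarrow> real \<Rightarrow> real \<Rightarrow> real \<Rightarrow> real" where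
  "C8 f p1 p2 q1 q2 = 1 / (2 * pi)
     * inverse (min (deriv f p1 - deriv f q1) (deriv f q2 - deriv f p2))"

text \<open>Right-hand sides of the estimate inside the cone (\<open>rhs_in\<close>) and outside it (\<open>rhs_out\<close>)
  for the origin \<open>(t\<^sub>0,x\<^sub>0)\<close>; the argument \<open>s\<close> is the elapsed time \<open>t - t\<^sub>0\<close>.\<close>

definition rhs_in :: "(real \<Rightarrow> real) \<Rightarrow> (real \<Rightarrow> complex) \<Rightarrow> real \<Rightarrow> real \<Rightarrow> real \<Rightarrow>
    real \<times> real \<Rightarrow> real \<Rightarrow> real" where
  "rhs_in f u0 \<delta> q1 q2 = (\<lambda>(t0, x0) s.
     (C5 f \<delta> q1 q2 * L2_norm (\<lambda>x. (x - x0) * wave_packet f u0 t0 x)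
      + C6 f \<delta> q1 q2 * L1_norm u0) * \<bar>s\<bar> powr (- \<delta>))"

definition rhs_out :: "(real \<Rightarrow> real) \<Rightarrow> (real \<Rightarrow> complex) \<Rightarrow> real \<Rightarrow> real \<Rightarrow> real \<Rightarrow> real \<Rightarrow>
    real \<times> real \<Rightarrow> real \<Rightarrow> real" where
  "rhs_out f u0 p1 p2 q1 q2 = (\<lambda>(t0, x0) s.
     (C7 f p1 p2 q1 q2 * L2_norm (\<lambda>x. (x - x0) * wave_packet f u0 t0 x)
      + C8 f p1 p2 q1 q2 * L1_norm u0) * inverse \<bar>s\<bar>)"

end

theory Submission
  imports Defs
    "HOL-Complex_Analysis.Cauchy_Integral_Theorem"
    "HOL-Probability.Characteristic_Functions"
    "HOL-Probability.Sinc_Integral"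
    "HOL-Real_Asymp.Real_Asymp"
begin

text \<open>
  Everything rests on one identity. Put
  \<open>g(p) = \<F>u\<^sub>0(p) e\<^bsup>i(\<xi>p - \<tau>f(p))\<^esup>\<close>. Up to the factor \<open>2\<pi>\<close> and a reflection its Fourier transform is the packet at
  time \<open>\<tau>\<close> centred at \<open>\<xi>\<close>, so multiplication of the packet by \<open>x - \<xi>\<close> corresponds to
  differentiation of \<open>g\<close>, and Plancherel's identity gives
  \<open>\<parallel>(\<cdot> - \<xi>) u\<^sub>f(\<tau>,\<cdot>)\<parallel>\<^sup>2 = \<parallel>g'\<parallel>\<^sup>2 / 2\<pi>\<close>. This number, called \<open>spread \<tau> \<xi>\<close> below, is the only way in
  which the origin of the cone enters the two error bounds.

  For the choice of the origin: since \<open>g'\<close> is affine in \<open>(\<tau>, \<xi>)\<close> up to a phase,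
  \<open>spread\<close> is a quadratic polynomial. Its minimum over \<open>\<xi>\<close>, attained at the mean position, is the
  variance, which is therefore quadratic in \<open>\<tau>\<close>. The coefficient of \<open>\<tau>\<^sup>2\<close> is the variance of the
  group velocity \<open>f'\<close> under the probability density \<open>|\<F>u\<^sub>0|\<^sup>2 / 2\<pi>\<close>; it is positive because \<open>f'\<close> is
  injective (\<open>spread_quadratic\<close>). So the variance has a unique minimiser, and it yields the global minimum of
  \<open>spread\<close> and, as the constants in front of it are nonnegative, of both right-hand sides.

  For the error bounds: with \<open>s = t - t\<^sub>0\<close> and \<open>c = (x - x\<^sub>0)/s\<close> the packet is
  \<open>1/2\<pi>\<close> times the oscillatory integral of \<open>g(p) e\<^bsup>is(cp - f(p))\<^esup>\<close>. Outside the cone \<open>c - f'\<close> is bounded away from \<open>0\<close> on the support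
  of \<open>g\<close>, and one integration by parts suffices (\<open>nonstationary_phase\<close>). Inside the cone the phase is stationary at
  \<open>p\<^sub>0\<close>. On either side of \<open>p\<^sub>0\<close> one integrates by parts against a primitive of the Fresnel
  kernel in the variable \<open>z = sqrt (f(p) - f(p\<^sub>0) - f'(p\<^sub>0)(p - p\<^sub>0))\<close>: the boundary term
  is half of the leading term, and the remainder is controlled by the bound
  \<open>L(\<delta>) |s|\<^bsup>-\<delta>\<^esup> z\<^bsup>1-2\<delta>\<^esup>\<close> on that primitive (\<open>fresnel_primitive\<close>), by the Cauchy-Schwarz
  inequality for the part with \<open>g'\<close>, and by Taylor estimates for the
  change of variable (\<open>stationary_phase_half\<close>). The constants obtained in this way are
  no larger than \<open>C5\<close> and \<open>C6\<close>.
\<close>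

section \<open>The Fresnel integral\<close>

lemma gaussian_half_line:
  fixes s :: real
  assumes s: "s > 0"
  shows "((\<lambda>R. integral {0..R} (\<lambda>r. exp (- s * r\<^sup>2))) \<longlongrightarrow> sqrt pi / 2 * s powr (-1/2)) at_top"
    and "integral {0..R} (\<lambda>r. exp (- s * r\<^sup>2)) \<le> sqrt pi / 2 * s powr (-1/2)"
proof -
  let ?f = "\<lambda>x::real. indicator {0..} x *\<^sub>R exp (- s * x\<^sup>2)"
  have "has_bochner_integral lborel (\<lambda>x. indicator {0..} (0 + sqrt s * x) *\<^sub>R exp (- (0 + sqrt s * x)\<^sup>2))
      (sqrt pi / 2 /\<^sub>R \<bar>sqrt s\<bar>)"
    using s gaussian_moment_0 by (subst lborel_has_bochner_integral_real_affine_iff [symmetric]) auto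
  moreover have "(\<lambda>x. indicator {0..} (0 + sqrt s * x) *\<^sub>R exp (- (0 + sqrt s * x)\<^sup>2)) = ?f"
    using s by (auto simp: fun_eq_iff indicator_def power_mult_distrib zero_le_mult_iff)
  moreover have "sqrt pi / 2 /\<^sub>R \<bar>sqrt s\<bar> = sqrt pi / 2 * s powr (-1/2)"
    using s by (simp add: powr_minus powr_half_sqrt divide_simps)
  ultimately have b: "has_bochner_integral lborel ?f (sqrt pi / 2 * s powr (-1/2))"
    by (simp only:)
  then have int: "integrable lborel ?f" and val: "integral\<^sup>L lborel ?f = sqrt pi / 2 * s powr (-1/2)"
    by (auto simp: has_bochner_integral_iff)
  have eq: "(\<integral>x. indicator {..R} x *\<^sub>R ?f x \<partial>lborel) = integral {0..R} (\<lambda>r. exp (- s * r\<^sup>2))" for R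
  proof -
    have "set_integrable lborel {0..R} (\<lambda>r. exp (- s * r\<^sup>2))"
      by (intro borel_integrable_atLeastAtMost' continuous_intros)
    then have "integral {0..R} (\<lambda>r. exp (- s * r\<^sup>2)) = (\<integral>x. indicator {0..R} x *\<^sub>R exp (- s * x\<^sup>2) \<partial>lborel)"
      by (subst set_borel_integral_eq_integral(2) [symmetric]) (auto simp: set_lebesgue_integral_def)
    also have "\<dots> = (\<integral>x. indicator {..R} x *\<^sub>R ?f x \<partial>lborel)"
      by (intro Bochner_Integration.integral_cong) (auto simp: indicator_def)
    finally show ?thesis ..
  qed
  show "((\<lambda>R. integral {0..R} (\<lambda>r. exp (- s * r\<^sup>2))) \<longlongrightarrow> sqrt pi / 2 * s powr (-1/2)) at_top"
    using tendsto_integral_at_top [OF _ int] unfolding eq val by simp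
  have "(\<integral>x. indicator {..R} x *\<^sub>R ?f x \<partial>lborel) \<le> integral\<^sup>L lborel ?f"
    by (intro integral_mono int integrable_mult_indicator) (auto simp: indicator_def)
  then show "integral {0..R} (\<lambda>r. exp (- s * r\<^sup>2)) \<le> sqrt pi / 2 * s powr (-1/2)"
    unfolding eq val .
qed

text \<open>The integrand \<open>exp (-isw\<^sup>2)\<close> is entire, so it has a primitive on the complex plane. Along a
  ray \<open>z + r\<omega>\<close> with \<open>\<omega> = e\<^bsup>-i\<pi>/4\<^esup>\<close> its modulus is \<open>exp (- sqrt 2 s z r - s r\<^sup>2)\<close>, since
  \<open>\<omega>\<^sup>2 = -i\<close>. The primitive that vanishes at the far end of these rays is thus bounded by the
  integral of that modulus over \<open>r \<ge> 0\<close>, and dropping either factor gives one of the two bounds.\<close>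

lemma fresnel_primitive_pos:
  fixes s :: real
  assumes s: "s > 0"
  obtains K :: "real \<Rightarrow> complex" where
    "\<And>z. (K has_vector_derivative exp (- \<i> * s * (complex_of_real z)\<^sup>2)) (at z)"
    "K 0 = - (exp (- \<i> * (pi / 4)) * complex_of_real (sqrt pi / 2 * s powr (-1/2)))"
    "\<And>z. z \<ge> 0 \<Longrightarrow> cmod (K z) \<le> sqrt pi / 2 * s powr (-1/2)"
    "\<And>z. z > 0 \<Longrightarrow> cmod (K z) \<le> 1 / (sqrt 2 * s * z)"
proof -
  define \<omega> where "\<omega> = exp (- \<i> * (pi / 4))"
  have \<omega>: "\<omega> = Complex (1 / sqrt 2) (- 1 / sqrt 2)"
    by (simp add: \<omega>_def complex_eq_iff Re_exp Im_exp cos_45 sin_45 real_div_sqrt field_simps)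
  have \<omega>2: "\<omega>\<^sup>2 = - \<i>"
    by (simp add: \<omega> complex_eq_iff power2_eq_square)
  have n\<omega>: "cmod \<omega> = 1" by (simp add: \<omega>_def)
  define h where "h w = exp (- \<i> * s * w\<^sup>2)" for w :: complex
  have "h holomorphic_on UNIV" unfolding h_def by (intro holomorphic_intros)
  then obtain H where "\<And>w. (H has_field_derivative h w) (at w)"
    using holomorphic_convex_primitive'[of UNIV h] by auto
  note H = this has_field_derivative_at_within [OF this]
  have cray: "cmod (h (of_real z + of_real r * \<omega>)) = exp (- (sqrt 2 * s * z * r)) * exp (- s * r\<^sup>2)" for z r :: real
  proof -
    have "- \<i> * s * (of_real z + of_real r * \<omega>)\<^sup>2 = - \<i> * s * (of_real z)\<^sup>2 - 2 * \<i> * s * \<omega> * z * r - \<i> * s * r\<^sup>2 * \<omega>\<^sup>2"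
      by (simp add: power2_eq_square algebra_simps)
    also have "Re \<dots> = - (sqrt 2 * s * z * r) + (- s * r\<^sup>2)"
      by (simp add: \<omega>2, simp add: \<omega> real_div_sqrt field_simps flip: of_real_power)
    finally show ?thesis unfolding h_def by (simp only: norm_exp_eq_Re exp_add)
  qed
  define c where "c = sqrt pi / 2 * s powr (-1/2)"
  define E where "E R = integral {0..R} (\<lambda>r. exp (- s * r\<^sup>2))" for R
  have E: "(E \<longlongrightarrow> c) at_top" "\<And>R. E R \<le> c"
    using gaussian_half_line [OF s] unfolding E_def [abs_def] c_def by auto
  have E': "(E has_vector_derivative exp (- s * x\<^sup>2)) (at x within {0..R})" if "x \<in> {0..R}" for x R
    unfolding E_def [abs_def] using that by (intro integral_has_vector_derivative continuous_intros)
  have contE: "continuous_on {0..R} E" for R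
    using E' by (meson continuous_on_eq_continuous_within has_vector_derivative_continuous)
  have E'': "(E has_vector_derivative exp (- s * x\<^sup>2)) (at x)" if "0 < x" for x
    using E'[of x "x+1"] that at_within_Icc_at[of 0 x "x+1"] by auto
  have line: "((\<lambda>r. H (of_real z + of_real r * \<omega>)) has_vector_derivative \<omega> * h (of_real z + of_real r * \<omega>)) (at r within S)" for z r S
  proof -
    have "((\<lambda>r. of_real z + of_real r * \<omega>) has_vector_derivative \<omega>) (at r within S)"
      by (auto intro!: derivative_eq_intros)
    from field_vector_diff_chain_within [OF this H(2)]
    show ?thesis by (simp add: o_def)
  qed
  have clin: "continuous_on {0..R} (\<lambda>r. H (of_real z + of_real r * \<omega>))" for z R
    by (rule continuous_on_vector_derivative [OF line])
  have ray1: "cmod (H (of_real z + of_real R * \<omega>) - H (of_real z)) \<le> E R" if "R > 0" "z \<ge> 0" for R z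
  proof -
    have "cmod (H (of_real z + of_real R * \<omega>) - H (of_real z + of_real 0 * \<omega>)) \<le> E R - E 0"
    proof (rule differentiable_bound_general [OF \<open>R > 0\<close> clin contE line])
      fix x :: real assume x: "0 < x" "x < R"
      have "exp (- (sqrt 2 * s * z * x)) \<le> 1" using that s x by simp
      then show "cmod (\<omega> * h (complex_of_real z + complex_of_real x * \<omega>)) \<le> exp (- s * x\<^sup>2)"
        by (simp add: norm_mult n\<omega> cray)
    qed (use E'' in auto)
    then show ?thesis by (simp add: E_def)
  qed
  have ray2: "cmod (H (of_real z + of_real R * \<omega>) - H (of_real z)) \<le> 1 / (sqrt 2 * s * z)" if "R > 0" "z > 0" for R z
  proof -
    define a where "a = sqrt 2 * s * z"
    have a: "a > 0" using s that by (simp add: a_def)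
    have "cmod (H (of_real z + of_real R * \<omega>) - H (of_real z + of_real 0 * \<omega>)) \<le> - exp (- a * R) / a - (- exp (- a * 0) / a)"
    proof (rule differentiable_bound_general [OF \<open>R > 0\<close> clin _ line])
      fix x :: real assume x: "0 < x" "x < R"
      have "exp (- (s * x\<^sup>2)) \<le> 1" using s x by simp
      then show "cmod (\<omega> * h (complex_of_real z + complex_of_real x * \<omega>)) \<le> exp (- a * x)"
        by (simp add: norm_mult n\<omega> cray a_def)
      show "((\<lambda>x. - exp (- a * x) / a) has_vector_derivative exp (- a * x)) (at x)"
        using a unfolding has_real_derivative_iff_has_vector_derivative [symmetric]
        by (auto intro!: derivative_eq_intros)
    qed (use a in \<open>auto intro!: continuous_intros\<close>)
    also have "\<dots> \<le> 1 / a" using a by (simp add: field_simps)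
    finally show ?thesis by (simp add: a_def)
  qed
  have far: "cmod (H (of_real z + of_real R * \<omega>) - H (of_real R * \<omega>)) \<le> z * exp (- s * R\<^sup>2)" if "R > 0" "z \<ge> 0" for R z
  proof -
    have "cmod (H (of_real z + of_real R * \<omega>) - H (of_real 0 + of_real R * \<omega>))
       \<le> exp (- s * R\<^sup>2) * cmod ((of_real z + of_real R * \<omega>) - (of_real 0 + of_real R * \<omega>))"
    proof (rule field_differentiable_bound [where S = "(\<lambda>x. of_real x + of_real R * \<omega>) ` {0..z}"])
      have "linear complex_of_real" by (simp add: bounded_linear.linear bounded_linear_of_real)
      then have "convex ((+) (of_real R * \<omega>) ` complex_of_real ` {0..z})"
        by (intro convex_translation convex_linear_image) auto
      then show "convex ((\<lambda>x. complex_of_real x + of_real R * \<omega>) ` {0..z})"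
        by (simp add: image_image add.commute)
      fix x assume "x \<in> (\<lambda>x. complex_of_real x + of_real R * \<omega>) ` {0..z}"
      then obtain y where y: "x = complex_of_real y + of_real R * \<omega>" "0 \<le> y" by auto
      have "exp (- (sqrt 2 * s * y * R)) \<le> 1" using s y that by simp
      then show "cmod (h x) \<le> exp (- s * R\<^sup>2)" by (simp add: y cray)
    qed (use H(2) that in auto)
    then show ?thesis using that by (simp add: mult.commute)
  qed
  have axis: "H (of_real R * \<omega>) - H 0 = \<omega> * of_real (E R)" if "R > 0" for R
  proof -
    have "((\<lambda>r. \<omega> * h (of_real 0 + of_real r * \<omega>)) has_integral H (of_real 0 + of_real R * \<omega>) - H (of_real 0 + of_real 0 * \<omega>)) {0..R}"
      using that by (intro fundamental_theorem_of_calculus line) auto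
    moreover have "h (of_real r * \<omega>) = of_real (exp (- s * r\<^sup>2))" for r
    proof -
      have "- \<i> * s * (of_real r * \<omega>)\<^sup>2 = of_real (- s * r\<^sup>2)"
        by (simp add: power_mult_distrib \<omega>2 complex_eq_iff flip: of_real_power)
      then show ?thesis by (simp only: h_def exp_of_real)
    qed
    ultimately have "((\<lambda>r. \<omega> * of_real (exp (- s * r\<^sup>2))) has_integral H (of_real R * \<omega>) - H 0) {0..R}"
      by simp
    moreover have "((\<lambda>r. exp (- s * r\<^sup>2)) has_integral E R) {0..R}"
      unfolding E_def by (intro integrable_integral integrable_continuous_interval continuous_intros)
    then have "((\<lambda>r. \<omega> * of_real (exp (- s * r\<^sup>2))) has_integral \<omega> * of_real (E R)) {0..R}"
      by (intro has_integral_mult_right has_integral_of_real)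
    ultimately show ?thesis by (rule has_integral_unique)
  qed
  \<comment> \<open>\<open>H 0 + \<omega> c\<close> is the limit of \<open>H\<close> along the ray through \<open>\<omega>\<close>, hence along all parallel rays.\<close>
  define K where "K z = H (of_real z) - H 0 - \<omega> * of_real c" for z :: real
  have est: "cmod (K z) \<le> b" if z: "z \<ge> 0"
    and b: "\<And>R. R > 0 \<Longrightarrow> cmod (H (of_real z + of_real R * \<omega>) - H (of_real z)) \<le> b" for z b
  proof -
    have "cmod (K z) \<le> b + (z * exp (- s * R\<^sup>2) + \<bar>E R - c\<bar>)" if R: "R > 0" for R
    proof -
      have "K z = - (H (of_real z + of_real R * \<omega>) - H (of_real z))
        + ((H (of_real z + of_real R * \<omega>) - H (of_real R * \<omega>)) + \<omega> * of_real (E R - c))"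
        using axis [OF R] by (simp add: K_def algebra_simps)
      also have "cmod \<dots> \<le> b + (z * exp (- s * R\<^sup>2) + \<bar>E R - c\<bar>)"
        using b [OF R] far [OF R z]
        by (intro order_trans [OF norm_triangle_ineq] add_mono)
           (auto simp del: of_real_diff minus_diff_eq simp: norm_mult n\<omega>)
      finally show ?thesis .
    qed
    then have ev: "eventually (\<lambda>R. cmod (K z) \<le> b + (z * exp (- s * R\<^sup>2) + \<bar>E R - c\<bar>)) at_top"
      using eventually_gt_at_top by (rule eventually_mono [rotated])
    have "((\<lambda>R::real. exp (- s * R\<^sup>2)) \<longlongrightarrow> 0) at_top"
      using s by real_asymp
    then have "((\<lambda>R. b + (z * exp (- s * R\<^sup>2) + \<bar>E R - c\<bar>)) \<longlongrightarrow> b + (z * 0 + \<bar>c - c\<bar>)) at_top"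
      by (intro tendsto_intros E)
    with ev show ?thesis
      using tendsto_lowerbound [OF _ ev] by simp
  qed
  show ?thesis
  proof (rule that [of K])
    fix z :: real
    have "((\<lambda>z. H (of_real z)) has_vector_derivative h (of_real z)) (at z)"
      using has_vector_derivative_real_field [OF H(1)] by simp
    then show "(K has_vector_derivative exp (- \<i> * s * (complex_of_real z)\<^sup>2)) (at z)"
      unfolding K_def [abs_def] by (auto intro!: derivative_eq_intros simp: h_def)
    show "cmod (K z) \<le> sqrt pi / 2 * s powr (-1/2)" if "z \<ge> 0"
      using that ray1 E(2) unfolding c_def [symmetric] by (intro est) (auto intro: order_trans)
    show "cmod (K z) \<le> 1 / (sqrt 2 * s * z)" if "z > 0"
      using that ray2 by (intro est) auto
  qed (simp add: K_def \<omega>_def c_def)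
qed

text \<open>The estimate is the geometric interpolation, with weights \<open>2 - 2\<delta>\<close> and \<open>2\<delta> - 1\<close>, between the
  two bounds of the previous lemma; \<open>L_const\<close> absorbs the resulting constant because
  \<open>1 / sqrt 2\<close> lies below \<open>(sqrt \<pi> / 2) \<kappa>\<close>, where \<open>\<kappa>\<close> is the base of the power in \<open>L_const\<close>. Negative \<open>s\<close> is reduced to
  positive \<open>s\<close> by complex conjugation.\<close>

lemma fresnel_primitive:
  fixes s :: real
  assumes s: "s \<noteq> 0"
  obtains K :: "real \<Rightarrow> complex" where
    "\<And>z. (K has_vector_derivative exp (- \<i> * s * (complex_of_real z)\<^sup>2)) (at z)"
    "K 0 = - (exp (- (complex_of_real (sgn s)) * \<i> * (pi / 4)) * complex_of_real (sqrt pi / 2 * \<bar>s\<bar> powr (-1/2)))"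
    "\<And>z \<delta>. z > 0 \<Longrightarrow> 1/2 \<le> \<delta> \<Longrightarrow> \<delta> \<le> 1 \<Longrightarrow> cmod (K z) \<le> L_const \<delta> * \<bar>s\<bar> powr (-\<delta>) * z powr (1 - 2 * \<delta>)"
proof -
  have L: "(sqrt pi / 2) powr (2 - 2 * \<delta>) * (1 / sqrt 2) powr (2 * \<delta> - 1) \<le> L_const \<delta>" if "1/2 \<le> \<delta>" for \<delta>
  proof -
    define \<kappa> where "\<kappa> = 1 / (2 * sqrt pi) + sqrt (1 / (4 * pi) + 1 / 2)"
    \<comment> \<open>Numerically \<open>0.707 < 0.924\<close>; the crude bound \<open>\<pi> \<ge> 3\<close> is enough.\<close>
    have "1 / sqrt 2 \<le> sqrt pi / 2 * \<kappa>"
    proof -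
      have "(1 / sqrt 2)\<^sup>2 \<le> (1/4 + sqrt (1/16 + pi/8))\<^sup>2"
      proof -
        have "3 \<le> pi" using pi_approx by simp
        then have "sqrt (49/16/9) \<le> sqrt (1/16 + pi/8)" by (intro real_sqrt_le_mono) simp
        moreover have "sqrt (49/16/9) = 7/12" by (simp add: real_sqrt_divide)
        ultimately have "7/12 \<le> sqrt (1/16 + pi/8)" by (simp only:)
        then have "(1/4 + 7/12)\<^sup>2 \<le> (1/4 + sqrt (1/16 + pi/8))\<^sup>2" by (intro power_mono) auto
        moreover have "(1 / sqrt 2)\<^sup>2 \<le> (1/4 + 7/12 :: real)\<^sup>2" by (simp add: power2_eq_square)
        ultimately show ?thesis by simp
      qed
      then have "1 / sqrt 2 \<le> 1/4 + sqrt (1/16 + pi/8)" by (rule power2_le_imp_le) auto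
      also have "\<dots> = sqrt pi / 2 * \<kappa>"
      proof -
        have "sqrt pi / 2 * sqrt (1 / (4 * pi) + 1 / 2) = sqrt (pi / 4 * (1 / (4 * pi) + 1 / 2))"
          by (simp add: real_sqrt_mult real_sqrt_divide)
        also have "pi / 4 * (1 / (4 * pi) + 1 / 2) = 1/16 + pi/8" by (simp add: field_simps)
        finally show ?thesis by (simp add: \<kappa>_def field_simps)
      qed
      finally show ?thesis .
    qed
    then have "(1 / sqrt 2) powr (2 * \<delta> - 1) \<le> (sqrt pi / 2 * \<kappa>) powr (2 * \<delta> - 1)"
      using that by (intro powr_mono2) auto
    then have "(sqrt pi / 2) powr (2 - 2 * \<delta>) * (1 / sqrt 2) powr (2 * \<delta> - 1)
       \<le> (sqrt pi / 2) powr (2 - 2 * \<delta>) * (sqrt pi / 2 * \<kappa>) powr (2 * \<delta> - 1)"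
      by (intro mult_left_mono) auto
    also have "\<dots> = ((sqrt pi / 2) powr (2 - 2 * \<delta>) * (sqrt pi / 2) powr (2 * \<delta> - 1)) * \<kappa> powr (2 * \<delta> - 1)"
      by (subst powr_mult) (auto simp: \<kappa>_def)
    also have "(sqrt pi / 2) powr (2 - 2 * \<delta>) * (sqrt pi / 2) powr (2 * \<delta> - 1) = sqrt pi / 2"
      by (simp add: powr_add [symmetric])
    finally show ?thesis by (simp add: L_const_def \<kappa>_def)
  qed
  obtain K where K: 
    "\<And>z. (K has_vector_derivative exp (- \<i> * \<bar>s\<bar> * (complex_of_real z)\<^sup>2)) (at z)"
    "K 0 = - (exp (- \<i> * (pi / 4)) * complex_of_real (sqrt pi / 2 * \<bar>s\<bar> powr (-1/2)))"
    "\<And>z. z \<ge> 0 \<Longrightarrow> cmod (K z) \<le> sqrt pi / 2 * \<bar>s\<bar> powr (-1/2)"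
    "\<And>z. z > 0 \<Longrightarrow> cmod (K z) \<le> 1 / (sqrt 2 * \<bar>s\<bar> * z)"
    using fresnel_primitive_pos [of "\<bar>s\<bar>"] s by auto
  have bd: "cmod (K z) \<le> L_const \<delta> * \<bar>s\<bar> powr (-\<delta>) * z powr (1 - 2 * \<delta>)"
    if z: "z > 0" and \<delta>: "1/2 \<le> \<delta>" "\<delta> \<le> 1" for z \<delta>
  proof -
    have "cmod (K z) = cmod (K z) powr (2 - 2 * \<delta>) * cmod (K z) powr (2 * \<delta> - 1)"
      by (simp add: powr_add [symmetric])
    also have "\<dots> \<le> (sqrt pi / 2 * \<bar>s\<bar> powr (-1/2)) powr (2 - 2 * \<delta>) * (1 / (sqrt 2 * \<bar>s\<bar> * z)) powr (2 * \<delta> - 1)"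
      using K(3) [of z] K(4) [of z] z \<delta> by (intro mult_mono powr_mono2) auto
    also have "1 / (sqrt 2 * \<bar>s\<bar> * z) = 1 / sqrt 2 * (\<bar>s\<bar> powr (-1) * z powr (-1))"
      using z s by (simp add: powr_minus divide_simps)
    also have "(sqrt pi / 2 * \<bar>s\<bar> powr (-1/2)) powr (2 - 2 * \<delta>) * (1 / sqrt 2 * (\<bar>s\<bar> powr (-1) * z powr (-1))) powr (2 * \<delta> - 1)
      = ((sqrt pi / 2) powr (2 - 2 * \<delta>) * (1 / sqrt 2) powr (2 * \<delta> - 1))
         * ((\<bar>s\<bar> powr ((-1/2) * (2 - 2 * \<delta>)) * \<bar>s\<bar> powr ((-1) * (2 * \<delta> - 1))) * z powr ((-1) * (2 * \<delta> - 1)))"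
      by (simp only: powr_mult powr_powr mult_ac)
    also have "\<bar>s\<bar> powr ((-1/2) * (2 - 2 * \<delta>)) * \<bar>s\<bar> powr ((-1) * (2 * \<delta> - 1)) = \<bar>s\<bar> powr (-\<delta>)"
      by (simp add: powr_add [symmetric] field_simps)
    also have "(sqrt pi / 2) powr (2 - 2 * \<delta>) * (1 / sqrt 2) powr (2 * \<delta> - 1)
         * (\<bar>s\<bar> powr (-\<delta>) * z powr ((-1) * (2 * \<delta> - 1)))
       \<le> L_const \<delta> * (\<bar>s\<bar> powr (-\<delta>) * z powr (1 - 2 * \<delta>))"
      using L [OF \<delta>(1)] by (intro mult_mono) (auto simp: L_const_def)
    finally show ?thesis by (simp add: mult.assoc)
  qed
  show ?thesis
  proof (cases "s > 0")
    case True
    with K bd show ?thesis by (intro that [of K]) auto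
  next
    case False
    with s have neg: "s < 0" by simp
    show ?thesis
    proof (rule that [of "\<lambda>z. cnj (K z)"])
      fix z :: real
      have "((\<lambda>z. cnj (K z)) has_vector_derivative cnj (exp (- \<i> * \<bar>s\<bar> * (complex_of_real z)\<^sup>2))) (at z)"
        using K(1) by (rule has_vector_derivative_cnj)
      moreover have "cnj (exp (- \<i> * \<bar>s\<bar> * (complex_of_real z)\<^sup>2)) = exp (- \<i> * s * (complex_of_real z)\<^sup>2)"
        using neg by (simp add: exp_cnj)
      ultimately show "((\<lambda>z. cnj (K z)) has_vector_derivative exp (- \<i> * s * (complex_of_real z)\<^sup>2)) (at z)"
        by simp
    next
      show "cnj (K 0) = - (exp (- (complex_of_real (sgn s)) * \<i> * (pi / 4)) * complex_of_real (sqrt pi / 2 * \<bar>s\<bar> powr (-1/2)))"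
        using neg by (simp add: K(2) exp_cnj)
    qed (use bd in auto)
  qed
qed

section \<open>Stationary and non-stationary phase\<close>

text \<open>Form in which the Cauchy-Schwarz inequality is used: a bound by
  \<open>\<mu>/2 a\<^sup>2 + b\<^sup>2/(2\<mu>)\<close> for every \<open>\<mu>\<close> comes from a pointwise estimate and needs only the two square
  integrals, and optimising over \<open>\<mu>\<close> turns it into the product \<open>ab\<close>.\<close>

lemma AMGM_optimise:
  fixes X a b c k :: real
  assumes X: "\<And>\<mu>. \<mu> > 0 \<Longrightarrow> X \<le> c + k * (\<mu> / 2 * a\<^sup>2 + b\<^sup>2 / (2 * \<mu>))"
    and nn: "a \<ge> 0" "b \<ge> 0" "k \<ge> 0"
  shows "X \<le> c + k * (a * b)"
proof -
  have "X \<le> c + k * ((a + e) * (b + e))" if e: "e > 0" for e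
  proof -
    \<comment> \<open>The optimal \<open>\<mu> = b/a\<close>, perturbed so that \<open>a = 0\<close> and \<open>b = 0\<close> need no separate treatment.\<close>
    define \<mu> where "\<mu> = (b + e) / (a + e)"
    have \<mu>: "\<mu> > 0" using nn e by (simp add: \<mu>_def)
    have "a\<^sup>2 \<le> (a + e)\<^sup>2" "b\<^sup>2 \<le> (b + e)\<^sup>2" using nn e by (auto intro!: power_mono)
    then have "\<mu> / 2 * a\<^sup>2 + b\<^sup>2 / (2 * \<mu>) \<le> \<mu> / 2 * (a + e)\<^sup>2 + (b + e)\<^sup>2 / (2 * \<mu>)"
      using \<mu> by (intro add_mono mult_left_mono divide_right_mono) auto
    also have "\<dots> = (a + e) * (b + e)"
    proof -
      have "a + e \<noteq> 0" "b + e \<noteq> 0" using nn e by auto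
      then show ?thesis unfolding \<mu>_def by (simp add: power2_eq_square divide_simps, simp add: algebra_simps)
    qed
    finally have "k * (\<mu> / 2 * a\<^sup>2 + b\<^sup>2 / (2 * \<mu>)) \<le> k * ((a + e) * (b + e))"
      using nn by (intro mult_left_mono) auto
    with X [OF \<mu>] show ?thesis by linarith
  qed
  then have "eventually (\<lambda>e. X \<le> c + k * ((a + e) * (b + e))) (at_right 0)"
    by (simp add: eventually_at_right_less eventually_mono [OF eventually_at_right_less])
  moreover have "((\<lambda>e. c + k * ((a + e) * (b + e))) \<longlongrightarrow> c + k * ((a + 0) * (b + 0))) (at_right 0)"
    by (intro tendsto_intros)
  ultimately show ?thesis
    using tendsto_lowerbound [of _ _ "at_right (0::real)"] by fastforce
qed

lemma has_integral_powr_shift: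
  fixes a p q :: real
  assumes "p \<le> q" "a > -1"
  shows "((\<lambda>x. (x - p) powr a) has_integral (q - p) powr (a + 1) / (a + 1)) {p..q}"
proof -
  have "((\<lambda>x. (x - p) powr a) has_integral (q - p) powr (a + 1) / (a + 1) - (p - p) powr (a + 1) / (a + 1)) {p..q}"
  proof (rule fundamental_theorem_of_calculus_interior [OF assms(1)])
    show "continuous_on {p..q} (\<lambda>x. (x - p) powr (a + 1) / (a + 1))"
      using assms by (intro continuous_intros continuous_on_powr') auto
    fix x assume "x \<in> {p<..<q}"
    then show "((\<lambda>x. (x - p) powr (a + 1) / (a + 1)) has_vector_derivative (x - p) powr a) (at x)"
      unfolding has_real_derivative_iff_has_vector_derivative [symmetric]
      using assms by (auto intro!: derivative_eq_intros)
  qed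
  then show ?thesis using assms by simp
qed

text \<open>Each bound follows by comparing derivatives from \<open>p0\<close> on. The last one measures the
  departure from the quadratic case, in which \<open>f'\<close> is affine and the left-hand side vanishes; it
  is what controls the derivative of the change of variable \<open>p \<mapsto> sqrt (D p)\<close>.\<close>

lemma convex_remainder_bounds:
  fixes f f1 f2 f3 :: "real \<Rightarrow> real" and p0 :: real
  defines "D \<equiv> \<lambda>x. f x - f p0 - f1 p0 * (x - p0)"
  defines "D1 \<equiv> \<lambda>x. f1 x - f1 p0"
  assumes D1: "\<And>x. (f has_real_derivative f1 x) (at x)"
    and D2: "\<And>x. (f1 has_real_derivative f2 x) (at x)"
    and D3: "\<And>x. (f2 has_real_derivative f3 x) (at x)"
    and m: "m > 0"
    and f2: "\<And>x. x \<in> {p0..q} \<Longrightarrow> m \<le> f2 x" "\<And>x. x \<in> {p0..q} \<Longrightarrow> f2 x \<le> M"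
    and f3: "\<And>x. x \<in> {p0..q} \<Longrightarrow> \<bar>f3 x\<bar> \<le> N"
    and p: "p \<in> {p0..q}"
  shows "m * (p - p0) \<le> D1 p" "D1 p \<le> M * (p - p0)"
    and "m / 2 * (p - p0)\<^sup>2 \<le> D p" "D p \<le> M / 2 * (p - p0)\<^sup>2"
    and "\<bar>(D1 p)\<^sup>2 - 2 * D p * f2 p\<bar> \<le> N * M / 3 * (p - p0) ^ 3"
proof -
  note [derivative_intros] = DERIV_chain2 [OF D1] DERIV_chain2 [OF D2] DERIV_chain2 [OF D3]
  have 1: "m * (x - p0) \<le> D1 x" if "x \<in> {p0..q}" for x
  proof -
    have "D1 p0 - m * (p0 - p0) \<le> D1 x - m * (x - p0)"
    proof (rule DERIV_nonneg_imp_nondecreasing [where f = "\<lambda>x. D1 x - m * (x - p0)"])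
      fix y assume "p0 \<le> y" "y \<le> x"
      then show "\<exists>z. ((\<lambda>x. D1 x - m * (x - p0)) has_real_derivative z) (at y) \<and> 0 \<le> z"
        unfolding D1_def using that f2(1) [of y]
        by (intro exI [of _ "f2 y - m"]) (auto intro!: derivative_eq_intros)
    qed (use that in auto)
    then show ?thesis by (simp add: D1_def)
  qed
  have 2: "D1 x \<le> M * (x - p0)" if "x \<in> {p0..q}" for x
  proof -
    have "M * (p0 - p0) - D1 p0 \<le> M * (x - p0) - D1 x"
    proof (rule DERIV_nonneg_imp_nondecreasing [where f = "\<lambda>x. M * (x - p0) - D1 x"])
      fix y assume "p0 \<le> y" "y \<le> x"
      then show "\<exists>z. ((\<lambda>x. M * (x - p0) - D1 x) has_real_derivative z) (at y) \<and> 0 \<le> z"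
        unfolding D1_def using that f2(2) [of y]
        by (intro exI [of _ "M - f2 y"]) (auto intro!: derivative_eq_intros)
    qed (use that in auto)
    then show ?thesis by (simp add: D1_def)
  qed
  have 3: "m / 2 * (x - p0)\<^sup>2 \<le> D x" if "x \<in> {p0..q}" for x
  proof -
    have "D p0 - m / 2 * (p0 - p0)\<^sup>2 \<le> D x - m / 2 * (x - p0)\<^sup>2"
    proof (rule DERIV_nonneg_imp_nondecreasing [where f = "\<lambda>x. D x - m / 2 * (x - p0)\<^sup>2"])
      fix y assume "p0 \<le> y" "y \<le> x"
      then show "\<exists>z. ((\<lambda>x. D x - m / 2 * (x - p0)\<^sup>2) has_real_derivative z) (at y) \<and> 0 \<le> z"
        unfolding D_def using that 1 [of y]
        by (intro exI [of _ "D1 y - m * (y - p0)"])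
           (auto intro!: derivative_eq_intros simp: D1_def field_simps)
    qed (use that in auto)
    then show ?thesis by (simp add: D_def)
  qed
  have 4: "D x \<le> M / 2 * (x - p0)\<^sup>2" if "x \<in> {p0..q}" for x
  proof -
    have "M / 2 * (p0 - p0)\<^sup>2 - D p0 \<le> M / 2 * (x - p0)\<^sup>2 - D x"
    proof (rule DERIV_nonneg_imp_nondecreasing [where f = "\<lambda>x. M / 2 * (x - p0)\<^sup>2 - D x"])
      fix y assume "p0 \<le> y" "y \<le> x"
      then show "\<exists>z. ((\<lambda>x. M / 2 * (x - p0)\<^sup>2 - D x) has_real_derivative z) (at y) \<and> 0 \<le> z"
        unfolding D_def using that 2 [of y]
        by (intro exI [of _ "M * (y - p0) - D1 y"])
           (auto intro!: derivative_eq_intros simp: D1_def field_simps)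
    qed (use that in auto)
    then show ?thesis by (simp add: D_def)
  qed
  have pD: "0 \<le> D x" if "x \<in> {p0..q}" for x
    using 3 [OF that] m by (smt (verit, best) mult_nonneg_nonneg zero_le_power2 divide_nonneg_nonneg)
  \<comment> \<open>The terms with \<open>f''\<close> cancel in the derivative, which is \<open>-2 D f'''\<close>.\<close>
  have 5: "norm ((D1 p)\<^sup>2 - 2 * D p * f2 p - ((D1 p0)\<^sup>2 - 2 * D p0 * f2 p0)) \<le> N * M / 3 * (p - p0) ^ 3 - N * M / 3 * (p0 - p0) ^ 3" if "p0 < p"
  proof (rule differentiable_bound_general [OF that])
    fix x assume x: "p0 < x" "x < p"
    then have xq: "x \<in> {p0..q}" using p by auto
    show "((\<lambda>p. (D1 p)\<^sup>2 - 2 * D p * f2 p) has_vector_derivative - 2 * D x * f3 x) (at x)"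
      unfolding has_real_derivative_iff_has_vector_derivative [symmetric] D_def D1_def
      by (auto intro!: derivative_eq_intros simp: field_simps)
    show "((\<lambda>p. N * M / 3 * (p - p0) ^ 3) has_vector_derivative N * (M * (x - p0)\<^sup>2)) (at x)"
      unfolding has_real_derivative_iff_has_vector_derivative [symmetric]
      by (auto intro!: derivative_eq_intros simp: field_simps)
    have "norm (- 2 * D x * f3 x) = (2 * D x) * \<bar>f3 x\<bar>" using pD [OF xq] by (simp add: abs_mult)
    also have "\<dots> \<le> (M * (x - p0)\<^sup>2) * N"
    proof (rule mult_mono)
      show "2 * D x \<le> M * (x - p0)\<^sup>2" using 4 [OF xq] by simp
      then show "0 \<le> M * (x - p0)\<^sup>2" using pD [OF xq] by linarith
    qed (use f3 [OF xq] in auto)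
    finally show "norm (- 2 * D x * f3 x) \<le> N * (M * (x - p0)\<^sup>2)" by (simp add: mult.commute)
  next
    have "continuous_on S f" "continuous_on S f1" "continuous_on S f2" for S
      using D1 D2 D3 by (auto intro!: continuous_at_imp_continuous_on DERIV_isCont)
    then show "continuous_on {p0..p} (\<lambda>p. (D1 p)\<^sup>2 - 2 * D p * f2 p)" "continuous_on {p0..p} (\<lambda>p. N * M / 3 * (p - p0) ^ 3)"
      unfolding D_def D1_def by (auto intro!: continuous_intros)
  qed
  show "\<bar>(D1 p)\<^sup>2 - 2 * D p * f2 p\<bar> \<le> N * M / 3 * (p - p0) ^ 3"
    using 5 p by (cases "p = p0") (auto simp: D_def D1_def)
  show "m * (p - p0) \<le> D1 p" "D1 p \<le> M * (p - p0)"
    "m / 2 * (p - p0)\<^sup>2 \<le> D p" "D p \<le> M / 2 * (p - p0)\<^sup>2"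
    using 1 2 3 4 p by auto
qed

text \<open>With \<open>D\<close> the convex remainder, \<open>E = D'\<close> and \<open>w = 2 sqrt D / E\<close>, the chain rule reads
  \<open>w (K (sqrt D))' = e\<^bsup>-isD\<^esup>\<close>; so \<open>g e\<^bsup>-isD\<^esup>\<close> is the derivative of \<open>g w K(sqrt D)\<close> up to the term
  \<open>(g w)' K(sqrt D)\<close>. Here \<open>w\<close> is the derivative of \<open>p\<close> with respect to \<open>z = sqrt D\<close>, which
  extends to the stationary point by \<open>sqrt (2 / f'')\<close>. Working in the variable
  \<open>p\<close> avoids any actual substitution in the integral. The singularity \<open>(p - p0)\<^bsup>1-2\<delta>\<^esup>\<close> is
  square integrable exactly for \<open>\<delta> < 3/4\<close>.\<close>

lemma stationary_phase_half:
  fixes f f1 f2 f3 :: "real \<Rightarrow> real" and g g' :: "real \<Rightarrow> complex"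
    and p0 q s \<delta> m M N U \<Gamma> :: real
  assumes D1: "\<And>x. (f has_real_derivative f1 x) (at x)"
    and D2: "\<And>x. (f1 has_real_derivative f2 x) (at x)"
    and D3: "\<And>x. (f2 has_real_derivative f3 x) (at x)"
    and pos: "\<And>x. f2 x > 0"
    and pq: "p0 \<le> q" and m: "m > 0"
    and f2: "\<And>x. x \<in> {p0..q} \<Longrightarrow> m \<le> f2 x" "\<And>x. x \<in> {p0..q} \<Longrightarrow> f2 x \<le> M"
    and f3: "\<And>x. x \<in> {p0..q} \<Longrightarrow> \<bar>f3 x\<bar> \<le> N"
    and g: "\<And>x. (g has_vector_derivative g' x) (at x)" "continuous_on {p0..q} g'"
    and gq: "g q = 0" and U: "\<And>x. cmod (g x) \<le> U"
    and \<Gamma>: "integral {p0..q} (\<lambda>x. (cmod (g' x))\<^sup>2) \<le> \<Gamma>\<^sup>2" "\<Gamma> \<ge> 0"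
    and s: "s \<noteq> 0" and \<delta>: "1/2 < \<delta>" "\<delta> < 3/4"
  shows "cmod (integral {p0..q} (\<lambda>p. g p * exp (- \<i> * s * complex_of_real (f p - f p0 - f1 p0 * (p - p0))))
           - g p0 * complex_of_real (sqrt (2 / f2 p0)) *
             (exp (- (complex_of_real (sgn s)) * \<i> * (pi / 4)) * complex_of_real (sqrt pi / 2 * \<bar>s\<bar> powr (-1/2))))
     \<le> L_const \<delta> * \<bar>s\<bar> powr (-\<delta>) * (m / 2) powr (1/2 - \<delta>) *
        (2 * sqrt (M / 2) / m * \<Gamma> * sqrt ((q - p0) powr (3 - 4 * \<delta>) / (3 - 4 * \<delta>))
         + U * (N * M / (3 * m\<^sup>2 * sqrt (m / 2))) * ((q - p0) powr (2 - 2 * \<delta>) / (2 - 2 * \<delta>)))"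
proof -
  have M: "M > 0" using f2 [of p0] m pq by fastforce
  have N: "N \<ge> 0" using f3 [of p0] pq by fastforce
  have U0: "U \<ge> 0" using U [of p0] norm_ge_zero order_trans by blast
  have L0: "L_const \<delta> \<ge> 0" by (simp add: L_const_def)
  define D where "D x = f x - f p0 - f1 p0 * (x - p0)" for x
  define E where "E x = f1 x - f1 p0" for x
  define \<kappa> where "\<kappa> = L_const \<delta> * \<bar>s\<bar> powr (-\<delta>) * (m / 2) powr (1/2 - \<delta>)"
  define \<alpha> where "\<alpha> = 2 * sqrt (M / 2) / m"
  define \<beta> where "\<beta> = N * M / (3 * m\<^sup>2 * sqrt (m / 2))"
  define T where "T = (q - p0) powr (2 - 2 * \<delta>) / (2 - 2 * \<delta>)"
  define S where "S = (q - p0) powr (3 - 4 * \<delta>) / (3 - 4 * \<delta>)"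
  have nn: "\<kappa> \<ge> 0" "\<alpha> \<ge> 0" "\<beta> \<ge> 0" "S \<ge> 0" "T \<ge> 0"
    using L0 M N m \<delta> by (auto simp: \<kappa>_def \<alpha>_def \<beta>_def S_def T_def)
  obtain K where K: "\<And>z. (K has_vector_derivative exp (- \<i> * s * (complex_of_real z)\<^sup>2)) (at z)"
    "K 0 = - (exp (- (complex_of_real (sgn s)) * \<i> * (pi / 4)) * complex_of_real (sqrt pi / 2 * \<bar>s\<bar> powr (-1/2)))"
    "\<And>z \<delta>. z > 0 \<Longrightarrow> 1/2 \<le> \<delta> \<Longrightarrow> \<delta> \<le> 1 \<Longrightarrow> cmod (K z) \<le> L_const \<delta> * \<bar>s\<bar> powr (-\<delta>) * z powr (1 - 2 * \<delta>)"
    using fresnel_primitive [OF s] by blast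
  have dD: "(D has_real_derivative E x) (at x)" for x
    unfolding D_def [abs_def] E_def by (auto intro!: derivative_eq_intros D1)
  have dE: "(E has_real_derivative f2 x) (at x)" for x
    unfolding E_def [abs_def] by (auto intro!: derivative_eq_intros D2)
  have E0: "E p0 = 0" and D0: "D p0 = 0" by (auto simp: E_def D_def)
  have Epos: "E x > 0" if "x > p0" for x
    using DERIV_pos_imp_increasing [OF that, of E] dE pos E0 by metis
  have Dpos: "D x > 0" if "x > p0" for x
  proof -
    have "D p0 < D x"
    proof (rule DERIV_pos_imp_increasing_open [OF that])
      show "\<exists>y. (D has_real_derivative y) (at x) \<and> 0 < y" if "p0 < x" for x
        using dD Epos that by blast
      show "continuous_on {p0..x} D"
        using dD by (auto intro!: continuous_at_imp_continuous_on DERIV_isCont)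
    qed
    then show ?thesis by (simp add: D0)
  qed
  have contD: "continuous_on A D" for A
    using dD by (auto intro!: continuous_at_imp_continuous_on DERIV_isCont)
  have contg: "continuous_on A g" and contK: "continuous_on A K" for A
    using g(1) K(1) by (auto intro!: continuous_at_imp_continuous_on has_vector_derivative_continuous)
  define w where "w x = (if x = p0 then sqrt (2 / f2 p0) else 2 * sqrt (D x) / E x)" for x
  define w' where "w' x = ((E x)\<^sup>2 - 2 * D x * f2 x) / (sqrt (D x) * (E x)\<^sup>2)" for x
  have dw: "(w has_real_derivative w' x) (at x)" if x: "x > p0" for x
  proof -
    have "((\<lambda>x. 2 * sqrt (D x) / E x) has_real_derivative
        ((2 * (E x * (inverse (sqrt (D x)) / 2))) * E x - 2 * sqrt (D x) * f2 x) / (E x * E x)) (at x)"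
      using Dpos [OF x] Epos [OF x]
      by (auto intro!: derivative_eq_intros dE DERIV_chain2 [OF DERIV_real_sqrt] dD)
    also have "((2 * (E x * (inverse (sqrt (D x)) / 2))) * E x - 2 * sqrt (D x) * f2 x) / (E x * E x) = w' x"
    proof -
      define r where "r = sqrt (D x)"
      have "r > 0" "D x = r * r" using Dpos [OF x] by (auto simp: r_def)
      then show ?thesis using Epos [OF x]
        unfolding w'_def r_def [symmetric] by (simp add: field_simps power2_eq_square)
    qed
    finally show ?thesis
      by (rule has_field_derivative_transform_within_open [of _ _ _ "{p0<..}"])
         (use x in \<open>auto simp: w_def\<close>)
  qed
  \<comment> \<open>De l'Hopital's rule for \<open>D / E\<^sup>2\<close>, whose derivatives have quotient \<open>1/(2f'')\<close>.\<close>
  have wlim: "(w \<longlongrightarrow> w p0) (at_right p0)"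
  proof -
    have ev: "eventually (\<lambda>x. x > p0) (at_right p0)" by (simp add: eventually_at_right_less)
    have lims: "(D \<longlongrightarrow> 0) (at_right p0)" "(E \<longlongrightarrow> 0) (at_right p0)" "(f2 \<longlongrightarrow> f2 p0) (at_right p0)"
      using DERIV_isCont [OF dD, of p0] DERIV_isCont [OF dE, of p0] DERIV_isCont [OF D3, of p0]
      by (auto simp: isCont_def E0 D0 intro: tendsto_within_subset [where S = UNIV])
    have "((\<lambda>x. D x / (E x)\<^sup>2) \<longlongrightarrow> 1 / (2 * f2 p0)) (at_right p0)"
    proof (rule lhopital_right)
      show "((\<lambda>x. (E x)\<^sup>2) \<longlongrightarrow> 0) (at_right p0)" using tendsto_power [OF lims(2), of 2] by simp
      show "eventually (\<lambda>x. (E x)\<^sup>2 \<noteq> 0) (at_right p0)"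
        using ev by (rule eventually_mono) (use Epos in \<open>fastforce simp: power2_eq_square\<close>)
      show "eventually (\<lambda>x. 2 * E x * f2 x \<noteq> 0) (at_right p0)"
        using ev by (rule eventually_mono) (use Epos pos in \<open>simp add: less_le\<close>)
      show "eventually (\<lambda>x. (D has_real_derivative E x) (at x)) (at_right p0)" using dD by simp
      show "eventually (\<lambda>x. ((\<lambda>x. (E x)\<^sup>2) has_real_derivative 2 * E x * f2 x) (at x)) (at_right p0)"
        by (intro always_eventually allI) (auto intro!: derivative_eq_intros dE)
      have "((\<lambda>x. 1 / (2 * f2 x)) \<longlongrightarrow> 1 / (2 * f2 p0)) (at_right p0)"
        using pos [of p0] by (intro tendsto_intros lims) auto
      then show "((\<lambda>x. E x / (2 * E x * f2 x)) \<longlongrightarrow> 1 / (2 * f2 p0)) (at_right p0)"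
        by (rule Lim_transform_eventually) (use ev in \<open>eventually_elim, use Epos in force\<close>)
    qed (use lims in auto)
    then have "((\<lambda>x. sqrt (4 * (D x / (E x)\<^sup>2))) \<longlongrightarrow> sqrt (4 * (1 / (2 * f2 p0)))) (at_right p0)"
      by (rule tendsto_real_sqrt [OF tendsto_mult [OF tendsto_const]])
    moreover have "sqrt (4 * (1 / (2 * f2 p0))) = w p0"
      by (simp add: w_def field_simps)
    ultimately have "((\<lambda>x. sqrt (4 * (D x / (E x)\<^sup>2))) \<longlongrightarrow> w p0) (at_right p0)" by simp
    then show ?thesis
    proof (rule Lim_transform_eventually)
      show "eventually (\<lambda>x. sqrt (4 * (D x / (E x)\<^sup>2)) = w x) (at_right p0)"
        using ev
      proof eventually_elim
        case (elim x)
        then show ?case using Epos [OF elim] by (simp add: w_def real_sqrt_mult real_sqrt_divide)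
      qed
    qed
  qed
  have contw: "continuous_on {p0..q} w"
  proof (cases "p0 = q")
    case False
    with pq have "p0 < q" by simp
    show ?thesis unfolding continuous_on_eq_continuous_within
    proof
      fix x assume "x \<in> {p0..q}"
      then consider "x = p0" | "x > p0" by fastforce
      then show "continuous (at x within {p0..q}) w"
      proof cases
        case 1
        then show ?thesis using wlim \<open>p0 < q\<close> by (simp add: continuous_within at_within_Icc_at_right)
      next
        case 2
        then show ?thesis using DERIV_isCont [OF dw] continuous_at_imp_continuous_at_within by blast
      qed
    qed
  qed auto
  define e where "e p = exp (- \<i> * s * complex_of_real (D p))" for p
  define P where "P p = g p * complex_of_real (w p) * K (sqrt (D p))" for p
  \<comment> \<open>The formula for \<open>w'\<close> divides by \<open>0\<close> at \<open>p0\<close>; there the value \<open>0\<close> makes the pointwise bound hold trivially.\<close>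
  define R where "R p = (if p = p0 then 0 else (g' p * complex_of_real (w p) + g p * complex_of_real (w' p)) * K (sqrt (D p)))" for p
  have contP: "continuous_on {p0..q} P"
    unfolding P_def [abs_def]
    by (intro continuous_intros contg contw continuous_on_compose2 [OF contK [of UNIV]] contD) auto
  have dP: "(P has_vector_derivative (g p * e p + R p)) (at p)" if p: "p > p0" for p
  proof -
    define r where "r = sqrt (D p)"
    have r: "r > 0" "r\<^sup>2 = D p" using Dpos [OF p] by (auto simp: r_def)
    have dr: "((\<lambda>x. sqrt (D x)) has_vector_derivative E p / (2 * r)) (at p)"
      unfolding has_real_derivative_iff_has_vector_derivative [symmetric] r_def
      using Dpos [OF p] by (auto intro!: derivative_eq_intros DERIV_chain2 [OF DERIV_real_sqrt] dD simp: field_simps)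
    have dK: "((\<lambda>x. K (sqrt (D x))) has_vector_derivative (E p / (2 * r)) *\<^sub>R e p) (at p)"
      using vector_diff_chain_at [OF dr K(1)] r
      by (simp add: o_def r_def [symmetric] e_def flip: of_real_power)
    have dwc: "((\<lambda>x. complex_of_real (w x)) has_vector_derivative complex_of_real (w' p)) (at p)"
      using dw [OF p] by (intro has_vector_derivative_of_real) (simp add: has_real_derivative_iff_has_vector_derivative)
    have "(P has_vector_derivative (g p * complex_of_real (w p)) * ((E p / (2 * r)) *\<^sub>R e p)
        + (g p * complex_of_real (w' p) + g' p * complex_of_real (w p)) * K (sqrt (D p))) (at p)"
      unfolding P_def [abs_def] by (intro has_vector_derivative_mult dK dwc g)
    also have "(g p * complex_of_real (w p)) * ((E p / (2 * r)) *\<^sub>R e p) = g p * e p"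
    proof -
      have "w p * (E p / (2 * r)) = 1" using p r Epos [OF p] by (simp add: w_def r_def)
      then have "complex_of_real (w p) * complex_of_real (E p / (2 * r)) = 1" by (metis of_real_1 of_real_mult)
      then show ?thesis by (simp add: scaleR_conv_of_real algebra_simps)
    qed
    finally show ?thesis using p by (simp add: R_def algebra_simps)
  qed
  have IP: "((\<lambda>p. g p * e p + R p) has_integral (P q - P p0)) {p0..q}"
    using pq contP dP by (intro fundamental_theorem_of_calculus_interior) auto
  have ige: "(\<lambda>p. g p * e p) integrable_on {p0..q}"
    unfolding e_def [abs_def] by (intro integrable_continuous_interval continuous_intros contg contD)
  have IR: "(R has_integral (P q - P p0 - integral {p0..q} (\<lambda>p. g p * e p))) {p0..q}"
    using has_integral_diff [OF IP integrable_integral [OF ige]] by simp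
  have bd: "cmod (R p) \<le> \<kappa> * (\<alpha> * (\<mu> / 2 * (cmod (g' p))\<^sup>2 + (p - p0) powr (2 - 4 * \<delta>) / (2 * \<mu>)) + U * \<beta> * (p - p0) powr (1 - 2 * \<delta>))"
    if p: "p \<in> {p0..q}" and \<mu>: "\<mu> > 0" for p \<mu>
  proof (cases "p = p0")
    case True
    then show ?thesis using nn U0 \<mu> by (simp add: R_def)
  next
    case False
    with p have pp: "p > p0" by auto
    define x where "x = p - p0"
    have x: "x > 0" using pp by (simp add: x_def)
    note rem = convex_remainder_bounds [OF D1 D2 D3 m f2 f3 p, folded D_def E_def x_def]
    have sq: "sqrt (m / 2) * x \<le> sqrt (D p)" "sqrt (D p) \<le> sqrt (M / 2) * x"
      using real_sqrt_le_mono [OF rem(3)] real_sqrt_le_mono [OF rem(4)] x by (simp_all only: real_sqrt_mult real_sqrt_abs abs_of_pos)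
    have m2: "sqrt (m / 2) > 0" using m by simp
    have w: "w p \<le> \<alpha>" "w p \<ge> 0"
    proof -
      have "2 * sqrt (D p) / E p \<le> 2 * (sqrt (M / 2) * x) / (m * x)"
        using sq rem x m M Dpos [OF pp] by (intro frac_le mult_mono) auto
      then show "w p \<le> \<alpha>" using x False by (simp add: w_def \<alpha>_def)
      show "w p \<ge> 0" using False Epos [OF pp] Dpos [OF pp] by (simp add: w_def)
    qed
    have w': "\<bar>w' p\<bar> \<le> \<beta>"
    proof -
      have "\<bar>w' p\<bar> = \<bar>(E p)\<^sup>2 - 2 * D p * f2 p\<bar> / (sqrt (D p) * (E p)\<^sup>2)"
        unfolding w'_def using Dpos [OF pp] by (simp add: abs_mult)
      also have "\<dots> \<le> (N * M / 3 * x ^ 3) / ((sqrt (m / 2) * x) * (m * x)\<^sup>2)"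
        using rem sq x m M N m2 less_imp_le [OF Dpos [OF pp]] less_imp_le [OF Epos [OF pp]]
        by (intro frac_le mult_mono power_mono mult_pos_pos) auto
      also have "\<dots> = \<beta>"
        using x m m2 by (simp add: \<beta>_def power2_eq_square power3_eq_cube)
      finally show ?thesis .
    qed
    have "cmod (K (sqrt (D p))) \<le> L_const \<delta> * \<bar>s\<bar> powr (-\<delta>) * sqrt (D p) powr (1 - 2 * \<delta>)"
      using K(3) Dpos [OF pp] \<delta> by simp
    also have "\<dots> \<le> L_const \<delta> * \<bar>s\<bar> powr (-\<delta>) * (sqrt (m / 2) * x) powr (1 - 2 * \<delta>)"
      using sq(1) m2 x \<delta> L0 by (intro mult_left_mono powr_mono2') auto
    also have "(sqrt (m / 2) * x) powr (1 - 2 * \<delta>) = (m / 2) powr (1/2 - \<delta>) * x powr (1 - 2 * \<delta>)"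
      using m by (simp add: powr_mult powr_half_sqrt [symmetric] powr_powr algebra_simps)
    finally have Kb: "cmod (K (sqrt (D p))) \<le> \<kappa> * x powr (1 - 2 * \<delta>)"
      by (simp add: \<kappa>_def mult.assoc)
    define r where "r = x powr (1 - 2 * \<delta>)"
    have r2: "x powr (2 - 4 * \<delta>) = r\<^sup>2" by (simp add: r_def power2_eq_square powr_add [symmetric])
    have "cmod (R p) \<le> (cmod (g' p) * w p + cmod (g p) * \<bar>w' p\<bar>) * cmod (K (sqrt (D p)))"
      unfolding R_def if_not_P [OF False] norm_mult
      using w by (intro mult_right_mono order_trans [OF norm_triangle_ineq]) (auto simp: norm_mult)
    also have "\<dots> \<le> (cmod (g' p) * \<alpha> + U * \<beta>) * (\<kappa> * r)"
      using w w' Kb U [of p] U0 nn unfolding r_def [symmetric] by (intro mult_mono add_mono) auto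
    also have "\<dots> = \<kappa> * (\<alpha> * (cmod (g' p) * r) + U * \<beta> * r)" by (simp add: algebra_simps)
    also have "\<dots> \<le> \<kappa> * (\<alpha> * (\<mu> / 2 * (cmod (g' p))\<^sup>2 + r\<^sup>2 / (2 * \<mu>)) + U * \<beta> * r)"
    proof -
      have "0 \<le> (\<mu> * cmod (g' p) - r)\<^sup>2 / (2 * \<mu>)" using \<mu> by simp
      also have "\<dots> = \<mu> / 2 * (cmod (g' p))\<^sup>2 + r\<^sup>2 / (2 * \<mu>) - cmod (g' p) * r"
        using \<mu> by (simp add: power2_eq_square field_simps)
      finally show ?thesis using nn by (intro mult_left_mono add_right_mono) auto
    qed
    finally show ?thesis unfolding x_def [symmetric] r2 unfolding r_def [symmetric] .
  qed
  have main: "cmod (P q - P p0 - integral {p0..q} (\<lambda>p. g p * e p)) \<le> \<kappa> * (U * \<beta> * T) + \<kappa> * \<alpha> * (\<mu> / 2 * \<Gamma>\<^sup>2 + (sqrt S)\<^sup>2 / (2 * \<mu>))"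
    if \<mu>: "\<mu> > 0" for \<mu>
  proof -
    have i1: "((\<lambda>p. (p - p0) powr (2 - 4 * \<delta>)) has_integral S) {p0..q}"
      using has_integral_powr_shift [OF pq, of "2 - 4 * \<delta>"] \<delta> by (simp add: S_def)
    have i2: "((\<lambda>p. (p - p0) powr (1 - 2 * \<delta>)) has_integral T) {p0..q}"
      using has_integral_powr_shift [OF pq, of "1 - 2 * \<delta>"] \<delta> by (simp add: T_def)
    have i3: "((\<lambda>p. (cmod (g' p))\<^sup>2) has_integral integral {p0..q} (\<lambda>x. (cmod (g' x))\<^sup>2)) {p0..q}"
      by (intro integrable_integral integrable_continuous_interval continuous_intros g)
    have "((\<lambda>p. \<kappa> * (\<alpha> * (\<mu> / 2 * (cmod (g' p))\<^sup>2 + (p - p0) powr (2 - 4 * \<delta>) / (2 * \<mu>)) + U * \<beta> * (p - p0) powr (1 - 2 * \<delta>)))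
       has_integral \<kappa> * (\<alpha> * (\<mu> / 2 * integral {p0..q} (\<lambda>x. (cmod (g' x))\<^sup>2) + S / (2 * \<mu>)) + U * \<beta> * T)) {p0..q}"
      by (intro has_integral_mult_right has_integral_add has_integral_divide i1 i2 i3)
    then have "cmod (P q - P p0 - integral {p0..q} (\<lambda>p. g p * e p)) \<le> \<kappa> * (\<alpha> * (\<mu> / 2 * integral {p0..q} (\<lambda>x. (cmod (g' x))\<^sup>2) + S / (2 * \<mu>)) + U * \<beta> * T)"
      using has_integral_norm_bound_integral_component [OF IR _, where k = "1::real"] bd [OF _ \<mu>] by simp
    also have "\<dots> \<le> \<kappa> * (\<alpha> * (\<mu> / 2 * \<Gamma>\<^sup>2 + S / (2 * \<mu>)) + U * \<beta> * T)"
      using nn \<mu> \<Gamma> by (intro mult_left_mono add_right_mono) auto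
    finally show ?thesis using nn by (simp add: algebra_simps)
  qed
  have "cmod (P q - P p0 - integral {p0..q} (\<lambda>p. g p * e p)) \<le> \<kappa> * (U * \<beta> * T) + \<kappa> * \<alpha> * (\<Gamma> * sqrt S)"
    by (rule AMGM_optimise [OF main]) (use nn \<Gamma> in auto)
  moreover have "P q = 0" by (simp add: P_def gq)
  moreover have "P p0 = - (g p0 * complex_of_real (sqrt (2 / f2 p0)) *
      (exp (- (complex_of_real (sgn s)) * \<i> * (pi / 4)) * complex_of_real (sqrt pi / 2 * \<bar>s\<bar> powr (-1/2))))"
    by (simp add: P_def D0 K(2) w_def)
  ultimately show ?thesis
    unfolding e_def D_def \<kappa>_def [symmetric] \<alpha>_def [symmetric] \<beta>_def [symmetric] S_def [symmetric] T_def [symmetric]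
    by (simp add: norm_minus_commute algebra_simps)
qed

text \<open>The part to the left of \<open>p0\<close> is the reflection \<open>p \<mapsto> -p\<close> of a part to the right. The two
  boundary terms are equal and add up to the leading term. Each half contributes at most the
  bound belonging to the full length \<open>q2 - q1\<close>, whence the factor \<open>2\<close>.\<close>

lemma stationary_phase:
  fixes f f1 f2 f3 :: "real \<Rightarrow> real" and g g' :: "real \<Rightarrow> complex"
    and p0 q1 q2 s \<delta> m M N U \<Gamma> :: real
  assumes D1: "\<And>x. (f has_real_derivative f1 x) (at x)"
    and D2: "\<And>x. (f1 has_real_derivative f2 x) (at x)"
    and D3: "\<And>x. (f2 has_real_derivative f3 x) (at x)"
    and pos: "\<And>x. f2 x > 0"
    and p0: "p0 \<in> {q1..q2}" and m: "m > 0"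
    and f2: "\<And>x. x \<in> {q1..q2} \<Longrightarrow> m \<le> f2 x" "\<And>x. x \<in> {q1..q2} \<Longrightarrow> f2 x \<le> M"
    and f3: "\<And>x. x \<in> {q1..q2} \<Longrightarrow> \<bar>f3 x\<bar> \<le> N"
    and g: "\<And>x. (g has_vector_derivative g' x) (at x)" "continuous_on UNIV g'"
    and gq: "g q1 = 0" "g q2 = 0" and U: "\<And>x. cmod (g x) \<le> U"
    and \<Gamma>: "integral {q1..q2} (\<lambda>x. (cmod (g' x))\<^sup>2) \<le> \<Gamma>\<^sup>2" "\<Gamma> \<ge> 0"
    and s: "s \<noteq> 0" and \<delta>: "1/2 < \<delta>" "\<delta> < 3/4"
  shows "cmod (integral {q1..q2} (\<lambda>p. g p * exp (- \<i> * s * complex_of_real (f p - f p0 - f1 p0 * (p - p0))))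
           - g p0 * complex_of_real (sqrt (2 * pi / f2 p0)) *
             (exp (- (complex_of_real (sgn s)) * \<i> * (pi / 4)) * complex_of_real (\<bar>s\<bar> powr (-1/2))))
     \<le> 2 * (L_const \<delta> * \<bar>s\<bar> powr (-\<delta>) * (m / 2) powr (1/2 - \<delta>) *
        (2 * sqrt (M / 2) / m * \<Gamma> * sqrt ((q2 - q1) powr (3 - 4 * \<delta>) / (3 - 4 * \<delta>))
         + U * (N * M / (3 * m\<^sup>2 * sqrt (m / 2))) * ((q2 - q1) powr (2 - 2 * \<delta>) / (2 - 2 * \<delta>))))"
proof -
  define \<theta> where "\<theta> = exp (- (complex_of_real (sgn s)) * \<i> * (pi / 4))"
  define h where "h = g p0 * complex_of_real (sqrt (2 / f2 p0)) * (\<theta> * complex_of_real (sqrt pi / 2 * \<bar>s\<bar> powr (-1/2)))"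
  define e where "e p = g p * exp (- \<i> * s * complex_of_real (f p - f p0 - f1 p0 * (p - p0)))" for p
  define B where "B l = L_const \<delta> * \<bar>s\<bar> powr (-\<delta>) * (m / 2) powr (1/2 - \<delta>) *
        (2 * sqrt (M / 2) / m * \<Gamma> * sqrt (l powr (3 - 4 * \<delta>) / (3 - 4 * \<delta>))
         + U * (N * M / (3 * m\<^sup>2 * sqrt (m / 2))) * (l powr (2 - 2 * \<delta>) / (2 - 2 * \<delta>)))" for l
  have M: "M > 0" using f2 [of p0] m p0 by fastforce
  have N: "N \<ge> 0" using f3 [of p0] p0 by fastforce
  have U0: "U \<ge> 0" using U [of p0] norm_ge_zero order_trans by blast
  have Bmono: "B l \<le> B l'" if "0 \<le> l" "l \<le> l'" for l l'
    unfolding B_def using that M N U0 m \<Gamma> \<delta>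
    by (intro mult_left_mono add_mono real_sqrt_le_mono divide_right_mono powr_mono2)
       (auto simp: L_const_def)
  have contg: "continuous_on A g" for A
    using g(1) by (auto intro!: continuous_at_imp_continuous_on has_vector_derivative_continuous)
  have contf: "continuous_on A f" for A
    using D1 by (auto intro!: continuous_at_imp_continuous_on DERIV_isCont)
  have conte: "continuous_on A e" for A
    unfolding e_def [abs_def] by (intro continuous_intros contg contf)
  have \<Gamma>': "integral S (\<lambda>x. (cmod (g' x))\<^sup>2) \<le> \<Gamma>\<^sup>2" if "S = {a..b}" "S \<subseteq> {q1..q2}" for S a b
  proof -
    have "integral S (\<lambda>x. (cmod (g' x))\<^sup>2) \<le> integral {q1..q2} (\<lambda>x. (cmod (g' x))\<^sup>2)"
      using that by (intro integral_subset_le)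
        (auto intro!: integrable_continuous_interval continuous_intros continuous_on_subset [OF g(2)])
    with \<Gamma> show ?thesis by simp
  qed
  have right: "cmod (integral {p0..q2} e - h) \<le> B (q2 - p0)"
    unfolding e_def [abs_def] h_def \<theta>_def B_def
    using p0 by (intro stationary_phase_half [OF D1 D2 D3 pos _ m _ _ _ g(1) _ gq(2) U \<Gamma>' \<Gamma>(2) s \<delta>] f2 f3
        continuous_on_subset [OF g(2)]) auto
  have "cmod (integral {-p0..-q1} (\<lambda>p. g (-p) * exp (- \<i> * s * complex_of_real (f (-p) - f (-(-p0)) - - f1 (-(-p0)) * (p - - p0))))
           - g (-(-p0)) * complex_of_real (sqrt (2 / f2 (-(-p0)))) * (exp (- (complex_of_real (sgn s)) * \<i> * (pi / 4)) * complex_of_real (sqrt pi / 2 * \<bar>s\<bar> powr (-1/2)))) \<le> B (- q1 - - p0)"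
    unfolding B_def
  proof (rule stationary_phase_half [where g' = "\<lambda>x. - g' (-x)" and ?f1.0 = "\<lambda>x. - f1 (-x)" and ?f2.0 = "\<lambda>x. f2 (-x)" and ?f3.0 = "\<lambda>x. - f3 (-x)"])
    fix x
    show "((\<lambda>x. f (- x)) has_real_derivative - f1 (- x)) (at x)"
      using DERIV_chain2 [OF D1, of "\<lambda>x. -x" "-1" x UNIV] DERIV_minus [OF DERIV_ident] by fastforce
    show "((\<lambda>x. - f1 (- x)) has_real_derivative f2 (- x)) (at x)"
      using DERIV_minus [OF DERIV_chain2 [OF D2, of "\<lambda>x. -x" "-1" x UNIV]] DERIV_minus [OF DERIV_ident] by fastforce
    show "((\<lambda>x. f2 (- x)) has_real_derivative - f3 (- x)) (at x)"
      using DERIV_chain2 [OF D3, of "\<lambda>x. -x" "-1" x UNIV] DERIV_minus [OF DERIV_ident] by fastforce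
    have "((\<lambda>x::real. -x) has_vector_derivative -1) (at x)" by (auto intro!: derivative_eq_intros)
    from vector_diff_chain_at [OF this g(1)]
    show "((\<lambda>x. g (- x)) has_vector_derivative - g' (- x)) (at x)" by (simp add: o_def)
  next
    have "integral {- p0..- q1} (\<lambda>x. (cmod (- g' (- x)))\<^sup>2) = integral {q1..p0} (\<lambda>x. (cmod (g' x))\<^sup>2)"
      using Henstock_Kurzweil_Integration.integral_reflect_real [of p0 q1 "\<lambda>x. (cmod (g' x))\<^sup>2"] by simp
    then show "integral {- p0..- q1} (\<lambda>x. (cmod (- g' (- x)))\<^sup>2) \<le> \<Gamma>\<^sup>2"
      using \<Gamma>' [of "{q1..p0}"] p0 by auto
    show "continuous_on {- p0..- q1} (\<lambda>x. - g' (- x))"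
      by (intro continuous_intros continuous_on_compose2 [OF g(2)]) auto
  qed (use p0 m f2 f3 gq U \<Gamma> s \<delta> pos in auto)
  also have "integral {-p0..-q1} (\<lambda>p. g (-p) * exp (- \<i> * s * complex_of_real (f (-p) - f (-(-p0)) - - f1 (-(-p0)) * (p - - p0))))
      = integral {-p0..-q1} (\<lambda>p. e (- p))"
    by (intro integral_cong) (simp add: e_def algebra_simps)
  also have "\<dots> = integral {q1..p0} e"
    by (rule Henstock_Kurzweil_Integration.integral_reflect_real)
  finally have left: "cmod (integral {q1..p0} e - h) \<le> B (p0 - q1)"
    by (simp add: h_def \<theta>_def)
  have "integral {q1..p0} e + integral {p0..q2} e = integral {q1..q2} e"
    using p0 by (intro Henstock_Kurzweil_Integration.integral_combine integrable_continuous_interval conte) auto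
  moreover have "h + h = g p0 * complex_of_real (sqrt (2 * pi / f2 p0)) * (\<theta> * complex_of_real (\<bar>s\<bar> powr (-1/2)))"
    by (simp add: h_def real_sqrt_mult real_sqrt_divide)
  ultimately have "integral {q1..q2} e - g p0 * complex_of_real (sqrt (2 * pi / f2 p0)) * (\<theta> * complex_of_real (\<bar>s\<bar> powr (-1/2)))
      = (integral {q1..p0} e - h) + (integral {p0..q2} e - h)" by simp
  also have "cmod \<dots> \<le> B (p0 - q1) + B (q2 - p0)"
    by (intro norm_triangle_mono left right)
  also have "\<dots> \<le> B (q2 - q1) + B (q2 - q1)"
    using p0 by (intro add_mono Bmono) auto
  finally show ?thesis unfolding e_def [abs_def] \<theta>_def B_def by simp
qed

text \<open>One integration by parts against \<open>e\<^bsup>is(cp - f(p))\<^esup>\<close>. With \<open>\<psi> = c - f'\<close>, the term where the derivative falls on \<open>1/\<psi>\<close>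
  has total mass \<open>\<integral> f''/\<psi>\<^sup>2 = 1/\<psi>(p2) - 1/\<psi>(p1)\<close>; as \<open>\<psi>\<close> keeps its sign, this is at most \<open>1/\<mu>\<close>.\<close>

lemma nonstationary_phase:
  fixes f f1 f2 :: "real \<Rightarrow> real" and g g' :: "real \<Rightarrow> complex"
    and p1 p2 s c \<mu> U \<Gamma> :: real
  assumes D1: "\<And>x. (f has_real_derivative f1 x) (at x)"
    and D2: "\<And>x. (f1 has_real_derivative f2 x) (at x)"
    and pos: "\<And>x. f2 x > 0"
    and p12: "p1 \<le> p2" and \<mu>: "\<mu> > 0"
    and sep: "(\<forall>p\<in>{p1..p2}. \<mu> \<le> c - f1 p) \<or> (\<forall>p\<in>{p1..p2}. \<mu> \<le> f1 p - c)"
    and g: "\<And>x. (g has_vector_derivative g' x) (at x)" "continuous_on UNIV g'"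
    and gp: "g p1 = 0" "g p2 = 0" and U: "\<And>x. cmod (g x) \<le> U"
    and \<Gamma>: "integral {p1..p2} (\<lambda>x. (cmod (g' x))\<^sup>2) \<le> \<Gamma>\<^sup>2" "\<Gamma> \<ge> 0"
    and s: "s \<noteq> 0"
  shows "cmod (integral {p1..p2} (\<lambda>p. g p * exp (\<i> * s * complex_of_real (c * p - f p))))
     \<le> (\<Gamma> * sqrt (p2 - p1) + U) / (\<mu> * \<bar>s\<bar>)"
proof -
  have U0: "U \<ge> 0" using U [of p1] norm_ge_zero order_trans by blast
  define \<psi> where "\<psi> p = c - f1 p" for p
  have \<psi>: "\<mu> \<le> \<bar>\<psi> p\<bar>" "\<psi> p \<noteq> 0" if "p \<in> {p1..p2}" for p
    using sep that \<mu> by (force simp: \<psi>_def)+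
  have d\<psi>: "(\<psi> has_real_derivative - f2 p) (at p within A)" for p A
    unfolding \<psi>_def [abs_def] by (auto intro!: derivative_eq_intros has_field_derivative_at_within [OF D2])
  have contg: "continuous_on A g" for A
    using g(1) by (auto intro!: continuous_at_imp_continuous_on has_vector_derivative_continuous)
  have contf: "continuous_on A f" for A
    using D1 by (auto intro!: continuous_at_imp_continuous_on DERIV_isCont)
  define e where "e p = exp (\<i> * s * complex_of_real (c * p - f p))" for p
  have conte: "continuous_on A e" for A
    unfolding e_def [abs_def] by (intro continuous_intros contf)
  have ne: "cmod (e p) = 1" for p by (simp add: e_def)
  have de: "(e has_vector_derivative \<i> * s * \<psi> p * e p) (at p)" for p
  proof -
    have "((\<lambda>p. c * p - f p) has_real_derivative \<psi> p) (at p)"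
      unfolding \<psi>_def by (auto intro!: derivative_eq_intros D1)
    then have "((\<lambda>p. \<i> * s * complex_of_real (c * p - f p)) has_vector_derivative \<i> * s * \<psi> p) (at p)"
      by (intro has_vector_derivative_mult_right has_vector_derivative_of_real)
         (simp add: has_real_derivative_iff_has_vector_derivative)
    from field_vector_diff_chain_at [OF this DERIV_exp]
    show ?thesis by (simp add: o_def e_def [abs_def])
  qed
  define P where "P p = g p * e p * complex_of_real (inverse (\<psi> p)) / (\<i> * s)" for p
  define R where "R p = (g' p * complex_of_real (inverse (\<psi> p)) + g p * complex_of_real (f2 p / (\<psi> p)\<^sup>2)) * e p / (\<i> * s)" for p
  have dP: "(P has_vector_derivative (g p * e p + R p)) (at p)" if p: "p \<in> {p1..p2}" for p
  proof -
    have "((\<lambda>p. inverse (\<psi> p)) has_real_derivative f2 p / (\<psi> p)\<^sup>2) (at p)"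
      using \<psi>(2) [OF p] by (auto intro!: derivative_eq_intros d\<psi> simp: power2_eq_square field_simps)
    then have "((\<lambda>p. complex_of_real (inverse (\<psi> p))) has_vector_derivative complex_of_real (f2 p / (\<psi> p)\<^sup>2)) (at p)"
      by (intro has_vector_derivative_of_real) (simp add: has_real_derivative_iff_has_vector_derivative)
    then have "(P has_vector_derivative ((g p * e p) * complex_of_real (f2 p / (\<psi> p)\<^sup>2)
       + (g p * (\<i> * s * \<psi> p * e p) + g' p * e p) * complex_of_real (inverse (\<psi> p))) / (\<i> * s)) (at p)"
      unfolding P_def [abs_def] by (intro has_vector_derivative_divide has_vector_derivative_mult de g)
    moreover have "((g p * e p) * complex_of_real (f2 p / (\<psi> p)\<^sup>2)
       + (g p * (\<i> * s * \<psi> p * e p) + g' p * e p) * complex_of_real (inverse (\<psi> p))) / (\<i> * s) = g p * e p + R p"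
      using \<psi>(2) [OF p] s unfolding R_def by (simp add: field_simps)
    ultimately show ?thesis by simp
  qed
  have "((\<lambda>p. g p * e p + R p) has_integral (P p2 - P p1)) {p1..p2}"
    using p12 by (intro fundamental_theorem_of_calculus has_vector_derivative_at_within [OF dP]) auto
  then have IP: "((\<lambda>p. g p * e p + R p) has_integral 0) {p1..p2}" by (simp add: P_def gp)
  have ige: "(\<lambda>p. g p * e p) integrable_on {p1..p2}"
    by (intro integrable_continuous_interval continuous_intros contg conte)
  have IR: "(R has_integral (- integral {p1..p2} (\<lambda>p. g p * e p))) {p1..p2}"
    using has_integral_diff [OF IP integrable_integral [OF ige]] by simp
  have iv: "((\<lambda>p. f2 p / (\<psi> p)\<^sup>2) has_integral inverse (\<psi> p2) - inverse (\<psi> p1)) {p1..p2}"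
  proof (rule fundamental_theorem_of_calculus [OF p12])
    fix p assume p: "p \<in> {p1..p2}"
    show "((\<lambda>p. inverse (\<psi> p)) has_vector_derivative f2 p / (\<psi> p)\<^sup>2) (at p within {p1..p2})"
      unfolding has_real_derivative_iff_has_vector_derivative [symmetric]
      using \<psi>(2) [OF p] by (auto intro!: derivative_eq_intros d\<psi> simp: power2_eq_square field_simps)
  qed
  have ivb: "inverse (\<psi> p2) - inverse (\<psi> p1) \<le> 1 / \<mu>"
    using sep
  proof
    assume "\<forall>p\<in>{p1..p2}. \<mu> \<le> c - f1 p"
    then have "\<mu> \<le> \<psi> p1" "\<mu> \<le> \<psi> p2" using p12 by (auto simp: \<psi>_def)
    then have "inverse (\<psi> p2) \<le> inverse \<mu>" "0 \<le> inverse (\<psi> p1)" using \<mu> by (auto intro: le_imp_inverse_le)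
    then have "inverse (\<psi> p2) - inverse (\<psi> p1) \<le> inverse \<mu>" by linarith
    then show ?thesis by (simp add: inverse_eq_divide)
  next
    assume "\<forall>p\<in>{p1..p2}. \<mu> \<le> f1 p - c"
    then have "\<mu> \<le> - \<psi> p1" "\<mu> \<le> - \<psi> p2" using p12 by (auto simp: \<psi>_def)
    then have "inverse (- \<psi> p1) \<le> inverse \<mu>" "0 \<le> inverse (- \<psi> p2)" using \<mu> by (auto intro: le_imp_inverse_le simp del: inverse_minus_eq)
    then have "inverse (\<psi> p2) - inverse (\<psi> p1) \<le> inverse \<mu>" unfolding inverse_minus_eq by linarith
    then show ?thesis by (simp add: inverse_eq_divide)
  qed
  have main: "cmod (integral {p1..p2} (\<lambda>p. g p * e p)) \<le> U / (\<mu> * \<bar>s\<bar>) + 1 / (\<mu> * \<bar>s\<bar>) * (\<nu> / 2 * \<Gamma>\<^sup>2 + (sqrt (p2 - p1))\<^sup>2 / (2 * \<nu>))"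
    if \<nu>: "\<nu> > 0" for \<nu>
  proof -
    have bd: "cmod (R p) \<le> 1 / \<bar>s\<bar> * (1 / \<mu> * (\<nu> / 2 * (cmod (g' p))\<^sup>2 + 1 / (2 * \<nu>)) + U * (f2 p / (\<psi> p)\<^sup>2))"
      if p: "p \<in> {p1..p2}" for p
    proof -
      have "0 \<le> (\<nu> * cmod (g' p) - 1)\<^sup>2 / (2 * \<nu>)" using \<nu> by simp
      also have "\<dots> = \<nu> / 2 * (cmod (g' p))\<^sup>2 + 1 / (2 * \<nu>) - cmod (g' p)"
        using \<nu> by (simp add: power2_eq_square field_simps)
      finally have a: "cmod (g' p) \<le> \<nu> / 2 * (cmod (g' p))\<^sup>2 + 1 / (2 * \<nu>)" by simp
      have b: "inverse \<bar>\<psi> p\<bar> \<le> 1 / \<mu>" using \<psi> [OF p] \<mu> by (simp add: divide_simps)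
      have "cmod (R p) = cmod (g' p * complex_of_real (inverse (\<psi> p)) + g p * complex_of_real (f2 p / (\<psi> p)\<^sup>2)) / \<bar>s\<bar>"
        by (simp add: R_def norm_mult norm_divide ne del: of_real_divide of_real_inverse)
      also have "\<dots> \<le> (cmod (g' p) * inverse \<bar>\<psi> p\<bar> + cmod (g p) * (f2 p / (\<psi> p)\<^sup>2)) / \<bar>s\<bar>"
        using pos [of p] by (intro divide_right_mono order_trans [OF norm_triangle_ineq])
           (auto simp: norm_mult norm_divide norm_inverse norm_power)
      also have "\<dots> \<le> ((\<nu> / 2 * (cmod (g' p))\<^sup>2 + 1 / (2 * \<nu>)) * (1 / \<mu>) + U * (f2 p / (\<psi> p)\<^sup>2)) / \<bar>s\<bar>"
        using a b U [of p] pos [of p] \<mu> \<nu> U0 by (intro divide_right_mono add_mono mult_mono) auto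
      finally show ?thesis by (simp add: field_simps)
    qed
    have i1: "((\<lambda>p. 1 / (2 * \<nu>)) has_integral (p2 - p1) / (2 * \<nu>)) {p1..p2}"
      using has_integral_const_real [of "1 / (2 * \<nu>)" p1 p2] p12 by simp
    have i3: "((\<lambda>p. (cmod (g' p))\<^sup>2) has_integral integral {p1..p2} (\<lambda>x. (cmod (g' x))\<^sup>2)) {p1..p2}"
      by (intro integrable_integral integrable_continuous_interval continuous_intros continuous_on_subset [OF g(2)]) auto
    have "((\<lambda>p. 1 / \<bar>s\<bar> * (1 / \<mu> * (\<nu> / 2 * (cmod (g' p))\<^sup>2 + 1 / (2 * \<nu>)) + U * (f2 p / (\<psi> p)\<^sup>2)))
       has_integral 1 / \<bar>s\<bar> * (1 / \<mu> * (\<nu> / 2 * integral {p1..p2} (\<lambda>x. (cmod (g' x))\<^sup>2) + (p2 - p1) / (2 * \<nu>)) + U * (inverse (\<psi> p2) - inverse (\<psi> p1)))) {p1..p2}"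
      by (intro has_integral_mult_right has_integral_add i1 iv i3)
    then have "cmod (- integral {p1..p2} (\<lambda>p. g p * e p)) \<le> 1 / \<bar>s\<bar> * (1 / \<mu> * (\<nu> / 2 * integral {p1..p2} (\<lambda>x. (cmod (g' x))\<^sup>2) + (p2 - p1) / (2 * \<nu>)) + U * (inverse (\<psi> p2) - inverse (\<psi> p1)))"
      using has_integral_norm_bound_integral_component [OF IR _, where k = "1::real"] bd by simp
    also have "\<dots> \<le> 1 / \<bar>s\<bar> * (1 / \<mu> * (\<nu> / 2 * \<Gamma>\<^sup>2 + (p2 - p1) / (2 * \<nu>)) + U * (1 / \<mu>))"
      using \<mu> \<nu> \<Gamma> U0 ivb by (intro mult_left_mono add_mono) auto
    finally show ?thesis using p12 by (simp add: algebra_simps)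
  qed
  have "cmod (integral {p1..p2} (\<lambda>p. g p * e p)) \<le> U / (\<mu> * \<bar>s\<bar>) + 1 / (\<mu> * \<bar>s\<bar>) * (\<Gamma> * sqrt (p2 - p1))"
    by (rule AMGM_optimise [OF main]) (use \<mu> \<Gamma> p12 in auto)
  then show ?thesis unfolding e_def [symmetric] by (simp add: add_divide_distrib)
qed

text \<open>The two sides differ by the factor \<open>(M/m)\<^bsup>1-\<delta>\<^esup> \<ge> 1\<close> only.\<close>

lemma C5_dominates:
  fixes \<delta> m M l :: real
  assumes \<delta>: "\<delta> < 3/4" and m: "0 < m" "m \<le> M"
  shows "1 / pi * L_const \<delta> * (m / 2) powr (1/2 - \<delta>) * (2 * sqrt (M / 2) / m) * sqrt (2 * pi) * sqrt (l powr (3 - 4 * \<delta>) / (3 - 4 * \<delta>))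
    \<le> 2 powr (\<delta> + 1/2) * L_const \<delta> / (sqrt pi * sqrt (3 - 4 * \<delta>)) * l powr ((3 - 4 * \<delta>) / 2) * M powr (3/2 - \<delta>) * m powr (- 3/2)"
proof -
  have L: "L_const \<delta> \<ge> 0" by (simp add: L_const_def)
  have M: "M > 0" using m by simp
  have "(2::real) powr (1/2 - \<delta>) = 1 / 2 powr (\<delta> - 1/2)"
    using powr_minus_divide [of "2::real" "\<delta> - 1/2"] by simp
  then have e1: "(m / 2) powr (1/2 - \<delta>) = m powr (1/2 - \<delta>) * 2 powr (\<delta> - 1/2)"
    by (simp add: powr_divide)
  have e2: "(2::real) powr (\<delta> + 1/2) = 2 * 2 powr (\<delta> - 1/2)"
    using powr_add [of "2::real" 1 "\<delta> - 1/2"] by (simp add: add.commute)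
  have e3: "sqrt (M / 2) * sqrt (2 * pi) = sqrt M * sqrt pi" by (simp add: real_sqrt_mult real_sqrt_divide)
  have e4: "sqrt (l powr (3 - 4 * \<delta>) / (3 - 4 * \<delta>)) = l powr ((3 - 4 * \<delta>) / 2) / sqrt (3 - 4 * \<delta>)"
    by (simp add: real_sqrt_divide powr_half_sqrt [symmetric] powr_powr)
  have e5: "M powr (3/2 - \<delta>) = sqrt M * M powr (1 - \<delta>)"
    using M by (simp add: powr_half_sqrt [symmetric] powr_add [symmetric])
  have e6: "m powr (1/2 - \<delta>) / m = m powr (1 - \<delta>) * m powr (- 3/2)"
  proof -
    have "m powr (1/2 - \<delta>) / m = m powr (1/2 - \<delta> - 1)" using m by (simp only: powr_diff) simp
    also have "1/2 - \<delta> - 1 = (1 - \<delta>) + (- 3/2)" by simp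
    finally show ?thesis by (simp only: powr_add)
  qed
  have pp: "1 / pi * sqrt pi = 1 / sqrt pi"
    by (simp add: field_simps)
  have "1 / pi * L_const \<delta> * (m / 2) powr (1/2 - \<delta>) * (2 * sqrt (M / 2) / m) * sqrt (2 * pi) * sqrt (l powr (3 - 4 * \<delta>) / (3 - 4 * \<delta>))
     = 1 / pi * (2 * 2 powr (\<delta> - 1/2)) * L_const \<delta> * (sqrt (M / 2) * sqrt (2 * pi)) * (m powr (1/2 - \<delta>) / m) * sqrt (l powr (3 - 4 * \<delta>) / (3 - 4 * \<delta>))"
    unfolding e1 by simp
  also have "\<dots> = (1 / pi * sqrt pi) * 2 powr (\<delta> + 1/2) * L_const \<delta> * (l powr ((3 - 4 * \<delta>) / 2) / sqrt (3 - 4 * \<delta>)) * (sqrt M * m powr (- 3/2)) * m powr (1 - \<delta>)"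
    unfolding e2 e3 e4 e6 by simp
  also have "\<dots> \<le> (1 / pi * sqrt pi) * 2 powr (\<delta> + 1/2) * L_const \<delta> * (l powr ((3 - 4 * \<delta>) / 2) / sqrt (3 - 4 * \<delta>)) * (sqrt M * m powr (- 3/2)) * M powr (1 - \<delta>)"
    using m M L \<delta> by (intro mult_left_mono powr_mono2 mult_nonneg_nonneg divide_nonneg_nonneg) auto
  finally show ?thesis unfolding pp e5 by (simp add: mult_ac)
qed

text \<open>The left-hand side contains the power \<open>M m\<^bsup>-2-\<delta>\<^esup>\<close>. Those on the right arise from it on multiplication by
  \<open>(M/m)\<^bsup>3/2-\<delta>\<^esup>\<close> and \<open>(M/m)\<^bsup>5/2-\<delta>\<^esup>\<close>, which are at least \<open>1\<close>.\<close>

lemma C6_dominates: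
  fixes \<delta> m M N l :: real
  assumes \<delta>: "\<delta> < 3/4" and m: "0 < m" "m \<le> M" and N: "0 \<le> N"
  shows "1 / pi * L_const \<delta> * (m / 2) powr (1/2 - \<delta>) * (N * M / (3 * m\<^sup>2 * sqrt (m / 2))) * (l powr (2 - 2 * \<delta>) / (2 - 2 * \<delta>))
    \<le> 2 powr (\<delta> - 2) * L_const \<delta> / (pi * (1 - \<delta>)) * l powr (2 - 2 * \<delta>)
         * (M powr (5/2 - \<delta>) * N * m powr (- 7/2)
            + 1/3 * (M powr (7/2 - \<delta>) * N * m powr (- 9/2)))"
proof -
  have L: "L_const \<delta> \<ge> 0" by (simp add: L_const_def)
  have M: "M > 0" using m by simp
  have e1: "(m / 2) powr (1/2 - \<delta>) / sqrt (m / 2) / m\<^sup>2 = m powr (- 2 - \<delta>) * (4 * 2 powr (\<delta> - 2))"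
  proof -
    have "(m / 2) powr (1/2 - \<delta>) / sqrt (m / 2) = (m / 2) powr (1/2 - \<delta> - 1/2)"
      using m by (simp add: powr_diff powr_half_sqrt powr_minus_divide)
    also have "1/2 - \<delta> - 1/2 = - \<delta>" by simp
    also have "(m / 2) powr (- \<delta>) = m powr (- \<delta>) * 2 powr \<delta>"
      by (simp add: powr_divide powr_minus_divide)
    finally have "(m / 2) powr (1/2 - \<delta>) / sqrt (m / 2) / m\<^sup>2 = m powr (- \<delta>) / m powr 2 * 2 powr \<delta>"
      using m by simp
    also have "m powr (- \<delta>) / m powr 2 = m powr (- \<delta> - 2)" by (simp only: powr_diff)
    also have "- \<delta> - 2 = - 2 - \<delta>" by simp
    also have "2 powr \<delta> = 4 * 2 powr (\<delta> - 2)"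
      using powr_add [of "2::real" 2 "\<delta> - 2"] by simp
    finally show ?thesis .
  qed
  have r1: "M * m powr (- 2 - \<delta>) \<le> M powr (5/2 - \<delta>) * m powr (- 7/2)"
  proof -
    have "M * m powr (- 2 - \<delta>) = M * m powr (- 7/2) * m powr (3/2 - \<delta>)" by (simp add: powr_add [symmetric])
    also have "\<dots> \<le> M * m powr (- 7/2) * M powr (3/2 - \<delta>)"
      using m M \<delta> by (intro mult_left_mono powr_mono2) auto
    also have "M * m powr (- 7/2) * M powr (3/2 - \<delta>) = (M powr 1 * M powr (3/2 - \<delta>)) * m powr (- 7/2)"
      using M by simp
    also have "M powr 1 * M powr (3/2 - \<delta>) = M powr (5/2 - \<delta>)" by (simp only: powr_add [symmetric]) simp
    finally show ?thesis .
  qed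
  have r2: "M * m powr (- 2 - \<delta>) \<le> M powr (7/2 - \<delta>) * m powr (- 9/2)"
  proof -
    have "M * m powr (- 2 - \<delta>) = M * m powr (- 9/2) * m powr (5/2 - \<delta>)" by (simp add: powr_add [symmetric])
    also have "\<dots> \<le> M * m powr (- 9/2) * M powr (5/2 - \<delta>)"
      using m M \<delta> by (intro mult_left_mono powr_mono2) auto
    also have "M * m powr (- 9/2) * M powr (5/2 - \<delta>) = (M powr 1 * M powr (5/2 - \<delta>)) * m powr (- 9/2)"
      using M by simp
    also have "M powr 1 * M powr (5/2 - \<delta>) = M powr (7/2 - \<delta>)" by (simp only: powr_add [symmetric]) simp
    finally show ?thesis .
  qed
  have "1 / pi * L_const \<delta> * (m / 2) powr (1/2 - \<delta>) * (N * M / (3 * m\<^sup>2 * sqrt (m / 2))) * (l powr (2 - 2 * \<delta>) / (2 - 2 * \<delta>))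
     = 1 / pi * L_const \<delta> * ((m / 2) powr (1/2 - \<delta>) / sqrt (m / 2) / m\<^sup>2) * (N * M / 3) * (l powr (2 - 2 * \<delta>) / (2 * (1 - \<delta>)))"
    by (simp add: field_simps)
  also have "\<dots> = 2 powr (\<delta> - 2) * L_const \<delta> / (pi * (1 - \<delta>)) * l powr (2 - 2 * \<delta>) * N * (2/3 * (M * m powr (- 2 - \<delta>)))"
    unfolding e1 using \<delta> by (simp add: field_simps)
  also have "\<dots> \<le> 2 powr (\<delta> - 2) * L_const \<delta> / (pi * (1 - \<delta>)) * l powr (2 - 2 * \<delta>) * N *
      (M powr (5/2 - \<delta>) * m powr (- 7/2) + 1/3 * (M powr (7/2 - \<delta>) * m powr (- 9/2)))"
  proof (rule mult_left_mono)
    have "0 \<le> M * m powr (- 2 - \<delta>)" using M by simp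
    with r1 r2 show "2/3 * (M * m powr (- 2 - \<delta>)) \<le> M powr (5/2 - \<delta>) * m powr (- 7/2) + 1/3 * (M powr (7/2 - \<delta>) * m powr (- 9/2))"
      by linarith
  qed (use L N \<delta> in auto)
  finally show ?thesis by (simp add: algebra_simps)
qed

section \<open>Fourier transform and Plancherel's identity\<close>

lemma integral_of_supported:
  fixes f :: "real \<Rightarrow> 'a::euclidean_space"
  assumes f: "continuous_on {a..b} f" and z: "\<And>x. x \<notin> {a..b} \<Longrightarrow> f x = 0"
  shows "integrable lborel f" and "(\<integral>x. f x \<partial>lborel) = integral {a..b} f"
proof -
  have si: "set_integrable lborel {a..b} f"
    using f by (rule borel_integrable_atLeastAtMost')
  have "(\<lambda>x. indicat_real {a..b} x *\<^sub>R f x) = f" using z by (auto simp: indicator_def)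
  then show "integrable lborel f" "(\<integral>x. f x \<partial>lborel) = integral {a..b} f"
    using si set_borel_integral_eq_integral(2) [OF si] by (auto simp: set_integrable_def set_lebesgue_integral_def)
qed

lemma norm_character [simp]:
  "cmod (exp (- \<i> * complex_of_real x * complex_of_real p)) = 1"
  "cmod (exp (\<i> * complex_of_real x * complex_of_real p)) = 1"
  by (simp_all)

lemma integrable_mult_character:
  fixes u :: "real \<Rightarrow> complex"
  assumes u: "integrable lborel u"
  shows "integrable lborel (\<lambda>x. u x * exp (- \<i> * complex_of_real x * complex_of_real p))"
    and "integrable lborel (\<lambda>x. u x * exp (\<i> * complex_of_real x * complex_of_real p))"
proof -
  note [measurable] = borel_measurable_integrable [OF u]
  show "integrable lborel (\<lambda>x. u x * exp (- \<i> * complex_of_real x * complex_of_real p))"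
    by (rule Bochner_Integration.integrable_bound [OF u]) (auto simp: norm_mult)
  show "integrable lborel (\<lambda>x. u x * exp (\<i> * complex_of_real x * complex_of_real p))"
    by (rule Bochner_Integration.integrable_bound [OF u]) (auto simp: norm_mult)
qed

lemma fourier_bound:
  fixes u :: "real \<Rightarrow> complex"
  assumes u: "integrable lborel u"
  shows "cmod (fourier u p) \<le> L1_norm u"
  unfolding fourier_def L1_norm_def
  by (rule order_trans [OF integral_norm_bound]) (simp add: norm_mult)

lemma continuous_fourier:
  fixes u :: "real \<Rightarrow> complex"
  assumes u: "integrable lborel u"
  shows "continuous_on UNIV (fourier u)"
proof (rule continuous_at_imp_continuous_on, intro ballI)
  fix p :: real
  note [measurable] = borel_measurable_integrable [OF u]
  show "isCont (fourier u) p"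
    unfolding continuous_at_sequentially
  proof (intro allI impI)
    fix X :: "nat \<Rightarrow> real" assume X: "X \<longlonglongrightarrow> p"
    show "(fourier u \<circ> X) \<longlonglongrightarrow> fourier u p"
      unfolding o_def fourier_def
    proof (rule integral_dominated_convergence [where w = "\<lambda>x. cmod (u x)"])
      show "AE x in lborel. (\<lambda>i. u x * exp (- \<i> * complex_of_real x * complex_of_real (X i))) \<longlonglongrightarrow> u x * exp (- \<i> * complex_of_real x * complex_of_real p)"
        by (intro always_eventually allI tendsto_intros X)
    qed (use u in \<open>auto simp: norm_mult\<close>)
  qed
qed

lemma norm_exp_imag_diff_le: "cmod (exp (\<i> * complex_of_real t) - 1) \<le> \<bar>t\<bar>"
  using iexp_approx1 [of t 0] by simp

lemma has_vector_derivative_iff_quotient: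
  fixes f :: "real \<Rightarrow> 'a::real_normed_vector"
  shows "(f has_vector_derivative D) (at x) \<longleftrightarrow> ((\<lambda>h. (f (x + h) - f x) /\<^sub>R h) \<longlongrightarrow> D) (at 0)"
proof -
  have "((\<lambda>h. (f (x + h) - f x) /\<^sub>R h) \<longlongrightarrow> D) (at 0) \<longleftrightarrow> ((\<lambda>h. norm ((f (x + h) - f x) /\<^sub>R h - D)) \<longlongrightarrow> 0) (at 0)"
    by (simp add: tendsto_norm_zero_iff LIM_zero_iff)
  also have "\<dots> \<longleftrightarrow> ((\<lambda>h. norm (f (x + h) - f x - h *\<^sub>R D) / norm h) \<longlongrightarrow> 0) (at 0)"
  proof (rule filterlim_cong [OF refl refl])
    have "norm ((f (x + h) - f x) /\<^sub>R h - D) = norm (f (x + h) - f x - h *\<^sub>R D) / norm h" if "h \<noteq> 0" for h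
    proof -
      have "(f (x + h) - f x) /\<^sub>R h - D = (f (x + h) - f x - h *\<^sub>R D) /\<^sub>R h"
        using that by (simp add: scaleR_diff_right)
      then show ?thesis by (simp add: divide_inverse mult.commute)
    qed
    then show "\<forall>\<^sub>F h in at 0. norm ((f (x + h) - f x) /\<^sub>R h - D) = norm (f (x + h) - f x - h *\<^sub>R D) / norm h"
      by (simp add: eventually_at_filter)
  qed
  also have "\<dots> \<longleftrightarrow> (f has_vector_derivative D) (at x)"
    by (simp add: has_vector_derivative_def has_derivative_at bounded_linear_scaleR_left)
  finally show ?thesis ..
qed

text \<open>Difference quotients under the integral sign are dominated by \<open>|x u(x)|\<close>, because
  \<open>|e\<^bsup>it\<^esup> - 1| \<le> |t|\<close>.\<close>

lemma fourier_has_derivative: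
  fixes u :: "real \<Rightarrow> complex"
  assumes u: "integrable lborel u" and xu: "integrable lborel (\<lambda>x. of_real x * u x)"
  shows "(fourier u has_vector_derivative fourier (\<lambda>x. - \<i> * (of_real x * u x)) p) (at p)"
proof -
  note [measurable] = borel_measurable_integrable [OF u]
  let ?c = "\<lambda>x p. exp (- \<i> * complex_of_real x * complex_of_real p)"
  have "((\<lambda>h. (fourier u (p + h) - fourier u p) /\<^sub>R h) \<longlongrightarrow> fourier (\<lambda>x. - \<i> * (of_real x * u x)) p) (at 0)"
    unfolding tendsto_at_iff_sequentially
  proof (intro allI impI)
    fix X :: "nat \<Rightarrow> real" assume X: "\<forall>i. X i \<in> UNIV - {0}" "X \<longlonglongrightarrow> 0"
    then have X0: "X i \<noteq> 0" for i by auto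
    have eq: "(fourier u (p + X i) - fourier u p) /\<^sub>R X i = (\<integral>x. u x * ?c x p * ((exp (\<i> * of_real (- x * X i)) - 1) /\<^sub>R X i) \<partial>lborel)" for i
    proof -
      have "fourier u (p + X i) - fourier u p = (\<integral>x. u x * ?c x (p + X i) - u x * ?c x p \<partial>lborel)"
        unfolding fourier_def
        by (intro Bochner_Integration.integral_diff [symmetric] integrable_mult_character u)
      also have "\<dots> = (\<integral>x. u x * ?c x p * (exp (\<i> * of_real (- x * X i)) - 1) \<partial>lborel)"
        by (intro Bochner_Integration.integral_cong) (simp_all add: exp_add [symmetric] algebra_simps)
      finally show ?thesis
        by (simp only: integral_scaleR_right [symmetric] mult_scaleR_right)
    qed
    show "((\<lambda>h. (fourier u (p + h) - fourier u p) /\<^sub>R h) \<circ> X) \<longlonglongrightarrow> fourier (\<lambda>x. - \<i> * (of_real x * u x)) p"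
      unfolding o_def eq unfolding fourier_def
    proof (rule integral_dominated_convergence [where w = "\<lambda>x. cmod (of_real x * u x)"])
      show "integrable lborel (\<lambda>x. cmod (of_real x * u x))" using xu by (rule integrable_norm)
      show "AE x in lborel. (\<lambda>i. u x * ?c x p * ((exp (\<i> * of_real (- x * X i)) - 1) /\<^sub>R X i)) \<longlonglongrightarrow> - \<i> * (of_real x * u x) * ?c x p"
      proof (intro always_eventually allI)
        fix x :: real
        have "((\<lambda>h::real. exp (\<i> * of_real (- x * h))) has_vector_derivative (- \<i> * of_real x)) (at 0)"
        proof -
          have "((\<lambda>h::real. \<i> * of_real (- x * h)) has_vector_derivative (- \<i> * of_real x)) (at 0)"
            by (auto intro!: derivative_eq_intros)
          from field_vector_diff_chain_at [OF this DERIV_exp]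
          show ?thesis by (simp add: o_def)
        qed
        then have "((\<lambda>h::real. (exp (\<i> * of_real (- x * h)) - 1) /\<^sub>R h) \<longlongrightarrow> - \<i> * of_real x) (at 0)"
          unfolding has_vector_derivative_iff_quotient by simp
        then have "(\<lambda>i. (exp (\<i> * of_real (- x * X i)) - 1) /\<^sub>R X i) \<longlonglongrightarrow> - \<i> * of_real x"
          using X unfolding tendsto_at_iff_sequentially by (auto simp: o_def)
        then have "(\<lambda>i. u x * ?c x p * ((exp (\<i> * of_real (- x * X i)) - 1) /\<^sub>R X i)) \<longlonglongrightarrow> u x * ?c x p * (- \<i> * of_real x)"
          by (intro tendsto_intros)
        then show "(\<lambda>i. u x * ?c x p * ((exp (\<i> * of_real (- x * X i)) - 1) /\<^sub>R X i)) \<longlonglongrightarrow> - \<i> * (of_real x * u x) * ?c x p"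
          by (simp add: mult_ac)
      qed
      fix i
      show "AE x in lborel. cmod (u x * ?c x p * ((exp (\<i> * of_real (- x * X i)) - 1) /\<^sub>R X i)) \<le> cmod (of_real x * u x)"
      proof (intro always_eventually allI)
        fix x :: real
        have "cmod ((exp (\<i> * of_real (- x * X i)) - 1) /\<^sub>R X i) \<le> \<bar>x\<bar>"
          using norm_exp_imag_diff_le [of "- x * X i"] X0 [of i] by (simp add: divide_simps abs_mult del: of_real_mult of_real_minus)
        then show "cmod (u x * ?c x p * ((exp (\<i> * of_real (- x * X i)) - 1) /\<^sub>R X i)) \<le> cmod (of_real x * u x)"
          unfolding norm_mult norm_character norm_of_real
          by (subst (2) mult.commute) (simp only: mult_1_right mult_left_mono norm_ge_zero)
      qed
    qed auto
  qed
  then show ?thesis by (simp only: has_vector_derivative_iff_quotient)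
qed

text \<open>Fubini's theorem for the kernel \<open>e\<^bsup>icxp\<^esup>\<close>; both signs of \<open>c\<close> occur in the proof of Plancherel's identity.\<close>

lemma multiplication_formula:
  fixes u F :: "real \<Rightarrow> complex" and c :: real
  assumes u: "integrable lborel u" and F: "integrable lborel F"
  shows "(\<integral>p. F p * (\<integral>x. u x * exp (\<i> * complex_of_real (c * x * p)) \<partial>lborel) \<partial>lborel)
       = (\<integral>x. u x * (\<integral>p. F p * exp (\<i> * complex_of_real (c * x * p)) \<partial>lborel) \<partial>lborel)"
proof -
  note [measurable] = borel_measurable_integrable [OF u] borel_measurable_integrable [OF F]
  let ?k = "\<lambda>x p. F p * u x * exp (\<i> * complex_of_real (c * x * p))"
  have int: "integrable (lborel \<Otimes>\<^sub>M lborel) (\<lambda>(x, p). ?k x p)"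
  proof (rule lborel_pair.Fubini_integrable)
    have "(\<lambda>x. \<integral>p. norm (case (x, p) of (x, p) \<Rightarrow> ?k x p) \<partial>lborel) = (\<lambda>x. cmod (u x) * (\<integral>p. cmod (F p) \<partial>lborel))"
      by (simp add: norm_mult mult.commute)
    then show "integrable lborel (\<lambda>x. \<integral>p. norm (case (x, p) of (x, p) \<Rightarrow> ?k x p) \<partial>lborel)"
      using u by simp
    show "AE x in lborel. integrable lborel (\<lambda>p. case (x, p) of (x, p) \<Rightarrow> ?k x p)"
    proof (intro always_eventually allI)
      fix x
      show "integrable lborel (\<lambda>p. case (x, p) of (x, p) \<Rightarrow> ?k x p)"
        by (rule Bochner_Integration.integrable_bound [of _ "\<lambda>p. u x * F p"]) (use F in \<open>auto simp: norm_mult\<close>)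
    qed
  qed measurable
  have "(\<integral>p. F p * (\<integral>x. u x * exp (\<i> * complex_of_real (c * x * p)) \<partial>lborel) \<partial>lborel) = (\<integral>p. (\<integral>x. ?k x p \<partial>lborel) \<partial>lborel)"
    by (simp add: mult.assoc)
  also have "\<dots> = (\<integral>x. (\<integral>p. ?k x p \<partial>lborel) \<partial>lborel)"
    using int by (rule lborel_pair.Fubini_integral)
  also have "\<dots> = (\<integral>x. u x * (\<integral>p. F p * exp (\<i> * complex_of_real (c * x * p)) \<partial>lborel) \<partial>lborel)"
    by (intro Bochner_Integration.integral_cong refl) (simp add: mult_ac flip: integral_mult_right_zero)
  finally show ?thesis .
qed

lemma gaussian_fourier:
  fixes e t :: real
  assumes e: "e > 0"
  shows "(\<integral>p. complex_of_real (exp (- (e * p)\<^sup>2 / 2)) * exp (\<i> * complex_of_real (t * p)) \<partial>lborel)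
       = complex_of_real (sqrt (2 * pi) / e * exp (- (t / e)\<^sup>2 / 2))"
    and "integrable lborel (\<lambda>p. exp (- (e * p)\<^sup>2 / 2))"
proof -
  have g: "exp (- (e * p)\<^sup>2 / 2) = sqrt (2 * pi) * std_normal_density (0 + e * p)" for p
    by (simp add: std_normal_density_def)
  have "integrable lborel std_normal_density" by simp
  then show "integrable lborel (\<lambda>p. exp (- (e * p)\<^sup>2 / 2))"
    unfolding g using e by (intro integrable_mult_right lborel_integrable_real_affine) auto
  have "complex_of_real (exp (- ((t / e)\<^sup>2) / 2)) = char std_normal_distribution (t / e)"
    by (simp add: char_std_normal_distribution)
  also have "\<dots> = (\<integral>x. std_normal_density x *\<^sub>R exp (\<i> * complex_of_real (t / e * x)) \<partial>lborel)"
    unfolding char_def by (subst integral_density) auto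
  also have "\<dots> = \<bar>e\<bar> *\<^sub>R (\<integral>p. std_normal_density (0 + e * p) *\<^sub>R exp (\<i> * complex_of_real (t / e * (0 + e * p))) \<partial>lborel)"
    using e by (intro lborel_integral_real_affine) auto
  also have "\<dots> = e *\<^sub>R (\<integral>p. (1 / sqrt (2 * pi)) *\<^sub>R (complex_of_real (exp (- (e * p)\<^sup>2 / 2)) * exp (\<i> * complex_of_real (t * p))) \<partial>lborel)"
  proof -
    have "std_normal_density (0 + e * p) *\<^sub>R exp (\<i> * complex_of_real (t / e * (0 + e * p)))
       = (1 / sqrt (2 * pi)) *\<^sub>R (complex_of_real (exp (- (e * p)\<^sup>2 / 2)) * exp (\<i> * complex_of_real (t * p)))" for p
      using e by (simp add: std_normal_density_def scaleR_conv_of_real)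
    with e show ?thesis by simp
  qed
  also have "\<dots> = (e / sqrt (2 * pi)) *\<^sub>R (\<integral>p. complex_of_real (exp (- (e * p)\<^sup>2 / 2)) * exp (\<i> * complex_of_real (t * p)) \<partial>lborel)"
    by (simp only: integral_scaleR_right scaleR_scaleR) simp
  finally show "(\<integral>p. complex_of_real (exp (- (e * p)\<^sup>2 / 2)) * exp (\<i> * complex_of_real (t * p)) \<partial>lborel)
       = complex_of_real (sqrt (2 * pi) / e * exp (- (t / e)\<^sup>2 / 2))"
    using e by (simp add: scaleR_conv_of_real field_simps)
qed

text \<open>The integral of \<open>|\<F>u|\<^sup>2\<close> is damped by a Gaussian of width \<open>1/e\<close>. Two applications of the
  multiplication formula turn the damped integral into the pairing of \<open>u\<close> with its convolution
  by an approximate identity, which tends to \<open>2\<pi> \<parallel>u\<parallel>\<^sup>2\<close> by dominated convergence as \<open>e \<rightarrow> 0\<close>.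
  Monotone convergence on the Fourier side then yields both the integrability of \<open>|\<F>u|\<^sup>2\<close> and its
  value.\<close>

theorem plancherel:
  fixes u :: "real \<Rightarrow> complex"
  assumes u: "integrable lborel u" and cont: "continuous_on UNIV u" and bdd: "\<And>x. cmod (u x) \<le> B"
  shows "integrable lborel (\<lambda>p. (cmod (fourier u p))\<^sup>2)"
    and "(\<integral>p. (cmod (fourier u p))\<^sup>2 \<partial>lborel) = 2 * pi * (\<integral>x. (cmod (u x))\<^sup>2 \<partial>lborel)"
proof -
  have [measurable]: "u \<in> borel_measurable borel" using borel_measurable_continuous_onI [OF cont] .
  have [measurable]: "(\<lambda>x. cnj (u x)) \<in> borel_measurable borel"
    by (intro borel_measurable_continuous_onI continuous_intros cont)
  have [measurable]: "fourier u \<in> borel_measurable borel"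
    using borel_measurable_continuous_onI [OF continuous_fourier [OF u]] .
  have cu: "integrable lborel (\<lambda>x. cnj (u x))" using u by simp
  define e where "e n = 1 / real (Suc n)" for n
  have e: "e n > 0" for n by (simp add: e_def)
  have elim: "e \<longlonglongrightarrow> 0" unfolding e_def [abs_def] by (rule LIMSEQ_Suc [OF lim_1_over_n])
  define G where "G n p = exp (- (e n * p)\<^sup>2 / 2)" for n p
  have Gint: "integrable lborel (\<lambda>p. complex_of_real (G n p))" for n
    unfolding G_def using gaussian_fourier(2) [OF e] by simp
  have GFint: "integrable lborel (\<lambda>p. complex_of_real (G n p) * fourier u p)" for n
    by (rule Bochner_Integration.integrable_bound [of _ "\<lambda>p. L1_norm u *\<^sub>R G n p"])
       (use gaussian_fourier(2) [OF e, of n] order_trans [OF fourier_bound [OF u] abs_ge_self] in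
         \<open>auto simp: G_def norm_mult mult.commute abs_mult intro!: mult_right_mono\<close>)
  let ?I = "\<lambda>n y. \<integral>w. u (y - e n * w) * complex_of_real (sqrt (2 * pi) * exp (- w\<^sup>2 / 2)) \<partial>lborel"
  \<comment> \<open>Inner application of the multiplication formula, followed by the substitution \<open>x = y - e w\<close>.\<close>
  have step: "(\<integral>p. complex_of_real (G n p) * fourier u p * exp (\<i> * complex_of_real (y * p)) \<partial>lborel) = ?I n y" for n y
  proof -
    have "integrable lborel (\<lambda>p. complex_of_real (G n p) * exp (\<i> * complex_of_real y * complex_of_real p))"
      using integrable_mult_character(2) [OF Gint, of n y] by (simp add: mult_ac)
    then have int: "integrable lborel (\<lambda>p. complex_of_real (G n p) * exp (\<i> * complex_of_real (y * p)))"
      by (simp add: mult.assoc)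
    have "(\<integral>p. complex_of_real (G n p) * fourier u p * exp (\<i> * complex_of_real (y * p)) \<partial>lborel)
      = (\<integral>p. (complex_of_real (G n p) * exp (\<i> * complex_of_real (y * p))) * (\<integral>x. u x * exp (\<i> * complex_of_real (-1 * x * p)) \<partial>lborel) \<partial>lborel)"
      unfolding fourier_def by (simp add: mult_ac)
    also have "\<dots> = (\<integral>x. u x * (\<integral>p. complex_of_real (G n p) * exp (\<i> * complex_of_real (y * p)) * exp (\<i> * complex_of_real (-1 * x * p)) \<partial>lborel) \<partial>lborel)"
      by (rule multiplication_formula [OF u int])
    also have "\<dots> = (\<integral>x. u x * complex_of_real (sqrt (2 * pi) / e n * exp (- ((y - x) / e n)\<^sup>2 / 2)) \<partial>lborel)"
    proof -
      have "(\<integral>p. complex_of_real (G n p) * exp (\<i> * complex_of_real (y * p)) * exp (\<i> * complex_of_real (-1 * x * p)) \<partial>lborel)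
          = (\<integral>p. complex_of_real (exp (- (e n * p)\<^sup>2 / 2)) * exp (\<i> * complex_of_real ((y - x) * p)) \<partial>lborel)" for x
        unfolding G_def mult.assoc by (simp add: exp_add [symmetric] algebra_simps)
      then show ?thesis by (simp only: gaussian_fourier(1) [OF e])
    qed
    also have "\<dots> = \<bar>- e n\<bar> *\<^sub>R (\<integral>w. u (y + (- e n) * w) * complex_of_real (sqrt (2 * pi) / e n * exp (- ((y - (y + (- e n) * w)) / e n)\<^sup>2 / 2)) \<partial>lborel)"
      using e [of n] by (intro lborel_integral_real_affine) auto
    also have "\<dots> = (\<integral>w. e n *\<^sub>R (u (y + (- e n) * w) * complex_of_real (sqrt (2 * pi) / e n * exp (- ((y - (y + (- e n) * w)) / e n)\<^sup>2 / 2))) \<partial>lborel)"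
      using e [of n] by simp
    also have "\<dots> = ?I n y"
      using e [of n] by (intro Bochner_Integration.integral_cong refl) (simp add: scaleR_conv_of_real)
    finally show ?thesis .
  qed
  \<comment> \<open>Outer application, now for the conjugate of \<open>u\<close> and the opposite sign in the kernel.\<close>
  have F1: "complex_of_real (\<integral>p. G n p * (cmod (fourier u p))\<^sup>2 \<partial>lborel) = (\<integral>y. cnj (u y) * ?I n y \<partial>lborel)" for n
  proof -
    have "complex_of_real (\<integral>p. G n p * (cmod (fourier u p))\<^sup>2 \<partial>lborel) = (\<integral>p. (complex_of_real (G n p) * fourier u p) * cnj (fourier u p) \<partial>lborel)"
    proof -
      have "complex_of_real (G n p * (cmod (fourier u p))\<^sup>2) = complex_of_real (G n p) * fourier u p * cnj (fourier u p)" for p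
        using complex_norm_square [of "fourier u p"] by (simp add: mult.assoc)
      then show ?thesis by (simp only: integral_complex_of_real [symmetric])
    qed
    also have "\<dots> = (\<integral>p. (complex_of_real (G n p) * fourier u p) * (\<integral>y. cnj (u y) * exp (\<i> * complex_of_real (1 * y * p)) \<partial>lborel) \<partial>lborel)"
    proof -
      have "cnj (fourier u p) = (\<integral>y. cnj (u y) * exp (\<i> * complex_of_real (1 * y * p)) \<partial>lborel)" for p
      proof -
        have "(\<integral>y. cnj (u y) * exp (\<i> * complex_of_real (1 * y * p)) \<partial>lborel)
            = (\<integral>y. cnj (u y * exp (- \<i> * complex_of_real y * complex_of_real p)) \<partial>lborel)"
          by (intro Bochner_Integration.integral_cong) (simp_all add: exp_cnj mult.assoc)
        then show ?thesis unfolding fourier_def by (simp only: Bochner_Integration.integral_cnj)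
      qed
      then show ?thesis by (simp only:)
    qed
    also have "\<dots> = (\<integral>y. cnj (u y) * (\<integral>p. complex_of_real (G n p) * fourier u p * exp (\<i> * complex_of_real (1 * y * p)) \<partial>lborel) \<partial>lborel)"
      by (rule multiplication_formula [OF cu GFint])
    finally show ?thesis by (simp only: mult_1_left step)
  qed
  have lim: "(\<lambda>n. \<integral>y. cnj (u y) * ?I n y \<partial>lborel) \<longlonglongrightarrow> (\<integral>y. cnj (u y) * (u y * complex_of_real (2 * pi)) \<partial>lborel)"
  proof -
    have gi: "integrable lborel (\<lambda>w::real. sqrt (2 * pi) * exp (- w\<^sup>2 / 2))"
      and gv: "(\<integral>w. sqrt (2 * pi) * exp (- w\<^sup>2 / 2) \<partial>lborel) = 2 * pi"
    proof -
      have g: "sqrt (2 * pi) * exp (- w\<^sup>2 / 2) = 2 * pi * std_normal_density w" for w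
        by (simp add: std_normal_density_def real_sqrt_mult field_simps)
      show "integrable lborel (\<lambda>w::real. sqrt (2 * pi) * exp (- w\<^sup>2 / 2))" unfolding g by simp
      show "(\<integral>w. sqrt (2 * pi) * exp (- w\<^sup>2 / 2) \<partial>lborel) = 2 * pi"
        unfolding g using integral_std_normal_moment_even [of 0] by simp
    qed
    have B0: "B \<ge> 0" using bdd [of 0] norm_ge_zero order_trans by blast
    have bnd: "cmod (u (y - e n * w) * complex_of_real (sqrt (2 * pi) * exp (- w\<^sup>2 / 2))) \<le> B * (sqrt (2 * pi) * exp (- w\<^sup>2 / 2))" for y w n
      unfolding norm_mult norm_of_real using bdd B0 by (intro mult_mono) auto
    have Ilim: "(\<lambda>n. ?I n y) \<longlonglongrightarrow> (\<integral>w. u y * complex_of_real (sqrt (2 * pi) * exp (- w\<^sup>2 / 2)) \<partial>lborel)" for y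
    proof (rule integral_dominated_convergence [where w = "\<lambda>w. B * (sqrt (2 * pi) * exp (- w\<^sup>2 / 2))"])
      show "AE w in lborel. (\<lambda>n. u (y - e n * w) * complex_of_real (sqrt (2 * pi) * exp (- w\<^sup>2 / 2))) \<longlonglongrightarrow> u y * complex_of_real (sqrt (2 * pi) * exp (- w\<^sup>2 / 2))"
      proof (intro always_eventually allI tendsto_intros)
        fix w
        have "isCont u y" using cont by (simp add: continuous_on_eq_continuous_at)
        moreover have "(\<lambda>n. y - e n * w) \<longlonglongrightarrow> y - 0 * w" by (intro tendsto_intros elim)
        ultimately show "(\<lambda>n. u (y - e n * w)) \<longlonglongrightarrow> u y" by (auto intro: isCont_tendsto_compose)
      qed
    qed (use gi bnd in auto)
    have Ival: "(\<integral>w. u y * complex_of_real (sqrt (2 * pi) * exp (- w\<^sup>2 / 2)) \<partial>lborel) = u y * complex_of_real (2 * pi)" for y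
      by (subst integral_mult_right_zero) (simp only: integral_complex_of_real gv)
    have Ibd: "cmod (?I n y) \<le> B * (2 * pi)" for n y
    proof -
      have "cmod (?I n y) \<le> (\<integral>w. B * (sqrt (2 * pi) * exp (- w\<^sup>2 / 2)) \<partial>lborel)"
      proof (rule Bochner_Integration.integral_norm_bound_integral)
        show "integrable lborel (\<lambda>w. u (y - e n * w) * complex_of_real (sqrt (2 * pi) * exp (- w\<^sup>2 / 2)))"
          by (rule Bochner_Integration.integrable_bound [of _ "\<lambda>w. B * (sqrt (2 * pi) * exp (- w\<^sup>2 / 2))"])
             (use gi bnd order_trans [OF bnd abs_ge_self] in auto)
      qed (use gi bnd in auto)
      also have "\<dots> = B * (2 * pi)" by (subst integral_mult_right_zero) (simp only: gv)
      finally show ?thesis .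
    qed
    show ?thesis
    proof (rule integral_dominated_convergence [where w = "\<lambda>y. cmod (u y) * (B * (2 * pi))"])
      show "integrable lborel (\<lambda>y. cmod (u y) * (B * (2 * pi)))" using u by simp
      show "AE y in lborel. (\<lambda>n. cnj (u y) * ?I n y) \<longlonglongrightarrow> cnj (u y) * (u y * complex_of_real (2 * pi))"
        using Ilim unfolding Ival by (intro always_eventually allI tendsto_intros)
      show "AE y in lborel. cmod (cnj (u y) * ?I n y) \<le> cmod (u y) * (B * (2 * pi))" for n
        unfolding norm_mult complex_mod_cnj using Ibd by (intro always_eventually allI mult_left_mono) auto
    qed measurable
  qed
  have val: "(\<integral>y. cnj (u y) * (u y * complex_of_real (2 * pi)) \<partial>lborel) = complex_of_real (2 * pi * (\<integral>x. (cmod (u x))\<^sup>2 \<partial>lborel))"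
  proof -
    have "cnj (u y) * (u y * complex_of_real (2 * pi)) = complex_of_real (2 * pi * (cmod (u y))\<^sup>2)" for y
      using complex_norm_square [of "u y"] by (simp add: mult_ac)
    then show ?thesis by (simp only: integral_complex_of_real integral_mult_right_zero)
  qed
  have lim': "(\<lambda>n. \<integral>p. G n p * (cmod (fourier u p))\<^sup>2 \<partial>lborel) \<longlonglongrightarrow> 2 * pi * (\<integral>x. (cmod (u x))\<^sup>2 \<partial>lborel)"
    using lim unfolding F1 [symmetric] val tendsto_of_real_iff .
  have G2: "integrable lborel (\<lambda>p. G n p * (cmod (fourier u p))\<^sup>2)" for n
  proof (rule Bochner_Integration.integrable_bound [of _ "\<lambda>p. (L1_norm u)\<^sup>2 * G n p"])
    show "integrable lborel (\<lambda>p. (L1_norm u)\<^sup>2 * G n p)" using gaussian_fourier(2) [OF e, of n] by (simp add: G_def)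
    have "(cmod (fourier u p))\<^sup>2 \<le> (L1_norm u)\<^sup>2" for p
      using fourier_bound [OF u] by (intro power_mono) auto
    then show "AE p in lborel. norm (G n p * (cmod (fourier u p))\<^sup>2) \<le> norm ((L1_norm u)\<^sup>2 * G n p)"
      by (auto simp: G_def mult.commute intro!: mult_right_mono)
  qed (simp add: G_def [abs_def])
  have mono: "mono (\<lambda>n. G n p * (cmod (fourier u p))\<^sup>2)" for p
  proof (rule monoI)
    fix n m :: nat assume "n \<le> m"
    then have "e m \<le> e n" by (simp add: e_def frac_le)
    then have "(e m * p)\<^sup>2 \<le> (e n * p)\<^sup>2"
      using e [of m] by (simp add: power_mult_distrib mult_right_mono power_mono)
    then show "G n p * (cmod (fourier u p))\<^sup>2 \<le> G m p * (cmod (fourier u p))\<^sup>2"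
      by (intro mult_right_mono) (auto simp: G_def)
  qed
  have Glim: "(\<lambda>n. G n p * (cmod (fourier u p))\<^sup>2) \<longlonglongrightarrow> (cmod (fourier u p))\<^sup>2" for p
  proof -
    have "(\<lambda>n. G n p * (cmod (fourier u p))\<^sup>2) \<longlonglongrightarrow> exp (- (0 * p)\<^sup>2 / 2) * (cmod (fourier u p))\<^sup>2"
      unfolding G_def by (intro tendsto_intros elim) auto
    then show ?thesis by simp
  qed
  note mc = integral_monotone_convergence_nonneg [OF G2 _ _ _ lim', where u = "\<lambda>p. (cmod (fourier u p))\<^sup>2"]
  show "integrable lborel (\<lambda>p. (cmod (fourier u p))\<^sup>2)"
    by (rule mc(1)) (use mono Glim in \<open>auto simp: G_def\<close>)
  show "(\<integral>p. (cmod (fourier u p))\<^sup>2 \<partial>lborel) = 2 * pi * (\<integral>x. (cmod (u x))\<^sup>2 \<partial>lborel)"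
    by (rule mc(2)) (use mono Glim in \<open>auto simp: G_def\<close>)
qed

section \<open>Essential suprema, Schwartz functions and symbols\<close>

text \<open>A bound that holds almost everywhere holds on a dense subset of the interval, hence, by
  continuity, everywhere, end points included.\<close>

lemma abs_le_Linf_norm:
  fixes h :: "real \<Rightarrow> real"
  assumes cont: "continuous_on UNIV h" and ab: "a < b" and p: "p \<in> {a..b}"
  shows "\<bar>h p\<bar> \<le> Linf_norm a b h"
proof -
  let ?M = "lebesgue_on {a<..<b}"
  let ?h = "\<lambda>x. ereal \<bar>h x\<bar>"
  have "continuous_on {a..b} (\<lambda>x. \<bar>h x\<bar>)"
    using cont by (intro continuous_intros) (auto intro: continuous_on_subset)
  then have "bounded ((\<lambda>x. \<bar>h x\<bar>) ` {a..b})" by (intro compact_imp_bounded compact_continuous_image) auto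
  then obtain C where C: "\<And>x. x \<in> {a..b} \<Longrightarrow> \<bar>h x\<bar> \<le> C" unfolding bounded_iff by force
  have [measurable]: "h \<in> borel_measurable borel" using borel_measurable_continuous_onI [OF cont] .
  have "?h \<in> borel_measurable lborel" by measurable
  then have "?h \<in> borel_measurable lebesgue" by (rule measurable_completion)
  then have meas: "?h \<in> borel_measurable ?M" by (rule measurable_restrict_space1)
  have ub: "esssup ?M ?h \<le> ereal C"
    by (rule esssup_I [OF meas]) (use C in \<open>auto intro!: AE_I2\<close>)
  have ae: "AE x in ?M. ?h x \<le> esssup ?M ?h" by (rule esssup_AE)
  \<comment> \<open>A nonempty open set is not null, so it meets the set where the almost sure bound holds.\<close>
  have dense: "\<exists>x\<in>S. ?h x \<le> esssup ?M ?h" if S: "open S" "S \<inter> {a<..<b} \<noteq> {}" for S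
  proof (rule ccontr)
    assume "\<not> ?thesis"
    then have "AE x in ?M. x \<notin> S" using ae by (auto elim: eventually_mono)
    then have "AE x in lebesgue. x \<in> {a<..<b} \<longrightarrow> x \<notin> S"
      by (subst (asm) AE_restrict_space_iff) auto
    then have "AE x in lborel. x \<notin> S \<inter> {a<..<b}"
      by (subst (asm) AE_completion_iff) (auto elim: eventually_mono)
    moreover have bor: "S \<inter> {a<..<b} \<in> sets borel" using S by auto
    ultimately have "S \<inter> {a<..<b} \<in> null_sets lborel" by (simp add: AE_iff_null_sets)
    then have "negligible (S \<inter> {a<..<b})"
      using bor by (simp add: negligible_iff_null_sets null_sets_completionI)
    moreover have "open (S \<inter> {a<..<b})" using S by (intro open_Int) auto
    ultimately show False using S(2) open_not_negligible by blast
  qed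
  define E where "E = Linf_norm a b h"
  have "\<exists>x\<in>{a<..<b}. ?h x \<le> esssup ?M ?h" using dense [of "{a<..<b}"] ab by auto
  then have "esssup ?M ?h \<noteq> -\<infinity>" by auto
  with ub have E: "esssup ?M ?h = ereal E" unfolding E_def Linf_norm_def
    by (cases "esssup ?M ?h") auto
  show ?thesis
  proof (rule ccontr)
    assume "\<not> ?thesis"
    then have lt: "E < \<bar>h p\<bar>" by (simp add: E_def)
    have "continuous_on UNIV (\<lambda>x. \<bar>h x\<bar>)" using cont by (intro continuous_intros)
    then have op: "open {x. E < \<bar>h x\<bar>}" by (simp add: open_Collect_less)
    have "p \<in> closure {a<..<b}" using p ab by simp
    with op lt have "{x. E < \<bar>h x\<bar>} \<inter> {a<..<b} \<noteq> {}"
      by (auto simp: closure_iff_nhds_not_empty)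
    from dense [OF op this] show False using E by auto
  qed
qed

lemma integrable_quadratic_decay:
  fixes u :: "real \<Rightarrow> complex"
  assumes cont: "continuous_on UNIV u" and b: "\<And>x. (1 + x\<^sup>2) * cmod (u x) \<le> C"
  shows "integrable lborel u"
proof -
  have [measurable]: "u \<in> borel_measurable borel" using borel_measurable_continuous_onI [OF cont] .
  have i: "integrable lborel (\<lambda>x::real. inverse (1 + x\<^sup>2))"
    using integrable_inverse_1_plus_square by (simp add: set_integrable_def)
  show ?thesis
  proof (rule Bochner_Integration.integrable_bound [OF integrable_mult_right [OF i, of C]])
    have pos: "0 < 1 + x\<^sup>2" for x :: real by (smt (verit) zero_le_power2)
    have "cmod (u x) \<le> C * inverse (1 + x\<^sup>2)" for x
      using b [of x] pos [of x] by (simp add: field_simps)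
    then show "AE x in lborel. norm (u x) \<le> norm (C * inverse (1 + x\<^sup>2))"
      by (intro always_eventually allI) (use order_trans [OF _ abs_ge_self] in auto)
  qed simp
qed

lemma schwartz_integrable:
  assumes "schwartz u"
  shows "continuous_on UNIV u" "\<exists>B. \<forall>x. cmod (u x) \<le> B"
    and "integrable lborel u" "integrable lborel (\<lambda>x. of_real x * u x)"
proof -
  have n0: "nth_vderiv 0 u = u" by (simp add: nth_vderiv_def)
  have sch: "\<And>n x. nth_vderiv n u differentiable (at x)"
    "\<And>n k. bounded (range (\<lambda>x. \<bar>x\<bar> ^ k *\<^sub>R nth_vderiv n u x))"
    using assms unfolding schwartz_def by blast+
  have "u differentiable (at x)" for x using sch(1) [of 0 x] by (simp only: n0)
  then show cont: "continuous_on UNIV u"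
    by (intro continuous_at_imp_continuous_on) (auto intro: differentiable_imp_continuous_within)
  have "bounded (range (\<lambda>x. \<bar>x\<bar> ^ k *\<^sub>R u x))" for k using sch(2) [of k 0] by (simp only: n0)
  then have "\<exists>C. \<forall>x. \<bar>x\<bar> ^ k * cmod (u x) \<le> C" for k by (auto simp: bounded_iff power_abs)
  then obtain C where C: "\<And>k x. \<bar>x\<bar> ^ k * cmod (u x) \<le> C k" by metis
  show "\<exists>B. \<forall>x. cmod (u x) \<le> B" using C [of _ 0] by auto
  show "integrable lborel u"
  proof (rule integrable_quadratic_decay [OF cont])
    fix x show "(1 + x\<^sup>2) * cmod (u x) \<le> C 0 + C 2"
      using C [of x 0] C [of x 2] by (simp add: algebra_simps)
  qed
  show "integrable lborel (\<lambda>x. of_real x * u x)"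
  proof (rule integrable_quadratic_decay)
    show "continuous_on UNIV (\<lambda>x. of_real x * u x)" by (intro continuous_intros cont)
    fix x :: real
    have "\<bar>x\<bar> ^ 3 = x\<^sup>2 * \<bar>x\<bar>" by (simp add: power3_eq_cube power2_eq_square)
    then have "(1 + x\<^sup>2) * cmod (of_real x * u x) = \<bar>x\<bar> ^ 1 * cmod (u x) + \<bar>x\<bar> ^ 3 * cmod (u x)"
      by (simp add: norm_mult algebra_simps)
    also have "\<dots> \<le> C 1 + C 3" by (intro add_mono C)
    finally show "(1 + x\<^sup>2) * cmod (of_real x * u x) \<le> C 1 + C 3" .
  qed
qed

lemma is_symbol_derivs:
  assumes "is_symbol f"
  shows "(f has_real_derivative deriv f x) (at x)"
    and "(deriv f has_real_derivative (deriv ^^ 2) f x) (at x)"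
    and "((deriv ^^ 2) f has_real_derivative (deriv ^^ 3) f x) (at x)"
    and "(deriv ^^ 2) f x > 0"
    and "continuous_on A ((deriv ^^ n) f)"
proof -
  have d: "(deriv ^^ n) f field_differentiable (at x)" for n x using assms by (simp add: is_symbol_def)
  have "((deriv ^^ n) f has_real_derivative (deriv ^^ Suc n) f x) (at x)" for n
    using DERIV_deriv_iff_field_differentiable [THEN iffD2, OF d [of n x]] by simp
  from this [of 0] this [of 1] this [of 2]
  show "(f has_real_derivative deriv f x) (at x)"
    "(deriv f has_real_derivative (deriv ^^ 2) f x) (at x)"
    "((deriv ^^ 2) f has_real_derivative (deriv ^^ 3) f x) (at x)"
    by (simp_all add: numeral_2_eq_2 numeral_3_eq_3)
  show "(deriv ^^ 2) f x > 0" using assms by (simp add: is_symbol_def)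
  show "continuous_on A ((deriv ^^ n) f)"
    using d by (intro continuous_at_imp_continuous_on ballI) (simp add: field_differentiable_imp_continuous_at)
qed

section \<open>The packet as a Fourier transform of compactly supported data\<close>

locale localised_packet =
  fixes f :: "real \<Rightarrow> real" and u0 :: "real \<Rightarrow> complex" and p1 p2 :: real
  assumes p12: "p1 < p2"
    and symbol: "is_symbol f"
    and u0: "schwartz u0"
    and supp: "closure {p. fourier u0 p \<noteq> 0} \<subseteq> {p1..p2}"
    and unit: "L2_norm u0 = 1"
begin

abbreviation f1 :: "real \<Rightarrow> real" where "f1 \<equiv> deriv f"
abbreviation f2 :: "real \<Rightarrow> real" where "f2 \<equiv> (deriv ^^ 2) f"
abbreviation v :: "real \<Rightarrow> complex" where "v \<equiv> fourier u0"
definition v' :: "real \<Rightarrow> complex" where "v' = fourier (\<lambda>x. - \<i> * (of_real x * u0 x))"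

text \<open>The datum in momentum space, propagated to time \<open>\<tau>\<close> and translated by \<open>-\<xi>\<close> in position; \<open>g'\<close>
  is its derivative.\<close>

definition g :: "real \<Rightarrow> real \<Rightarrow> real \<Rightarrow> complex"
  where "g \<tau> \<xi> p = v p * exp (\<i> * of_real (\<xi> * p - \<tau> * f p))"

definition g' :: "real \<Rightarrow> real \<Rightarrow> real \<Rightarrow> complex"
  where "g' \<tau> \<xi> p = (v' p + \<i> * of_real (\<xi> - \<tau> * f1 p) * v p) * exp (\<i> * of_real (\<xi> * p - \<tau> * f p))"

lemma v_deriv: "(v has_vector_derivative v' p) (at p)"
  unfolding v'_def by (intro fourier_has_derivative schwartz_integrable u0)

lemma cont_v: "continuous_on A v" and cont_v': "continuous_on A v'"
proof -
  have "continuous_on UNIV v" by (intro continuous_fourier schwartz_integrable u0)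
  then show "continuous_on A v" by (rule continuous_on_subset) simp
  have "continuous_on UNIV v'"
    unfolding v'_def by (intro continuous_fourier integrable_mult_right schwartz_integrable u0)
  then show "continuous_on A v'" by (rule continuous_on_subset) simp
qed

lemma cont_f: "continuous_on A f" and cont_f1: "continuous_on A f1" and cont_f2: "continuous_on A f2"
  using is_symbol_derivs(5) [OF symbol, of _ 0] is_symbol_derivs(5) [OF symbol, of _ 1] is_symbol_derivs(5) [OF symbol, of _ 2]
  by simp_all

lemma v_zero: "p \<notin> {p1<..<p2} \<Longrightarrow> v p = 0"
proof -
  assume p: "p \<notin> {p1<..<p2}"
  have "- {p1..p2} \<subseteq> {p. v p = 0}"
  proof
    fix p assume "p \<in> - {p1..p2}"
    then have "p \<notin> closure {p. v p \<noteq> 0}" using supp by (meson ComplD subsetD)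
    then have "p \<notin> {p. v p \<noteq> 0}" using closure_subset by (meson subsetD)
    then show "p \<in> {p. v p = 0}" by simp
  qed
  moreover have "closed {p. v p = 0}"
    by (intro closed_Collect_eq cont_v continuous_on_const)
  ultimately have "closure (- {p1..p2}) \<subseteq> {p. v p = 0}" by (rule closure_minimal)
  moreover have "p \<in> closure (- {p1..p2})" using p by (simp add: closure_complement)
  ultimately show "v p = 0" by (simp add: subset_iff)
qed

lemma v'_zero: "p \<notin> {p1..p2} \<Longrightarrow> v' p = 0"
proof -
  assume p: "p \<notin> {p1..p2}"
  have "((\<lambda>x. 0) has_vector_derivative v' p) (at p)"
    by (rule has_vector_derivative_transform_within_open [OF v_deriv, of "- {p1..p2}"])
       (use p v_zero in auto)
  then show "v' p = 0" using vector_derivative_unique_at has_vector_derivative_const by blast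
qed

lemma g_deriv: "(g \<tau> \<xi> has_vector_derivative g' \<tau> \<xi> p) (at p)"
proof -
  have "((\<lambda>p. \<xi> * p - \<tau> * f p) has_real_derivative \<xi> - \<tau> * f1 p) (at p)"
    by (auto intro!: derivative_eq_intros is_symbol_derivs symbol)
  then have "((\<lambda>p. \<i> * complex_of_real (\<xi> * p - \<tau> * f p)) has_vector_derivative \<i> * of_real (\<xi> - \<tau> * f1 p)) (at p)"
    by (intro has_vector_derivative_mult_right has_vector_derivative_of_real)
       (simp add: has_real_derivative_iff_has_vector_derivative)
  from has_vector_derivative_mult [OF v_deriv field_vector_diff_chain_at [OF this DERIV_exp]]
  show ?thesis unfolding g_def [abs_def] g'_def by (simp add: o_def algebra_simps)
qed

lemma cont_g: "continuous_on A (g \<tau> \<xi>)" and cont_g': "continuous_on A (g' \<tau> \<xi>)"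
  unfolding g_def [abs_def] g'_def [abs_def] by (intro continuous_intros cont_v cont_v' cont_f cont_f1)+

lemma g_zero: "p \<notin> {p1<..<p2} \<Longrightarrow> g \<tau> \<xi> p = 0" and g'_zero: "p \<notin> {p1..p2} \<Longrightarrow> g' \<tau> \<xi> p = 0"
  by (auto simp: g_def g'_def v_zero v'_zero)

lemma norm_g: "cmod (g \<tau> \<xi> p) = cmod (v p)"
  and norm_g': "cmod (g' \<tau> \<xi> p) = cmod (v' p + \<i> * of_real (\<xi> - \<tau> * f1 p) * v p)"
  by (simp_all add: g_def g'_def norm_mult)

lemma norm_g_le: "cmod (g \<tau> \<xi> p) \<le> L1_norm u0"
  unfolding norm_g by (intro fourier_bound schwartz_integrable u0)

lemma bounded_if_supported:
  fixes h :: "real \<Rightarrow> 'a::euclidean_space"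
  assumes "continuous_on {p1..p2} h" "\<And>p. p \<notin> {p1..p2} \<Longrightarrow> h p = 0"
  shows "\<exists>B. \<forall>p. norm (h p) \<le> B"
proof -
  have "bounded (h ` {p1..p2})" using assms by (intro compact_imp_bounded compact_continuous_image) auto
  then obtain B where "\<forall>x\<in>{p1..p2}. norm (h x) \<le> B" by (auto simp: bounded_iff)
  then have "norm (h p) \<le> max B 0" for p
    using assms(2) [of p] by (cases "p \<in> {p1..p2}") (auto simp: le_max_iff_disj)
  then show ?thesis by blast
qed

lemma integrable_g: "integrable lborel (g \<tau> \<xi>)" and integrable_g': "integrable lborel (g' \<tau> \<xi>)"
  using integral_of_supported(1) [OF cont_g, of p1 p2] integral_of_supported(1) [OF cont_g', of p1 p2] g_zero g'_zero
  by (metis greaterThanLessThan_subseteq_atLeastAtMost_iff order_refl subsetD)+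

lemma fourier_g: "fourier (g \<tau> \<xi>) y = 2 * pi * wave_packet f u0 \<tau> (\<xi> - y)"
proof -
  have "fourier (g \<tau> \<xi>) y = (\<integral>p. v p * exp (- \<i> * \<tau> * f p + \<i> * complex_of_real (\<xi> - y) * p) \<partial>lborel)"
    unfolding fourier_def [of "g \<tau> \<xi>"] g_def
    by (intro Bochner_Integration.integral_cong) (simp_all add: exp_add [symmetric] algebra_simps)
  then show ?thesis by (simp add: wave_packet_def)
qed

text \<open>Integration by parts; the boundary terms vanish because \<open>g\<close> is supported in the open interval.\<close>

lemma fourier_g': "fourier (g' \<tau> \<xi>) y = \<i> * of_real y * fourier (g \<tau> \<xi>) y"
proof -
  let ?e = "\<lambda>p. exp (- \<i> * complex_of_real p * complex_of_real y)"
  let ?G = "\<lambda>p. g \<tau> \<xi> p * ?e p"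
  let ?G' = "\<lambda>p. g' \<tau> \<xi> p * ?e p - \<i> * of_real y * (g \<tau> \<xi> p * ?e p)"
  have dG: "(?G has_vector_derivative ?G' p) (at p)" for p
  proof -
    have "((\<lambda>p. - \<i> * complex_of_real p * complex_of_real y) has_vector_derivative - \<i> * of_real y) (at p)"
      by (auto intro!: derivative_eq_intros)
    from has_vector_derivative_mult [OF g_deriv field_vector_diff_chain_at [OF this DERIV_exp]]
    show ?thesis by (simp add: o_def algebra_simps)
  qed
  have c: "continuous_on {p1..p2} ?G'" by (intro continuous_intros cont_g cont_g')
  have "(?G' has_integral ?G p2 - ?G p1) {p1..p2}"
    using p12 by (intro fundamental_theorem_of_calculus has_vector_derivative_at_within [OF dG]) auto
  then have "integral {p1..p2} ?G' = 0" by (simp add: g_zero integral_unique)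
  moreover have "?G' p = 0" if "p \<notin> {p1..p2}" for p
  proof -
    have "p \<notin> {p1<..<p2}" using that by auto
    show ?thesis by (simp add: g_zero [OF \<open>p \<notin> {p1<..<p2}\<close>] g'_zero [OF that])
  qed
  ultimately have "(\<integral>p. ?G' p \<partial>lborel) = 0"
    using integral_of_supported(2) [OF c] by metis
  moreover have "(\<integral>p. ?G' p \<partial>lborel) = fourier (g' \<tau> \<xi>) y - \<i> * of_real y * fourier (g \<tau> \<xi>) y"
    unfolding fourier_def
    by (simp only: Bochner_Integration.integral_diff [OF integrable_mult_character(1) [OF integrable_g']
          integrable_mult_right [OF integrable_mult_character(1) [OF integrable_g]]] integral_mult_right_zero)
  ultimately show ?thesis by simp
qed

section \<open>Position moments and the minimal variance\<close>

text \<open>The propagator has modulus \<open>1\<close> in momentum space, so Plancherel's identity carries the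
  normalisation of \<open>u0\<close> over to every time.\<close>

lemma packet_unit:
  "integrable lborel (\<lambda>x. (cmod (wave_packet f u0 \<tau> x))\<^sup>2)"
  "(\<integral>x. (cmod (wave_packet f u0 \<tau> x))\<^sup>2 \<partial>lborel) = 1"
  "(\<integral>p. (cmod (v p))\<^sup>2 \<partial>lborel) = 2 * pi"
proof -
  obtain B where B: "\<And>x. cmod (u0 x) \<le> B" using schwartz_integrable [OF u0] by blast
  have v2: "(\<integral>p. (cmod (v p))\<^sup>2 \<partial>lborel) = 2 * pi * (\<integral>x. (cmod (u0 x))\<^sup>2 \<partial>lborel)"
    by (rule plancherel(2) [OF _ _ B]) (intro schwartz_integrable u0)+
  have "(\<integral>x. (cmod (u0 x))\<^sup>2 \<partial>lborel) = 1" using unit by (simp add: L2_norm_def)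
  with v2 show v2': "(\<integral>p. (cmod (v p))\<^sup>2 \<partial>lborel) = 2 * pi" by simp
  note pl = plancherel [OF integrable_g cont_g norm_g_le, of \<tau> 0]
  have eq: "(cmod (wave_packet f u0 \<tau> (0 + (-1) * y)))\<^sup>2 = (cmod (fourier (g \<tau> 0) y))\<^sup>2 / (4 * pi\<^sup>2)" for y
    by (simp add: fourier_g norm_mult power_mult_distrib)
  have "integrable lborel (\<lambda>y. (cmod (wave_packet f u0 \<tau> (0 + (-1) * y)))\<^sup>2)"
    unfolding eq using pl(1) by simp
  then show "integrable lborel (\<lambda>x. (cmod (wave_packet f u0 \<tau> x))\<^sup>2)"
    by (subst (asm) lborel_integrable_real_affine_iff) auto
  have "(\<integral>x. (cmod (wave_packet f u0 \<tau> x))\<^sup>2 \<partial>lborel) = \<bar>-1\<bar> *\<^sub>R (\<integral>y. (cmod (wave_packet f u0 \<tau> (0 + (-1) * y)))\<^sup>2 \<partial>lborel)"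
    by (rule lborel_integral_real_affine) simp
  also have "\<dots> = (\<integral>y. (cmod (fourier (g \<tau> 0) y))\<^sup>2 \<partial>lborel) / (4 * pi\<^sup>2)"
    unfolding eq by simp
  also have "\<dots> = 1" unfolding pl(2) norm_g v2' by (simp add: power2_eq_square)
  finally show "(\<integral>x. (cmod (wave_packet f u0 \<tau> x))\<^sup>2 \<partial>lborel) = 1" .
qed

definition spread :: "real \<Rightarrow> real \<Rightarrow> real"
  where "spread \<tau> \<xi> = (\<integral>p. (cmod (g' \<tau> \<xi> p))\<^sup>2 \<partial>lborel) / (2 * pi)"

text \<open>Plancherel's identity for \<open>g'\<close>.\<close>

lemma packet_moment:
  "integrable lborel (\<lambda>x. (x - \<xi>)\<^sup>2 * (cmod (wave_packet f u0 \<tau> x))\<^sup>2)"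
  "(\<integral>x. (x - \<xi>)\<^sup>2 * (cmod (wave_packet f u0 \<tau> x))\<^sup>2 \<partial>lborel) = spread \<tau> \<xi>"
proof -
  obtain B where B: "\<And>x. cmod (g' \<tau> \<xi> x) \<le> B" using bounded_if_supported [OF cont_g' g'_zero] by blast
  note pl = plancherel [OF integrable_g' cont_g' B]
  have eq: "(\<xi> + (-1) * y - \<xi>)\<^sup>2 * (cmod (wave_packet f u0 \<tau> (\<xi> + (-1) * y)))\<^sup>2 = (cmod (fourier (g' \<tau> \<xi>) y))\<^sup>2 / (4 * pi\<^sup>2)" for y
    by (simp add: fourier_g' fourier_g norm_mult power_mult_distrib)
  have "integrable lborel (\<lambda>y. (\<xi> + (-1) * y - \<xi>)\<^sup>2 * (cmod (wave_packet f u0 \<tau> (\<xi> + (-1) * y)))\<^sup>2)"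
    unfolding eq using pl(1) by simp
  then show "integrable lborel (\<lambda>x. (x - \<xi>)\<^sup>2 * (cmod (wave_packet f u0 \<tau> x))\<^sup>2)"
    using lborel_integrable_real_affine_iff [of "-1" "\<lambda>x. (x - \<xi>)\<^sup>2 * (cmod (wave_packet f u0 \<tau> x))\<^sup>2" \<xi>] by simp
  have "(\<integral>x. (x - \<xi>)\<^sup>2 * (cmod (wave_packet f u0 \<tau> x))\<^sup>2 \<partial>lborel)
      = \<bar>-1\<bar> *\<^sub>R (\<integral>y. (\<xi> + (-1) * y - \<xi>)\<^sup>2 * (cmod (wave_packet f u0 \<tau> (\<xi> + (-1) * y)))\<^sup>2 \<partial>lborel)"
    by (rule lborel_integral_real_affine) simp
  also have "\<dots> = (\<integral>y. (cmod (fourier (g' \<tau> \<xi>) y))\<^sup>2 \<partial>lborel) / (4 * pi\<^sup>2)"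
    unfolding eq by simp
  also have "\<dots> = spread \<tau> \<xi>" unfolding pl(2) spread_def by (simp add: power2_eq_square)
  finally show "(\<integral>x. (x - \<xi>)\<^sup>2 * (cmod (wave_packet f u0 \<tau> x))\<^sup>2 \<partial>lborel) = spread \<tau> \<xi>" .
qed

lemma L2_norm_packet: "L2_norm (\<lambda>x. (x - \<xi>) * wave_packet f u0 \<tau> x) = sqrt (spread \<tau> \<xi>)"
  unfolding L2_norm_def packet_moment(2) [symmetric]
  by (simp add: norm_mult power_mult_distrib flip: of_real_diff)

lemma spread_nonneg: "spread \<tau> \<xi> \<ge> 0"
  unfolding spread_def by simp

lemma spread_eq_moments: "spread \<tau> \<xi> = moment2 (wave_packet f u0 \<tau>) - 2 * \<xi> * moment1 (wave_packet f u0 \<tau>) + \<xi>\<^sup>2"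
proof -
  let ?w = "\<lambda>x. (cmod (wave_packet f u0 \<tau> x))\<^sup>2"
  note i0 = packet_unit(1) [of \<tau>] and i2 = packet_moment(1) [of 0 \<tau>, simplified]
  \<comment> \<open>\<open>2x = x\<^sup>2 + 1 - (x - 1)\<^sup>2\<close> reduces the first moment to the moments already known to be finite.\<close>
  have i1: "integrable lborel (\<lambda>x. x * ?w x)"
  proof -
    have "integrable lborel (\<lambda>x. (x\<^sup>2 * ?w x + ?w x - (x - 1)\<^sup>2 * ?w x) / 2)"
      by (intro integrable_divide Bochner_Integration.integrable_diff Bochner_Integration.integrable_add i0 i2 packet_moment(1))
    moreover have "(x\<^sup>2 * ?w x + ?w x - (x - 1)\<^sup>2 * ?w x) / 2 = x * ?w x" for x
      by (simp add: power2_eq_square algebra_simps)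
    ultimately show ?thesis by simp
  qed
  have "spread \<tau> \<xi> = (\<integral>x. x\<^sup>2 * ?w x - 2 * \<xi> * (x * ?w x) + \<xi>\<^sup>2 * ?w x \<partial>lborel)"
    unfolding packet_moment(2) [symmetric]
    by (intro Bochner_Integration.integral_cong) (simp_all add: power2_eq_square algebra_simps)
  also have "\<dots> = (\<integral>x. x\<^sup>2 * ?w x \<partial>lborel) - 2 * \<xi> * (\<integral>x. x * ?w x \<partial>lborel) + \<xi>\<^sup>2 * (\<integral>x. ?w x \<partial>lborel)"
    using i0 i1 i2 by simp
  finally show ?thesis by (simp add: moment1_def moment2_def packet_unit(2))
qed

text \<open>The coefficients are weighted integrals over momentum. The inequality \<open>B\<^sup>2 < C\<close> says that the group velocity \<open>f'\<close> has
  positive variance under the density \<open>|\<F>u\<^sub>0|\<^sup>2/2\<pi>\<close>: otherwise \<open>f'\<close> would equal its mean wherever the density is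
  nonzero, that is, the density would live on at most one point.\<close>

lemma spread_quadratic:
  obtains A C B D E where
    "\<And>\<tau> \<xi>. spread \<tau> \<xi> = A + C * \<tau>\<^sup>2 - 2 * B * \<tau> * \<xi> + \<xi>\<^sup>2 + D * \<tau> + E * \<xi>" "B\<^sup>2 < C"
proof -
  define \<rho> where "\<rho> p = Im (v' p * cnj (v p))" for p
  define W where "W p = (cmod (v p))\<^sup>2" for p
  have int: "integrable lborel h"
    if "continuous_on UNIV h" "\<And>p. v p = 0 \<Longrightarrow> v' p = 0 \<Longrightarrow> h p = 0" for h :: "real \<Rightarrow> real"
    using that v_zero v'_zero
    by (intro integral_of_supported(1) [of p1 p2]) (auto intro: continuous_on_subset)
  let ?I = "\<lambda>h. (\<integral>p. h p \<partial>lborel) / (2 * pi)"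
  have i: "integrable lborel (\<lambda>p. (cmod (v' p))\<^sup>2)" "integrable lborel W" "integrable lborel (\<lambda>p. f1 p * W p)"
    "integrable lborel (\<lambda>p. (f1 p)\<^sup>2 * W p)" "integrable lborel \<rho>" "integrable lborel (\<lambda>p. f1 p * \<rho> p)"
    by (rule int; force simp: \<rho>_def [abs_def] W_def [abs_def] intro!: continuous_intros cont_v cont_v' cont_f1)+
  have one: "?I W = 1" using packet_unit(3) by (simp add: W_def)
  have pt: "(cmod (g' \<tau> \<xi> p))\<^sup>2 = (cmod (v' p))\<^sup>2 + \<tau>\<^sup>2 * ((f1 p)\<^sup>2 * W p) - 2 * \<tau> * \<xi> * (f1 p * W p) + \<xi>\<^sup>2 * W p
      - 2 * \<tau> * (f1 p * \<rho> p) + 2 * \<xi> * \<rho> p" for \<tau> \<xi> p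
    unfolding norm_g' cmod_power2 W_def \<rho>_def by (simp add: power2_eq_square algebra_simps)
  have "spread \<tau> \<xi> = ?I (\<lambda>p. (cmod (v' p))\<^sup>2) + ?I (\<lambda>p. (f1 p)\<^sup>2 * W p) * \<tau>\<^sup>2 - 2 * ?I (\<lambda>p. f1 p * W p) * \<tau> * \<xi> + \<xi>\<^sup>2
      + (- 2 * ?I (\<lambda>p. f1 p * \<rho> p)) * \<tau> + 2 * ?I \<rho> * \<xi>" for \<tau> \<xi>
  proof -
    have "(\<integral>p. (cmod (g' \<tau> \<xi> p))\<^sup>2 \<partial>lborel) = (\<integral>p. (cmod (v' p))\<^sup>2 \<partial>lborel) + \<tau>\<^sup>2 * (\<integral>p. (f1 p)\<^sup>2 * W p \<partial>lborel)
       - 2 * \<tau> * \<xi> * (\<integral>p. f1 p * W p \<partial>lborel) + \<xi>\<^sup>2 * (\<integral>p. W p \<partial>lborel) - 2 * \<tau> * (\<integral>p. f1 p * \<rho> p \<partial>lborel) + 2 * \<xi> * (\<integral>p. \<rho> p \<partial>lborel)"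
      unfolding pt using i by simp
    also have "(\<integral>p. W p \<partial>lborel) = 2 * pi" using packet_unit(3) by (simp add: W_def)
    finally show ?thesis unfolding spread_def by (simp only:) (simp add: add_divide_distrib diff_divide_distrib ac_simps)
  qed
  moreover have "(?I (\<lambda>p. f1 p * W p))\<^sup>2 < ?I (\<lambda>p. (f1 p)\<^sup>2 * W p)"
  proof -
    define B where "B = ?I (\<lambda>p. f1 p * W p)"
    have "(\<integral>p. (f1 p - B)\<^sup>2 * W p \<partial>lborel) = (\<integral>p. (f1 p)\<^sup>2 * W p - 2 * B * (f1 p * W p) + B\<^sup>2 * W p \<partial>lborel)"
      by (intro Bochner_Integration.integral_cong) (simp_all add: power2_eq_square algebra_simps)
    also have "\<dots> = (\<integral>p. (f1 p)\<^sup>2 * W p \<partial>lborel) - 2 * B * (\<integral>p. f1 p * W p \<partial>lborel) + B\<^sup>2 * (\<integral>p. W p \<partial>lborel)"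
      using i by simp
    finally have e: "?I (\<lambda>p. (f1 p - B)\<^sup>2 * W p) = ?I (\<lambda>p. (f1 p)\<^sup>2 * W p) - 2 * B * B + B\<^sup>2 * 1"
      unfolding one [symmetric] B_def by (simp add: diff_divide_distrib add_divide_distrib)
    have cont: "continuous_on A (\<lambda>p. (f1 p - B)\<^sup>2 * W p)" for A
      unfolding W_def by (intro continuous_intros cont_f1 cont_v)
    have "(\<integral>p. (f1 p - B)\<^sup>2 * W p \<partial>lborel) = integral {p1..p2} (\<lambda>p. (f1 p - B)\<^sup>2 * W p)"
    proof (rule integral_of_supported(2) [OF cont])
      fix p assume "p \<notin> {p1..p2}"
      then have "p \<notin> {p1<..<p2}" by auto
      from v_zero [OF this] show "(f1 p - B)\<^sup>2 * W p = 0" by (simp add: W_def)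
    qed
    moreover have "integral {p1..p2} (\<lambda>p. (f1 p - B)\<^sup>2 * W p) \<noteq> 0"
    proof
      assume "integral {p1..p2} (\<lambda>p. (f1 p - B)\<^sup>2 * W p) = 0"
      then have z: "\<forall>p\<in>{p1..p2}. (f1 p - B)\<^sup>2 * W p = 0"
        by (subst (asm) integral_eq_0_iff [OF cont p12]) (auto simp: W_def)
      then have z': "f1 p = B \<or> v p = 0" for p
      proof (cases "p \<in> {p1..p2}")
        case True
        then show ?thesis using z by (auto simp: W_def)
      next
        case False
        then have "p \<notin> {p1<..<p2}" by auto
        then show ?thesis using v_zero by blast
      qed
      have "AE p in lborel. v p = 0"
      proof (cases "\<exists>p. f1 p = B")
        case True
        then obtain p where p: "f1 p = B" by blast
        have inj: "f1 q \<noteq> f1 p" if "q \<noteq> p" for q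
          using that DERIV_pos_imp_increasing [of q p f1] DERIV_pos_imp_increasing [of p q f1]
            is_symbol_derivs(2,4) [OF symbol] by (metis less_irrefl linorder_neqE_linordered_idom)
        have "AE q in lborel. q \<noteq> p" by (rule AE_lborel_singleton)
        then show ?thesis by (rule eventually_mono) (use z' inj p in metis)
      next
        case False
        then show ?thesis using z' by auto
      qed
      then have "AE p in lborel. (cmod (v p))\<^sup>2 = 0" by (auto elim: eventually_mono)
      then have "(\<integral>p. (cmod (v p))\<^sup>2 \<partial>lborel) = 0" by (rule integral_eq_zero_AE)
      then show False using packet_unit(3) by simp
    qed
    moreover have "(\<integral>p. (f1 p - B)\<^sup>2 * W p \<partial>lborel) \<ge> 0" by (simp add: W_def)
    ultimately have "?I (\<lambda>p. (f1 p - B)\<^sup>2 * W p) > 0" by (auto simp: less_le)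
    with e show ?thesis unfolding B_def [symmetric] by (simp add: power2_eq_square)
  qed
  ultimately show ?thesis by (rule that)
qed

text \<open>Comparing coefficients in \<open>\<xi>\<close> shows that the mean position moves uniformly with velocity \<open>B\<close>; the
  variance is then a parabola in \<open>\<tau>\<close> with leading coefficient \<open>C - B\<^sup>2 > 0\<close>.\<close>

lemma variance_minimum:
  obtains T where
    "\<And>\<tau>. pos_variance (wave_packet f u0 T) \<le> pos_variance (wave_packet f u0 \<tau>)"
    "\<And>\<tau>. pos_variance (wave_packet f u0 \<tau>) \<le> pos_variance (wave_packet f u0 T) \<Longrightarrow> \<tau> = T"
proof -
  obtain A C B D E where spread: "\<And>\<tau> \<xi>. spread \<tau> \<xi> = A + C * \<tau>\<^sup>2 - 2 * B * \<tau> * \<xi> + \<xi>\<^sup>2 + D * \<tau> + E * \<xi>" and BC: "B\<^sup>2 < C"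
    by (rule spread_quadratic, rule that)
  have M2: "moment2 (wave_packet f u0 \<tau>) = A + C * \<tau>\<^sup>2 + D * \<tau>" for \<tau>
    using spread_eq_moments [of \<tau> 0] spread [of \<tau> 0] by simp
  have M1: "moment1 (wave_packet f u0 \<tau>) = B * \<tau> - E / 2" for \<tau>
    using spread_eq_moments [of \<tau> 1] spread [of \<tau> 1] M2 [of \<tau>] by simp
  \<comment> \<open>Complete the square in \<open>\<tau>\<close>.\<close>
  define a where "a = C - B\<^sup>2"
  define b where "b = D + B * E"
  have a: "a > 0" using BC by (simp add: a_def)
  have V: "pos_variance (wave_packet f u0 \<tau>) = A - E\<^sup>2 / 4 - b\<^sup>2 / (4 * a) + a * (\<tau> - (- b / (2 * a)))\<^sup>2" for \<tau>
  proof -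
    have "a * (\<tau> - (- b / (2 * a)))\<^sup>2 = a * \<tau>\<^sup>2 + b * \<tau> + b\<^sup>2 / (4 * a)"
      using a by (simp add: power2_eq_square field_simps)
    moreover have "pos_variance (wave_packet f u0 \<tau>) = A - E\<^sup>2 / 4 + a * \<tau>\<^sup>2 + b * \<tau>"
      unfolding pos_variance_def M1 M2 a_def b_def by (simp add: power2_eq_square field_simps)
    ultimately show ?thesis by simp
  qed
  show ?thesis
  proof (rule that [of "- b / (2 * a)"])
    show "pos_variance (wave_packet f u0 (- b / (2 * a))) \<le> pos_variance (wave_packet f u0 \<tau>)" for \<tau>
      unfolding V using a by simp
    fix \<tau> assume "pos_variance (wave_packet f u0 \<tau>) \<le> pos_variance (wave_packet f u0 (- b / (2 * a)))"
    then have "a * (\<tau> - (- b / (2 * a)))\<^sup>2 \<le> 0" unfolding V by simp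
    then have "(\<tau> - (- b / (2 * a)))\<^sup>2 \<le> 0" using a by (simp add: mult_le_0_iff)
    then show "\<tau> = - b / (2 * a)" by simp
  qed
qed

lemma pos_variance_eq_spread: "pos_variance (wave_packet f u0 \<tau>) = spread \<tau> (moment1 (wave_packet f u0 \<tau>))"
  unfolding spread_eq_moments pos_variance_def by (simp add: power2_eq_square)

lemma pos_variance_le_spread: "pos_variance (wave_packet f u0 \<tau>) \<le> spread \<tau> \<xi>"
proof -
  have "spread \<tau> \<xi> - pos_variance (wave_packet f u0 \<tau>) = (\<xi> - moment1 (wave_packet f u0 \<tau>))\<^sup>2"
    unfolding spread_eq_moments pos_variance_def by (simp add: power2_eq_square algebra_simps)
  moreover have "0 \<le> (\<xi> - moment1 (wave_packet f u0 \<tau>))\<^sup>2" by simp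
  ultimately show ?thesis by linarith
qed

section \<open>Estimates inside and outside the cone\<close>

lemma margins:
  assumes "{p1..p2} \<subseteq> {q1<..<q2}"
  shows "q1 < p1" "p2 < q2"
proof -
  have "p1 \<in> {p1..p2}" "p2 \<in> {p1..p2}" using p12 by auto
  then have "p1 \<in> {q1<..<q2}" "p2 \<in> {q1<..<q2}" using assms by (meson subsetD)+
  then show "q1 < p1" "p2 < q2" by auto
qed

lemma f1_strict_mono: "a < b \<Longrightarrow> f1 a < f1 b"
  using DERIV_pos_imp_increasing [of a b f1] is_symbol_derivs(2,4) [OF symbol] by blast

text \<open>The phase \<open>-tf(p) + xp\<close> is split into the part for the origin \<open>(t0, x0)\<close>, which goes into \<open>g\<close>, and the part for
  the elapsed time, whose stationary points depend only on the slope \<open>(x - x0)/(t - t0)\<close>.\<close>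

lemma packet_as_phase_integral:
  assumes t: "t \<noteq> t0" and ab: "a \<le> p1" "p2 \<le> b"
  shows "wave_packet f u0 t x = 1 / (2 * pi) *
     integral {a..b} (\<lambda>p. g t0 x0 p * exp (\<i> * complex_of_real (t - t0) * complex_of_real ((x - x0) / (t - t0) * p - f p)))"
proof -
  define c where "c = (x - x0) / (t - t0)"
  have c: "(t - t0) * c = x - x0" using t by (simp add: c_def)
  have "v p * exp (- \<i> * t * f p + \<i> * x * p) = g t0 x0 p * exp (\<i> * complex_of_real (t - t0) * complex_of_real (c * p - f p))" for p
  proof -
    have "(x0 * p - t0 * f p) + (t - t0) * (c * p - f p) = (x0 * p - t0 * f p) + ((t - t0) * c) * p - (t - t0) * f p"
      by (simp add: algebra_simps)
    also have "\<dots> = x * p - t * f p" unfolding c by (simp add: algebra_simps)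
    finally have "exp (\<i> * of_real (x0 * p - t0 * f p)) * exp (\<i> * complex_of_real (t - t0) * complex_of_real (c * p - f p))
        = exp (\<i> * of_real (x * p - t * f p))"
      unfolding exp_add [symmetric] mult.assoc of_real_mult [symmetric] distrib_left [symmetric] of_real_add [symmetric] by simp
    moreover have "- \<i> * t * f p + \<i> * x * p = \<i> * of_real (x * p - t * f p)" by (simp add: algebra_simps)
    ultimately show ?thesis unfolding g_def by (simp add: mult.assoc)
  qed
  then have "wave_packet f u0 t x = 1 / (2 * pi) * (\<integral>p. g t0 x0 p * exp (\<i> * complex_of_real (t - t0) * complex_of_real (c * p - f p)) \<partial>lborel)"
    by (simp add: wave_packet_def)
  also have "(\<integral>p. g t0 x0 p * exp (\<i> * complex_of_real (t - t0) * complex_of_real (c * p - f p)) \<partial>lborel)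
     = integral {a..b} (\<lambda>p. g t0 x0 p * exp (\<i> * complex_of_real (t - t0) * complex_of_real (c * p - f p)))"
  proof (rule integral_of_supported(2))
    show "continuous_on {a..b} (\<lambda>p. g t0 x0 p * exp (\<i> * complex_of_real (t - t0) * complex_of_real (c * p - f p)))"
      by (intro continuous_intros cont_g cont_f)
    fix p assume "p \<notin> {a..b}"
    then have "p \<notin> {p1<..<p2}" using ab by auto
    from g_zero [OF this] show "g t0 x0 p * exp (\<i> * complex_of_real (t - t0) * complex_of_real (c * p - f p)) = 0" by simp
  qed
  finally show ?thesis by (simp add: c_def)
qed

lemma integral_g'_sq:
  assumes ab: "a \<le> p1" "p2 \<le> b"
  shows "integral {a..b} (\<lambda>p. (cmod (g' t0 x0 p))\<^sup>2) = (sqrt (2 * pi) * sqrt (spread t0 x0))\<^sup>2"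
proof -
  have "(\<integral>p. (cmod (g' t0 x0 p))\<^sup>2 \<partial>lborel) = integral {a..b} (\<lambda>p. (cmod (g' t0 x0 p))\<^sup>2)"
  proof (rule integral_of_supported(2))
    show "continuous_on {a..b} (\<lambda>p. (cmod (g' t0 x0 p))\<^sup>2)" by (intro continuous_intros cont_g')
    fix p assume "p \<notin> {a..b}"
    then have "p \<notin> {p1..p2}" using ab by auto
    from g'_zero [OF this] show "(cmod (g' t0 x0 p))\<^sup>2 = 0" by simp
  qed
  moreover have "(sqrt (2 * pi) * sqrt (spread t0 x0))\<^sup>2 = 2 * pi * spread t0 x0"
    using spread_nonneg [of t0 x0] by (simp add: power_mult_distrib)
  ultimately show ?thesis by (simp add: spread_def)
qed

lemma packet_outside_cone:
  assumes sub: "{p1..p2} \<subseteq> {q1<..<q2}" and tx: "(t, x) \<in> st_cone_compl f q1 q2 (t0, x0)"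
  shows "cmod (wave_packet f u0 t x) \<le> rhs_out f u0 p1 p2 q1 q2 (t0, x0) (t - t0)"
proof -
  note q = margins [OF sub]
  have t: "t \<noteq> t0" using tx by (auto simp: st_cone_compl_def)
  define c where "c = (x - x0) / (t - t0)"
  have c: "c < f1 q1 \<or> f1 q2 < c"
    using tx by (auto simp: st_cone_compl_def st_cone_def c_def not_le)
  define \<mu> where "\<mu> = min (f1 p1 - f1 q1) (f1 q2 - f1 p2)"
  have \<mu>: "\<mu> > 0" using f1_strict_mono q by (simp add: \<mu>_def)
  have mono: "f1 p1 \<le> f1 p" "f1 p \<le> f1 p2" if "p \<in> {p1..p2}" for p
    using f1_strict_mono [of p1 p] f1_strict_mono [of p p2] that by (cases "p = p1"; cases "p = p2"; force)+
  have sep: "(\<forall>p\<in>{p1..p2}. \<mu> \<le> c - f1 p) \<or> (\<forall>p\<in>{p1..p2}. \<mu> \<le> f1 p - c)"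
    using c
  proof
    assume "c < f1 q1"
    then have "\<forall>p\<in>{p1..p2}. \<mu> \<le> f1 p - c" using mono unfolding \<mu>_def by fastforce
    then show ?thesis ..
  next
    assume "f1 q2 < c"
    then have "\<forall>p\<in>{p1..p2}. \<mu> \<le> c - f1 p" using mono unfolding \<mu>_def by fastforce
    then show ?thesis ..
  qed
  define I where "I = integral {p1..p2} (\<lambda>p. g t0 x0 p * exp (\<i> * complex_of_real (t - t0) * complex_of_real (c * p - f p)))"
  have u: "wave_packet f u0 t x = 1 / (2 * pi) * I"
    unfolding I_def c_def by (rule packet_as_phase_integral [OF t]) auto
  have "cmod I
     \<le> (sqrt (2 * pi) * sqrt (spread t0 x0) * sqrt (p2 - p1) + L1_norm u0) / (\<mu> * \<bar>t - t0\<bar>)"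
    unfolding I_def
    by (rule nonstationary_phase [OF is_symbol_derivs(1,2) [OF symbol] is_symbol_derivs(4) [OF symbol] _ \<mu> sep g_deriv cont_g' _ _ norm_g_le])
       (use p12 t spread_nonneg integral_g'_sq in \<open>auto simp: g_zero\<close>)
  then have "cmod (wave_packet f u0 t x) \<le> 1 / (2 * pi) * ((sqrt (2 * pi) * sqrt (spread t0 x0) * sqrt (p2 - p1) + L1_norm u0) / (\<mu> * \<bar>t - t0\<bar>))"
    unfolding u norm_mult by (intro mult_mono) (auto simp: norm_divide norm_mult)
  also have "\<dots> = (sqrt (2 * pi) / (2 * pi) * sqrt (p2 - p1) * inverse \<mu> * sqrt (spread t0 x0) + 1 / (2 * pi) * inverse \<mu> * L1_norm u0) * inverse \<bar>t - t0\<bar>"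
  proof -
    have "1 / (2 * pi) * ((a * b * c + d) / (m * S)) = (a / (2 * pi) * c * inverse m * b + 1 / (2 * pi) * inverse m * d) * inverse S"
      if "m \<noteq> 0" "S \<noteq> 0" for a b c d m S :: real
      using that by (simp add: field_simps)
    then show ?thesis using \<mu> t by simp
  qed
  also have "sqrt (2 * pi) / (2 * pi) = 1 / sqrt (2 * pi)" by (simp add: real_div_sqrt field_simps)
  finally show ?thesis
    unfolding rhs_out_def prod.case C7_def C8_def L2_norm_packet \<mu>_def
    using p12 by (simp add: powr_half_sqrt)
qed

text \<open>The cone condition places the slope \<open>c\<close> between \<open>f'(q1)\<close> and \<open>f'(q2)\<close>, so \<open>f' = c\<close> has its
  solution \<open>p0\<close> in \<open>[q1, q2]\<close>. The value \<open>e\<^bsup>is(c p0 - f(p0))\<^esup>\<close> of the phase at that point is factored out, and what remains is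
  \<open>stationary_phase\<close> on \<open>[q1, q2]\<close>, at whose end points \<open>g\<close> vanishes.\<close>

lemma packet_in_cone:
  assumes sub: "{p1..p2} \<subseteq> {q1<..<q2}" and tx: "(t, x) \<in> st_cone f q1 q2 (t0, x0)"
    and \<delta>: "1/2 < \<delta>" "\<delta> < 3/4"
  shows "cmod (wave_packet f u0 t x - leading_term f u0 (t0, x0) t x) \<le> rhs_in f u0 \<delta> q1 q2 (t0, x0) (t - t0)"
proof -
  note q = margins [OF sub]
  have q12: "q1 < q2" using q p12 by simp
  have t: "t \<noteq> t0" using tx by (auto simp: st_cone_def)
  define s where "s = t - t0"
  have s: "s \<noteq> 0" using t by (simp add: s_def)
  define c where "c = (x - x0) / (t - t0)"
  have c: "f1 q1 \<le> c" "c \<le> f1 q2" using tx by (auto simp: st_cone_def c_def)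
  obtain p0 where p0: "p0 \<in> {q1..q2}" "f1 p0 = c"
    using IVT' [OF c less_imp_le [OF q12] cont_f1] by auto
  have "inj f1" by (rule injI) (metis f1_strict_mono less_irrefl linorder_neqE_linordered_idom)
  then have sm: "stat_momentum f (t0, x0) t x = p0"
    unfolding stat_momentum_def by (simp add: c_def [symmetric] p0(2) [symmetric])
  define m where "m = (INF p\<in>{q1..q2}. f2 p)"
  define M where "M = Linf_norm q1 q2 f2"
  define N where "N = Linf_norm q1 q2 ((deriv ^^ 3) f)"
  define \<sigma> where "\<sigma> = sqrt (spread t0 x0)"
  define \<theta> where "\<theta> = exp (- (complex_of_real (sgn s)) * \<i> * (pi / 4))"
  obtain pm where pm: "pm \<in> {q1..q2}" "\<And>p. p \<in> {q1..q2} \<Longrightarrow> f2 pm \<le> f2 p"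
    using continuous_attains_inf [of "{q1..q2}" f2] q12 cont_f2 by auto
  have "m = f2 pm" unfolding m_def using pm by (intro cInf_eq_minimum) auto
  then have m: "m > 0" "\<And>p. p \<in> {q1..q2} \<Longrightarrow> m \<le> f2 p"
    using pm is_symbol_derivs(4) [OF symbol] by auto
  have M: "f2 p \<le> M" if "p \<in> {q1..q2}" for p
    using abs_le_Linf_norm [OF cont_f2 q12 that] unfolding M_def by linarith
  have N: "\<bar>(deriv ^^ 3) f p\<bar> \<le> N" if "p \<in> {q1..q2}" for p
    unfolding N_def by (rule abs_le_Linf_norm [OF is_symbol_derivs(5) [OF symbol] q12 that])
  have mM: "m \<le> M" using m(2) M p0(1) order_trans by blast
  have N0: "0 \<le> N" using N [OF p0(1)] by linarith
  have gq: "g t0 x0 q1 = 0" "g t0 x0 q2 = 0" using q by (auto intro!: g_zero)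
  define J where "J = integral {q1..q2} (\<lambda>p. g t0 x0 p * exp (- \<i> * s * complex_of_real (f p - f p0 - f1 p0 * (p - p0))))"
  define lead where "lead = g t0 x0 p0 * complex_of_real (sqrt (2 * pi / f2 p0)) * (\<theta> * complex_of_real (\<bar>s\<bar> powr (-1/2)))"
  define A where "A = (m / 2) powr (1/2 - \<delta>) * (2 * sqrt (M / 2) / m) * sqrt (2 * pi) * sqrt ((q2 - q1) powr (3 - 4 * \<delta>) / (3 - 4 * \<delta>))"
  define B where "B = (m / 2) powr (1/2 - \<delta>) * (N * M / (3 * m\<^sup>2 * sqrt (m / 2))) * ((q2 - q1) powr (2 - 2 * \<delta>) / (2 - 2 * \<delta>))"
  have "cmod (J - lead) \<le> 2 * (L_const \<delta> * \<bar>s\<bar> powr (-\<delta>) * (m / 2) powr (1/2 - \<delta>) *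
        (2 * sqrt (M / 2) / m * (sqrt (2 * pi) * \<sigma>) * sqrt ((q2 - q1) powr (3 - 4 * \<delta>) / (3 - 4 * \<delta>))
         + L1_norm u0 * (N * M / (3 * m\<^sup>2 * sqrt (m / 2))) * ((q2 - q1) powr (2 - 2 * \<delta>) / (2 - 2 * \<delta>))))"
    unfolding J_def lead_def \<theta>_def
  proof (rule stationary_phase [OF is_symbol_derivs(1,2,3,4) [OF symbol] p0(1) m M N g_deriv cont_g' gq norm_g_le _ _ s \<delta>])
    show "integral {q1..q2} (\<lambda>x. (cmod (g' t0 x0 x))\<^sup>2) \<le> (sqrt (2 * pi) * \<sigma>)\<^sup>2"
      using integral_g'_sq [of q1 q2] q by (simp add: \<sigma>_def)
    show "0 \<le> sqrt (2 * pi) * \<sigma>" by (simp add: \<sigma>_def spread_nonneg)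
  qed
  also have "\<dots> = 2 * (L_const \<delta> * A * \<sigma> + L_const \<delta> * B * L1_norm u0) * \<bar>s\<bar> powr (-\<delta>)"
    unfolding A_def B_def by (simp add: algebra_simps)
  finally have est: "cmod (J - lead) \<le> 2 * (L_const \<delta> * A * \<sigma> + L_const \<delta> * B * L1_norm u0) * \<bar>s\<bar> powr (-\<delta>)" .
  define e0 where "e0 = exp (\<i> * s * complex_of_real (c * p0 - f p0))"
  have ne0: "cmod e0 = 1" by (simp add: e0_def)
  have u: "wave_packet f u0 t x = 1 / (2 * pi) * (e0 * J)"
  proof -
    have "g t0 x0 p * exp (\<i> * complex_of_real (t - t0) * complex_of_real (c * p - f p))
       = e0 * (g t0 x0 p * exp (- \<i> * s * complex_of_real (f p - f p0 - f1 p0 * (p - p0))))" for p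
    proof -
      have "\<i> * complex_of_real (t - t0) * complex_of_real (c * p - f p)
        = \<i> * s * complex_of_real (c * p0 - f p0) + (- \<i> * s * complex_of_real (f p - f p0 - f1 p0 * (p - p0)))"
        unfolding p0(2) by (simp add: s_def algebra_simps)
      then show ?thesis by (simp only: exp_add e0_def) simp
    qed
    then have "integral {q1..q2} (\<lambda>p. g t0 x0 p * exp (\<i> * complex_of_real (t - t0) * complex_of_real (c * p - f p))) = e0 * J"
      unfolding J_def by (simp only: Henstock_Kurzweil_Integration.integral_mult_right)
    then show ?thesis
      using packet_as_phase_integral [OF t less_imp_le [OF q(1)] less_imp_le [OF q(2)], of x x0]
      by (simp only: c_def [symmetric])
  qed
  have l: "leading_term f u0 (t0, x0) t x = 1 / (2 * pi) * (e0 * lead)"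
  proof -
    have ex: "exp (- \<i> * t * f p0 + \<i> * x * p0) = exp (\<i> * of_real (x0 * p0 - t0 * f p0)) * e0"
    proof -
      have xs: "x = x0 + s * c" using s by (simp add: c_def s_def)
      have "x * p0 - t * f p0 = (x0 * p0 - t0 * f p0) + s * (c * p0 - f p0)"
        unfolding xs by (simp add: s_def algebra_simps)
      then have "\<i> * complex_of_real (x * p0 - t * f p0) = \<i> * of_real (x0 * p0 - t0 * f p0) + \<i> * s * complex_of_real (c * p0 - f p0)"
        by (simp only: of_real_add of_real_mult distrib_left mult.assoc)
      then have "- \<i> * t * f p0 + \<i> * x * p0 = \<i> * of_real (x0 * p0 - t0 * f p0) + \<i> * s * complex_of_real (c * p0 - f p0)"
        by (simp add: algebra_simps)
      then show ?thesis by (simp only: exp_add e0_def)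
    qed
    have "sqrt (2 * pi) / (2 * pi) = 1 / sqrt (2 * pi)" by (simp add: real_div_sqrt field_simps)
    then have "sqrt (2 * pi / f2 p0) / (2 * pi) = 1 / sqrt (2 * pi) / sqrt (f2 p0)"
      by (simp only: real_sqrt_divide divide_divide_eq_left mult.commute [of "sqrt (f2 p0)"])
         (simp only: divide_divide_eq_left [symmetric])
    then have "complex_of_real (sqrt (2 * pi / f2 p0) / (2 * pi)) = complex_of_real (1 / sqrt (2 * pi) / sqrt (f2 p0))"
      by (simp only:)
    then have sq: "complex_of_real (sqrt (2 * pi / f2 p0)) / (2 * complex_of_real pi) = 1 / complex_of_real (sqrt (2 * pi)) / complex_of_real (sqrt (f2 p0))"
      by (simp only: of_real_divide of_real_mult of_real_1 of_real_numeral)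
    have "1 / (2 * pi) * (e0 * lead) = complex_of_real (sqrt (2 * pi / f2 p0)) / (2 * complex_of_real pi)
        * (e0 * (g t0 x0 p0 * (\<theta> * complex_of_real (\<bar>s\<bar> powr (-1/2)))))"
      unfolding lead_def by simp
    also have "\<dots> = 1 / sqrt (2 * pi) * \<theta> * (exp (\<i> * of_real (x0 * p0 - t0 * f p0)) * e0)
       * (v p0 / complex_of_real (sqrt (f2 p0))) * complex_of_real (\<bar>s\<bar> powr (-1/2))"
      unfolding sq g_def by simp
    also have "\<dots> = leading_term f u0 (t0, x0) t x"
      unfolding ex [symmetric] leading_term_def Let_def prod.case sm \<theta>_def s_def by simp
    finally show ?thesis ..
  qed
  have "wave_packet f u0 t x - leading_term f u0 (t0, x0) t x = 1 / (2 * pi) * (e0 * (J - lead))"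
    unfolding u l by (simp add: right_diff_distrib diff_divide_distrib)
  then have "cmod (wave_packet f u0 t x - leading_term f u0 (t0, x0) t x) = 1 / (2 * pi) * cmod (J - lead)"
    by (simp add: norm_mult norm_divide ne0)
  also have "\<dots> \<le> 1 / (2 * pi) * (2 * (L_const \<delta> * A * \<sigma> + L_const \<delta> * B * L1_norm u0) * \<bar>s\<bar> powr (-\<delta>))"
    using est by (intro mult_left_mono) auto
  also have "\<dots> = (1 / pi * L_const \<delta> * A * \<sigma> + 1 / pi * L_const \<delta> * B * L1_norm u0) * \<bar>s\<bar> powr (-\<delta>)"
    by (simp add: field_simps)
  also have "\<dots> \<le> (C5 f \<delta> q1 q2 * \<sigma> + C6 f \<delta> q1 q2 * L1_norm u0) * \<bar>s\<bar> powr (-\<delta>)"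
  proof (intro mult_right_mono add_mono)
    show "1 / pi * L_const \<delta> * A \<le> C5 f \<delta> q1 q2"
      using C5_dominates [OF \<delta>(2) m(1) mM]
      unfolding C5_def Let_def m_def [symmetric] M_def [symmetric] A_def by (simp only: mult.assoc)
    show "1 / pi * L_const \<delta> * B \<le> C6 f \<delta> q1 q2"
      using C6_dominates [OF \<delta>(2) m(1) mM N0]
      unfolding C6_def Let_def m_def [symmetric] M_def [symmetric] N_def [symmetric] B_def by (simp only: mult.assoc)
  qed (auto simp: \<sigma>_def spread_nonneg L1_norm_def)
  finally show ?thesis unfolding rhs_in_def prod.case L2_norm_packet \<sigma>_def s_def .
qed

lemma C5_nonneg: "\<delta> < 3/4 \<Longrightarrow> C5 f \<delta> q1 q2 \<ge> 0"
  by (simp add: C5_def Let_def L_const_def)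

lemma C7_nonneg: "{p1..p2} \<subseteq> {q1<..<q2} \<Longrightarrow> C7 f p1 p2 q1 q2 \<ge> 0"
proof -
  assume "{p1..p2} \<subseteq> {q1<..<q2}"
  from margins [OF this] show ?thesis using f1_strict_mono [of q1 p1] f1_strict_mono [of p2 q2] by (simp add: C7_def)
qed

end

theorem corollary3p7:
  fixes f :: "real \<Rightarrow> real" and u0 :: "real \<Rightarrow> complex" and p1 p2 q1 q2 :: real
  assumes "p1 < p2"
    and "{p1..p2} \<subseteq> {q1<..<q2}"
    and "is_symbol f"
    and "schwartz u0"
    and "closure {p. fourier u0 p \<noteq> 0} \<subseteq> {p1..p2}"
    and "L2_norm u0 = 1"
  shows "(\<exists>!\<tau>. is_arg_min (\<lambda>\<tau>. pos_variance (wave_packet f u0 \<tau>)) (\<lambda>_. True) \<tau>) \<and>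
         (let ts = arg_min (\<lambda>\<tau>. pos_variance (wave_packet f u0 \<tau>)) (\<lambda>_. True);
              xs = moment1 (wave_packet f u0 ts);
              \<sigma> = (INF \<tau>. sqrt (pos_variance (wave_packet f u0 \<tau>)))
         in (\<forall>\<delta>\<in>{1/2<..<3/4}. \<forall>s. s \<noteq> 0 \<longrightarrow>
               is_arg_min (\<lambda>z. rhs_in f u0 \<delta> q1 q2 z s) (\<lambda>_. True) (ts, xs))
          \<and> (\<forall>s. s \<noteq> 0 \<longrightarrow>
               is_arg_min (\<lambda>z. rhs_out f u0 p1 p2 q1 q2 z s) (\<lambda>_. True) (ts, xs))
          \<and> (\<forall>\<delta>\<in>{1/2<..<3/4}. \<forall>(t, x)\<in>st_cone f q1 q2 (ts, xs).
               cmod (wave_packet f u0 t x - leading_term f u0 (ts, xs) t x)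
                 \<le> (C5 f \<delta> q1 q2 * \<sigma> + C6 f \<delta> q1 q2 * L1_norm u0) * \<bar>t - ts\<bar> powr (- \<delta>))
          \<and> (\<forall>(t, x)\<in>st_cone_compl f q1 q2 (ts, xs).
               cmod (wave_packet f u0 t x)
                 \<le> (C7 f p1 p2 q1 q2 * \<sigma> + C8 f p1 p2 q1 q2 * L1_norm u0) * inverse \<bar>t - ts\<bar>))"
proof -
  interpret localised_packet f u0 p1 p2 using assms by unfold_locales
  let ?V = "\<lambda>\<tau>. pos_variance (wave_packet f u0 \<tau>)"
  obtain T where T: "\<And>\<tau>. ?V T \<le> ?V \<tau>" "\<And>\<tau>. ?V \<tau> \<le> ?V T \<Longrightarrow> \<tau> = T"
    by (rule variance_minimum, rule that)
  have iff: "is_arg_min ?V (\<lambda>_. True) \<tau> \<longleftrightarrow> \<tau> = T" for \<tau>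
    unfolding is_arg_min_linorder using T by auto
  then have ex1: "\<exists>!\<tau>. is_arg_min ?V (\<lambda>_. True) \<tau>" by simp
  have ts: "arg_min ?V (\<lambda>_. True) = T" unfolding arg_min_def iff by simp
  define X where "X = moment1 (wave_packet f u0 T)"
  have VT: "spread T X = ?V T" unfolding X_def by (rule pos_variance_eq_spread [symmetric])
  have spread_min: "sqrt (spread T X) \<le> sqrt (spread t0 x0)" for t0 x0
    using T(1) [of t0] pos_variance_le_spread [of t0 x0] VT by simp
  have \<sigma>: "(INF \<tau>. sqrt (?V \<tau>)) = sqrt (spread T X)"
    unfolding VT using T(1) by (intro cInf_eq_minimum) auto
  have in_min: "is_arg_min (\<lambda>z. rhs_in f u0 \<delta> q1 q2 z s) (\<lambda>_. True) (T, X)" if "\<delta> \<in> {1/2<..<3/4}" for \<delta> s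
    unfolding is_arg_min_linorder
  proof (intro conjI allI impI TrueI)
    fix z :: "real \<times> real"
    obtain t0 x0 where z: "z = (t0, x0)" by (cases z)
    show "rhs_in f u0 \<delta> q1 q2 (T, X) s \<le> rhs_in f u0 \<delta> q1 q2 z s"
      unfolding z rhs_in_def prod.case L2_norm_packet
      using spread_min [of t0 x0] C5_nonneg [of \<delta> q1 q2] that
      by (intro mult_right_mono add_right_mono mult_left_mono) auto
  qed
  have out_min: "is_arg_min (\<lambda>z. rhs_out f u0 p1 p2 q1 q2 z s) (\<lambda>_. True) (T, X)" for s
    unfolding is_arg_min_linorder
  proof (intro conjI allI impI TrueI)
    fix z :: "real \<times> real"
    obtain t0 x0 where z: "z = (t0, x0)" by (cases z)
    show "rhs_out f u0 p1 p2 q1 q2 (T, X) s \<le> rhs_out f u0 p1 p2 q1 q2 z s"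
      unfolding z rhs_out_def prod.case L2_norm_packet
      using spread_min [of t0 x0] C7_nonneg [OF assms(2)]
      by (intro mult_right_mono add_right_mono mult_left_mono) auto
  qed
  have E1: "cmod (wave_packet f u0 t x - leading_term f u0 (T, X) t x)
     \<le> (C5 f \<delta> q1 q2 * sqrt (spread T X) + C6 f \<delta> q1 q2 * L1_norm u0) * \<bar>t - T\<bar> powr (- \<delta>)"
    if "\<delta> \<in> {1/2<..<3/4}" "(t, x) \<in> st_cone f q1 q2 (T, X)" for \<delta> t x
    using packet_in_cone [OF assms(2) that(2), of \<delta>] that(1) unfolding rhs_in_def prod.case L2_norm_packet by simp
  have E2: "cmod (wave_packet f u0 t x)
     \<le> (C7 f p1 p2 q1 q2 * sqrt (spread T X) + C8 f p1 p2 q1 q2 * L1_norm u0) * inverse \<bar>t - T\<bar>"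
    if "(t, x) \<in> st_cone_compl f q1 q2 (T, X)" for t x
    using packet_outside_cone [OF assms(2) that] unfolding rhs_out_def prod.case L2_norm_packet .
  show ?thesis
    unfolding Let_def ts \<sigma> X_def [symmetric]
  proof (intro conjI)
    show "\<forall>\<delta>\<in>{1/2<..<3/4}. \<forall>(t, x)\<in>st_cone f q1 q2 (T, X).
               cmod (wave_packet f u0 t x - leading_term f u0 (T, X) t x)
                 \<le> (C5 f \<delta> q1 q2 * sqrt (spread T X) + C6 f \<delta> q1 q2 * L1_norm u0) * \<bar>t - T\<bar> powr (- \<delta>)"
      using E1 by fast
    show "\<forall>(t, x)\<in>st_cone_compl f q1 q2 (T, X).
               cmod (wave_packet f u0 t x)
                 \<le> (C7 f p1 p2 q1 q2 * sqrt (spread T X) + C8 f p1 p2 q1 q2 * L1_norm u0) * inverse \<bar>t - T\<bar>"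
      using E2 by fast
  qed (use ex1 in_min out_min in simp_all)
qed

end
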